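(* Let $0\le\theta<\rho\le1$ and let $G_1(x)=G(x,1)$, where $G$ is the entropy solution of $\partial_yG+\partial_x\varphi(G)=0$ on $\mathbb R\times[0,1]$ with $G(x,0)=\theta\mathbf 1_{x\le0}+\rho\mathbf 1_{x>0}$. Fix $u\in\mathbb R$ a continuity point of $G_1$ and set $\sigma=G(u,1)$. Then for any increasing sequence of integers $X_1<X_2<\cdots$ with $\lim_{T\to\infty}X_T/T=u$, $$\lim_{T\to\infty}\mathfrak S_{X_T}\mathfrak M_T\Upsilon^{(\theta;\rho)}=\Upsilon^{(\sigma)}$$ (weak convergence of probability measures on $\{0,1\}^{\mathbb Z}$ with the product topology).
   Context: Fix $0<b_1<b_2<1$, $\kappa=\frac{1-b_1}{1-b_2}$, $\varphi(z)=\frac{\kappa z}{(\kappa-1)z+1}$; entropy solution means the unique Kružkov entropy weak solution. The stochastic six-vertex model is the discrete-time Markov process on $\{0,1\}^{\mathbb Z}$: at step $t$ take independent $\chi_t(x)\sim$ Bernoulli$(b_1)$ and $j_t(x)$ with $P[j_t(x)=r]=(1-b_2)b_2^{r-1}$, $r\ge1$; label particles at time $t-1$ as $p_{t-1}(-M)<\dots<p_{t-1}(N)$ (with $\pm\infty$ conventions outside) and for $k=-M,\dots,N$, with $x=p_{t-1}(k)$: if $p_t(k-1)<x$, $p_t(k)=x$ when $\chi_t(x)=1$ and $p_t(k)=\min\{x+j_t(x),p_{t-1}(k+1)\}$ when $\chi_t(x)=0$; if $p_t(k-1)=x$, $p_t(k)=\min\{x+j_t(x),p_{t-1}(k+1)\}$;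 for infinitely many particles the same rules are applied via a Harris-type construction. $\mathfrak M_t\mu$ is the law at time $t$ of the model started from $\mu$; $\mathfrak S_m\mu$ is the law of $(\eta(x+m))_x$ for $\eta\sim\mu$. $\Upsilon^{(\sigma)}$ is product Bernoulli$(\sigma)$; $\Upsilon^{(\theta;\rho)}$ is the product measure with density $\theta$ at $x\le0$ and $\rho$ at $x>0$. *)

theory Defs
  imports "HOL-Probability.Probability"
begin

definition kappa :: "real \<Rightarrow> real \<Rightarrow> real" where
  "kappa b1 b2 = (1 - b1) / (1 - b2)"

definition phi :: "real \<Rightarrow> real \<Rightarrow> real \<Rightarrow> real" where
  "phi b1 b2 z = kappa b1 b2 * z / ((kappa b1 b2 - 1) * z + 1)"

definition test_fn :: "(real \<Rightarrow> real \<Rightarrow> real) \<Rightarrow> (real \<Rightarrow> real \<Rightarrow> real)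
    \<Rightarrow> (real \<Rightarrow> real \<Rightarrow> real) \<Rightarrow> bool" where
  "test_fn psi psix psiy \<longleftrightarrow>
     (\<forall>x y. ((\<lambda>x'. psi x' y) has_real_derivative psix x y) (at x)) \<and>
     (\<forall>x y. ((\<lambda>y'. psi x y') has_real_derivative psiy x y) (at y)) \<and>
     continuous_on UNIV (\<lambda>z. psix (fst z) (snd z)) \<and>
     continuous_on UNIV (\<lambda>z. psiy (fst z) (snd z)) \<and>
     (\<forall>x y. 0 \<le> psi x y) \<and>
     (\<exists>a b c d. 0 < c \<and> d < 1 \<and>
        (\<forall>x y. psi x y \<noteq> 0 \<longrightarrow> a \<le> x \<and> x \<le> b \<and> c \<le> y \<and> y \<le> d))"

text \<open>G x y: space variable x, time variable y \<in> [0,1]. Entropy solution of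
  d_y G + d_x f(G) = 0 with initial data G0, in the Kruzkov sense, with the
  (canonical) representative that is continuous in time with values in L^1_loc.\<close>
definition entropy_solution :: "(real \<Rightarrow> real) \<Rightarrow> (real \<Rightarrow> real) \<Rightarrow> (real \<Rightarrow> real \<Rightarrow> real) \<Rightarrow> bool" where
  "entropy_solution f G0 G \<longleftrightarrow>
     (\<lambda>z. G (fst z) (snd z)) \<in> borel_measurable borel \<and>
     (\<forall>x y. 0 \<le> G x y \<and> G x y \<le> 1) \<and>
     (\<forall>x. G x 0 = G0 x) \<and>
     (\<forall>R y0. y0 \<in> {0..1} \<longrightarrow>
        ((\<lambda>y. LINT x|lborel. indicator {-R..R} x * \<bar>G x y - G x y0\<bar>) \<longlongrightarrow> 0)
          (at y0 within {0..1})) \<and>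
     (\<forall>(k::real) psi psix psiy. test_fn psi psix psiy \<longrightarrow>
        0 \<le> (LINT z|(lborel :: (real \<times> real) measure).
               \<bar>G (fst z) (snd z) - k\<bar> * psiy (fst z) (snd z)
             + sgn (G (fst z) (snd z) - k) * (f (G (fst z) (snd z)) - f k) * psix (fst z) (snd z)))"

type_synonym config = "int \<Rightarrow> bool"

definition config_space :: "config measure" where
  "config_space = PiM UNIV (\<lambda>_. count_space UNIV)"

definition config_topology :: "config topology" where
  "config_topology = product_topology (\<lambda>_. discrete_topology UNIV) UNIV"

definition weak_conv_config :: "(nat \<Rightarrow> config measure) \<Rightarrow> config measure \<Rightarrow> bool" where
  "weak_conv_config mu nu \<longleftrightarrow>
     (\<forall>f. continuous_map config_topology euclideanreal f \<longrightarrow>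
        (\<lambda>T. integral\<^sup>L (mu T) f) \<longlonglongrightarrow> integral\<^sup>L nu f)"

definition Upsilon :: "real \<Rightarrow> config measure" where
  "Upsilon s = PiM UNIV (\<lambda>_. measure_pmf (bernoulli_pmf s))"

definition Upsilon2 :: "real \<Rightarrow> real \<Rightarrow> config measure" where
  "Upsilon2 th rh = PiM UNIV (\<lambda>x. measure_pmf (bernoulli_pmf (if x \<le> 0 then th else rh)))"

definition shiftM :: "int \<Rightarrow> config measure \<Rightarrow> config measure" where
  "shiftM m mu = distr mu config_space (\<lambda>eta x. eta (x + m))"

definition nxt :: "config \<Rightarrow> int \<Rightarrow> int option" where
  "nxt eta x = (if \<exists>y>x. eta y then Some (LEAST y. x < y \<and> eta y) else None)"

text \<open>chi x = True means chi_t(x) = 1 (the particle at x stays unless pushed);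
  j x \<ge> 1 is the jump variable j_t(x).  The particle at x moves iff some particle
  y \<le> x has chi y = 0 and every particle z in [y,x) reaches (pushes) its
  right neighbour, i.e. z + j z \<ge> next particle.  This is the Harris-type
  construction of the left-to-right sequential update.\<close>
definition moves :: "config \<Rightarrow> config \<Rightarrow> (int \<Rightarrow> nat) \<Rightarrow> int \<Rightarrow> bool" where
  "moves eta chi j x \<longleftrightarrow>
     (\<exists>y\<le>x. eta y \<and> \<not> chi y \<and>
        (\<forall>z. y \<le> z \<and> z < x \<and> eta z \<longrightarrow>
           (case nxt eta z of None \<Rightarrow> False | Some w \<Rightarrow> w \<le> z + int (j z))))"

definition newpos :: "config \<Rightarrow> config \<Rightarrow> (int \<Rightarrow> nat) \<Rightarrow> int \<Rightarrow> int" where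
  "newpos eta chi j x =
     (if moves eta chi j x then
        (case nxt eta x of None \<Rightarrow> x + int (j x) | Some w \<Rightarrow> min (x + int (j x)) w)
      else x)"

definition sv_step :: "config \<Rightarrow> config \<Rightarrow> (int \<Rightarrow> nat) \<Rightarrow> config" where
  "sv_step eta chi j = (\<lambda>y. \<exists>x. eta x \<and> newpos eta chi j x = y)"

definition noise_pmf :: "real \<Rightarrow> real \<Rightarrow> (bool \<times> nat) pmf" where
  "noise_pmf b1 b2 = pair_pmf (bernoulli_pmf b1) (map_pmf Suc (geometric_pmf (1 - b2)))"

definition noise_space :: "real \<Rightarrow> real \<Rightarrow> (nat \<times> int \<Rightarrow> bool \<times> nat) measure" where
  "noise_space b1 b2 = PiM UNIV (\<lambda>_. measure_pmf (noise_pmf b1 b2))"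

text \<open>omega (t, x) is the noise used in step t+1 at site x.\<close>
fun sv_iter :: "nat \<Rightarrow> config \<Rightarrow> (nat \<times> int \<Rightarrow> bool \<times> nat) \<Rightarrow> config" where
  "sv_iter 0 eta omega = eta"
| "sv_iter (Suc t) eta omega =
     sv_step (sv_iter t eta omega) (\<lambda>x. fst (omega (t, x))) (\<lambda>x. snd (omega (t, x)))"

definition sixv :: "real \<Rightarrow> real \<Rightarrow> config measure \<Rightarrow> nat \<Rightarrow> config measure" where
  "sixv b1 b2 mu T = distr (mu \<Otimes>\<^sub>M noise_space b1 b2) config_space
      (\<lambda>(eta, omega). sv_iter T eta omega)"

end

theory Submission
  imports Defs "HOL-Real_Asymp.Real_Asymp"
begin

text \<open>The flux is concave, so the entropy solution with data \<open>\<theta> < \<rho>\<close> is a shock moving with the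
  slope of the chord of the flux over \<open>{\<theta>..\<rho>}\<close>. On the lattice, Bernoulli data of
  density \<open>\<theta>\<close> to the left of the origin are stationary, so to the right of the origin the process is a
  six-vertex model in a quadrant whose left inputs are independent with probability \<open>flux \<theta>\<close> and whose
  bottom inputs are independent with density \<open>\<rho>\<close>. It is squeezed between the stationary quadrant
  models of densities \<open>\<theta>\<close> and \<open>\<rho>\<close> by a coupling with four classes: the second class particles of
  the pair of stationary models are coloured according to whether they come from the bottom or from
  the left. Given the positions of all second class particles, neighbours of different colour are
  exchanged by independent coin flips for which a product blocking measure is reversible, and the
  initial colouring has positive mass under that measure; hence the two colours stay separated up to
  a bounded expected number of particles. Since the currents of the stationary models have square
  root fluctuations, this determines the mean density on either side of the shock up to an error of
  lower order. The mean density is monotone in space, so the averaged statement holds site by site,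
  and the coupling turns it into convergence of the local law.\<close>

section \<open>The six-vertex model in a box\<close>

text \<open>The estimate on the two colours rests on a conserved difference. At the outputs of a box
  of height \<open>t\<close> and width \<open>m\<close>, colour 2 on top minus colour 1 on the right
  is a difference of second class counts in stationary models, with mean \<open>drift t m\<close>,
  which changes sign at the shock. The blocking measure bounds the expected minimum of the same two
  numbers. Together they force one of them to be of order \<open>sqrt t + sqrt m\<close>: colour 2
  behind the shock, colour 1 ahead of it. On the line the obstacle is that a push may originate
  arbitrarily far to the left. Emptying all sites up to \<open>- N\<close> leaves a finite
  computation, and the law of the arrow that comes out of the stationary stretch behind the cut
  converges geometrically to the stationary one. For the entropy solution, one-sided entropies
  confine \<open>G\<close> between \<open>\<theta>\<close> and \<open>\<rho>\<close>. By concavity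
  \<open>G - \<theta>\<close> is then carried at least as fast as the shock and
  \<open>\<rho> - G\<close> at most as fast, so weights with an edge moving at the shock speed show
  that they vanish on their sides. The two values differ, so a continuity point is never the shock
  position.\<close>

abbreviation E_pmf :: "'a pmf \<Rightarrow> ('a \<Rightarrow> real) \<Rightarrow> real" where
  "E_pmf \<equiv> measure_pmf.expectation"

section \<open>Expectations under finitely supported laws\<close>

lemma replicate_pmf_map: "replicate_pmf n (map_pmf f p) = map_pmf (map f) (replicate_pmf n p)"
  by (induction n) (simp_all add: map_pmf_def bind_assoc_pmf bind_return_pmf)

lemma finite_set_pmf_bool [simp]: "finite (set_pmf (p :: bool pmf))"
  by (rule finite_subset[of _ UNIV]) auto

lemma finite_set_replicate_pmf: "finite (set_pmf p) \<Longrightarrow> finite (set_pmf (replicate_pmf n p))"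
  by (induction n) auto

lemma expectation_bind_finite:
  fixes h :: "'b \<Rightarrow> real"
  assumes "finite (set_pmf p)" "\<And>x. x \<in> set_pmf p \<Longrightarrow> finite (set_pmf (f x))"
  shows "E_pmf (bind_pmf p f) h =
    E_pmf p (\<lambda>x. E_pmf (f x) h)"
  using assms by (subst pmf_expectation_bind[of "set_pmf p"])
    (auto simp: integral_measure_pmf[of "set_pmf p"])

lemma expectation_mono_finite:
  fixes f g :: "'a \<Rightarrow> real"
  assumes "finite (set_pmf p)" "\<And>x. x \<in> set_pmf p \<Longrightarrow> f x \<le> g x"
  shows "E_pmf p f \<le> E_pmf p g"
  using assms by (intro integral_mono_AE integrable_measure_pmf_finite) (auto simp: AE_measure_pmf_iff)

lemma expectation_cong_pmf:
  fixes f g :: "'a \<Rightarrow> real"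
  assumes "\<And>x. x \<in> set_pmf p \<Longrightarrow> f x = g x"
  shows "E_pmf p f = E_pmf p g"
  using assms by (intro integral_cong_AE) (auto simp: AE_measure_pmf_iff)

section \<open>Flux, vertex weights and boxes\<close>

locale six_vertex =
  fixes b1 b2 :: real
  assumes b: "0 < b1" "b1 < b2" "b2 < 1"
begin

lemma b_simps [simp]: "0 \<le> b1" "b1 \<le> 1" "0 \<le> b2" "b2 \<le> 1"
  using b by auto

abbreviation flux :: "real \<Rightarrow> real" where "flux \<equiv> phi b1 b2"

lemma flux_alt: "flux z = (1 - b1) * z / ((b2 - b1) * z + (1 - b2))"
proof -
  have "(kappa b1 b2 - 1) * z + 1 = ((b2 - b1) * z + (1 - b2)) / (1 - b2)"
    using b by (simp add: kappa_def field_simps)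
  then show ?thesis using b by (simp add: phi_def) (simp add: kappa_def)
qed

lemma flux_den_pos: "0 \<le> z \<Longrightarrow> 0 < (b2 - b1) * z + (1 - b2)"
  using b by (intro add_nonneg_pos mult_nonneg_nonneg) auto

lemma flux_bounds: assumes "0 \<le> z" "z \<le> 1" shows "0 \<le> flux z" "flux z \<le> 1"
proof -
  have "0 \<le> (1 - z) * (1 - b2)" using b assms by (intro mult_nonneg_nonneg) auto
  then have "(1 - b1) * z \<le> (b2 - b1) * z + (1 - b2)" by (simp add: algebra_simps)
  then show "flux z \<le> 1" using flux_den_pos[of z] assms by (simp add: flux_alt)
  show "0 \<le> flux z" using flux_den_pos[of z] assms b by (simp add: flux_alt)
qed

text \<open>Under independent inputs of densities \<open>z\<close> and \<open>flux z\<close>, a lone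
  vertical particle turns as often as a lone horizontal one. This equation determines
  \<open>flux\<close> and is the source of all stationarity below.\<close>

lemma flux_balance:
  assumes "0 \<le> z" "z \<le> 1"
  shows "z * (1 - flux z) * (1 - b1) = (1 - z) * flux z * (1 - b2)"
  using flux_den_pos[of z] assms by (simp add: flux_alt divide_simps) (simp add: algebra_simps)

text \<open>Classes are linearly ordered, a larger class being stronger; particles are \<open>True\<close>. The
  arguments are the vertical and the horizontal input, the result is the pair of the vertical and
  the horizontal output.\<close>

definition vertex :: "'a::linorder \<Rightarrow> 'a \<Rightarrow> ('a \<times> 'a) pmf" where
  "vertex v h = (if v = h then return_pmf (v, h)
     else map_pmf (\<lambda>c. if c then (v, h) else (h, v)) (bernoulli_pmf (if h < v then b1 else b2)))"

primrec row :: "'a::linorder \<Rightarrow> 'a list \<Rightarrow> ('a list \<times> 'a) pmf" where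
  "row h [] = return_pmf ([], h)"
| "row h (v # vs) = do {p \<leftarrow> vertex v h; q \<leftarrow> row (snd p) vs; return_pmf (fst p # fst q, snd q)}"

text \<open>The left inputs are listed from bottom to top; the result is the pair of the right and the
  top outputs.\<close>

primrec box :: "'a::linorder list \<Rightarrow> 'a list \<Rightarrow> ('a list \<times> 'a list) pmf" where
  "box [] vs = return_pmf ([], vs)"
| "box (h # hs) vs = do {p \<leftarrow> row h vs; q \<leftarrow> box hs (fst p); return_pmf (snd p # fst q, snd q)}"

declare row.simps(2) [simp del] box.simps(2) [simp del]

lemma row_Cons: "row h (v # vs) = vertex v h \<bind> (\<lambda>p. row (snd p) vs \<bind> (\<lambda>q. return_pmf (fst p # fst q, snd q)))"
  by (simp add: row.simps(2))

lemma box_Cons: "box (h # hs) vs = row h vs \<bind> (\<lambda>p. box hs (fst p) \<bind> (\<lambda>q. return_pmf (snd p # fst q, snd q)))"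
  by (simp add: box.simps(2))

lemma set_vertex: "p \<in> set_pmf (vertex v h) \<Longrightarrow> p = (v, h) \<or> p = (h, v)"
  by (auto simp: vertex_def split: if_splits)

lemma finite_vertex [simp]: "finite (set_pmf (vertex v h))"
  by (rule finite_subset[of _ "{(v,h),(h,v)}"]) (auto dest: set_vertex)

lemma finite_row [simp]: "finite (set_pmf (row h vs))"
  by (induction vs arbitrary: h) (auto simp: row_Cons)

lemma finite_box [simp]: "finite (set_pmf (box hs vs))"
  by (induction hs arbitrary: vs) (auto simp: box_Cons)

lemma row_mset:
  "p \<in> set_pmf (row h vs) \<Longrightarrow> add_mset (snd p) (mset (fst p)) = add_mset h (mset vs)"
proof (induction vs arbitrary: h p)
  case (Cons v vs)
  from Cons.prems obtain q r where q: "q \<in> set_pmf (vertex v h)" "r \<in> set_pmf (row (snd q) vs)"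
    "p = (fst q # fst r, snd r)" by (auto simp: row_Cons)
  with set_vertex[OF q(1)] Cons.IH[OF q(2)] show ?case by (auto simp: add_mset_commute)
qed simp

lemma row_length: "p \<in> set_pmf (row h vs) \<Longrightarrow> length (fst p) = length vs"
  by (induction vs arbitrary: h p) (auto simp: row_Cons)

lemma box_length: "p \<in> set_pmf (box hs vs) \<Longrightarrow> length (fst p) = length hs \<and> length (snd p) = length vs"
  by (induction hs arbitrary: vs p) (auto simp: box_Cons dest!: row_length)

lemma box_mset:
  "p \<in> set_pmf (box hs vs) \<Longrightarrow> mset (fst p) + mset (snd p) = mset hs + mset vs"
proof (induction hs arbitrary: vs p)
  case (Cons h hs)
  from Cons.prems obtain q r where q: "q \<in> set_pmf (row h vs)" "r \<in> set_pmf (box hs (fst q))"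
    "p = (snd q # fst r, snd r)" by (auto simp: box_Cons)
  have "mset (fst p) + mset (snd p) = add_mset (snd q) (mset (fst r) + mset (snd r))"
    using q(3) by simp
  also have "\<dots> = mset hs + add_mset (snd q) (mset (fst q))" by (simp add: Cons.IH[OF q(2)])
  also have "\<dots> = mset hs + add_mset h (mset vs)" by (simp only: row_mset[OF q(1)])
  finally show ?case by simp
qed simp

text \<open>If \<open>f\<close> merges the two classes the outcome is forced; otherwise their order,
  and with it the probability, is unchanged. All couplings below are multiclass models read through
  monotone thresholds by way of this fact.\<close>

lemma vertex_map:
  assumes "mono f"
  shows "map_pmf (map_prod f f) (vertex v h) = vertex (f v) (f h)"
proof (cases "f v = f h")
  case True
  then have "map_pmf (map_prod f f) (vertex v h) = map_pmf (\<lambda>_. (f v, f h)) (vertex v h)"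
    by (intro map_pmf_cong) (auto dest: set_vertex)
  with True show ?thesis by (simp add: vertex_def)
next
  case False
  then have "h < v \<longleftrightarrow> f h < f v" using assms
    by (metis linorder_not_le monoD order_le_less order_less_imp_le)
  with False show ?thesis by (auto simp: vertex_def pmf.map_comp o_def intro!: map_pmf_cong)
qed

lemma row_map:
  assumes "mono f"
  shows "map_pmf (map_prod (map f) f) (row h vs) = row (f h) (map f vs)"
proof (induction vs arbitrary: h)
  case (Cons v vs)
  have "row (f h) (map f (v # vs)) = vertex v h \<bind> (\<lambda>p. row (f (snd p)) (map f vs) \<bind>
      (\<lambda>q. return_pmf (f (fst p) # fst q, snd q)))"
    by (simp add: row_Cons vertex_map[OF assms, symmetric] bind_map_pmf)
  then show ?case
    by (simp add: Cons.IH[symmetric] row_Cons map_bind_pmf bind_map_pmf)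
qed simp

lemma box_map:
  assumes "mono f"
  shows "map_pmf (map_prod (map f) (map f)) (box hs vs) = box (map f hs) (map f vs)"
proof (induction hs arbitrary: vs)
  case (Cons h hs)
  have "box (map f (h # hs)) (map f vs) = row h vs \<bind> (\<lambda>p. box (map f hs) (map f (fst p)) \<bind>
      (\<lambda>q. return_pmf (f (snd p) # fst q, snd q)))"
    by (simp add: box_Cons row_map[OF assms, symmetric] bind_map_pmf)
  then show ?case
    by (simp add: Cons.IH[symmetric] box_Cons map_bind_pmf bind_map_pmf)
qed simp

lemma row_append:
  "row h (xs @ ys) = row h xs \<bind> (\<lambda>p. row (snd p) ys \<bind> (\<lambda>q. return_pmf (fst p @ fst q, snd q)))"
  by (induction xs arbitrary: h) (simp_all add: row_Cons bind_assoc_pmf bind_return_pmf bind_return_pmf')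

text \<open>The right part of a row depends on the left part only through the arrow between them, so
  all rows of the left part can be sampled before the right part is touched.\<close>

lemma box_append:
  "box hs (xs @ ys) = box hs xs \<bind> (\<lambda>p. box (fst p) ys \<bind> (\<lambda>q. return_pmf (fst q, snd p @ snd q)))"
proof (induction hs arbitrary: xs ys)
  case (Cons h hs)
  have "box (h # hs) (xs @ ys) = row h xs \<bind> (\<lambda>p. row (snd p) ys \<bind> (\<lambda>q. box hs (fst p) \<bind>
     (\<lambda>r. box (fst r) (fst q) \<bind> (\<lambda>s. return_pmf (snd q # fst s, snd r @ snd s)))))"
    by (simp add: box_Cons row_append Cons.IH bind_assoc_pmf bind_return_pmf)
  also have "\<dots> = row h xs \<bind> (\<lambda>p. box hs (fst p) \<bind> (\<lambda>r. row (snd p) ys \<bind>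
     (\<lambda>q. box (fst r) (fst q) \<bind> (\<lambda>s. return_pmf (snd q # fst s, snd r @ snd s)))))"
    by (subst bind_commute_pmf) simp
  finally show ?case by (simp add: box_Cons bind_assoc_pmf bind_return_pmf)
qed (simp add: bind_return_pmf)

text \<open>Of the four output atoms, those with equal entries are immediate and the two with a
  single particle are \<open>flux_balance\<close>. This Burke property of one vertex is what
  propagates along rows and columns.\<close>

lemma vertex_stationary:
  assumes "0 \<le> s" "s \<le> 1"
  shows "bernoulli_pmf (flux s) \<bind> (\<lambda>h. bernoulli_pmf s \<bind> (\<lambda>v. vertex v h)) =
    pair_pmf (bernoulli_pmf s) (bernoulli_pmf (flux s))"
proof (rule pmf_eqI)
  fix x :: "bool \<times> bool"
  obtain a c where x: "x = (a, c)" by (cases x)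
  note [simp] = assms flux_bounds[OF assms]
  have *: "s * (1 - flux s) * (1 - b1) = (1 - s) * flux s * (1 - b2)" by (rule flux_balance[OF assms])
  show "pmf (bernoulli_pmf (flux s) \<bind> (\<lambda>h. bernoulli_pmf s \<bind> (\<lambda>v. vertex v h))) x =
    pmf (pair_pmf (bernoulli_pmf s) (bernoulli_pmf (flux s))) x"
    unfolding x pmf_pair
    apply (cases a; cases c)
    subgoal by (simp add: pmf_bind vertex_def map_pmf_def)
    subgoal using * apply (simp add: pmf_bind vertex_def map_pmf_def) by (simp add: algebra_simps)
    subgoal using * apply (simp add: pmf_bind vertex_def map_pmf_def) by (simp add: algebra_simps)
    by (simp add: pmf_bind vertex_def map_pmf_def)
qed

text \<open>The vertical output of the first vertex is independent of the arrow it sends on, so the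
  rest of the row again starts from stationary inputs.\<close>

lemma row_stationary:
  assumes "0 \<le> s" "s \<le> 1"
  shows "bernoulli_pmf (flux s) \<bind> (\<lambda>h. replicate_pmf n (bernoulli_pmf s) \<bind> (\<lambda>vs. row h vs)) =
    pair_pmf (replicate_pmf n (bernoulli_pmf s)) (bernoulli_pmf (flux s))"
proof (induction n)
  case 0
  show ?case by (simp add: bind_return_pmf pair_return_pmf1 map_pmf_def)
next
  case (Suc n)
  let ?V = "replicate_pmf n (bernoulli_pmf s)" and ?B = "bernoulli_pmf s" and ?H = "bernoulli_pmf (flux s)"
  have "?H \<bind> (\<lambda>h. replicate_pmf (Suc n) ?B \<bind> (\<lambda>vs. row h vs)) =
    ?H \<bind> (\<lambda>h. ?B \<bind> (\<lambda>v. ?V \<bind> (\<lambda>vs. vertex v h \<bind> (\<lambda>p. row (snd p) vs \<bind>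
      (\<lambda>q. return_pmf (fst p # fst q, snd q))))))"
    by (simp add: bind_assoc_pmf bind_return_pmf row_Cons)
  also have "\<dots> = ?H \<bind> (\<lambda>h. ?B \<bind> (\<lambda>v. vertex v h)) \<bind> (\<lambda>p. ?V \<bind> (\<lambda>vs. row (snd p) vs \<bind>
      (\<lambda>q. return_pmf (fst p # fst q, snd q))))"
    by (subst bind_commute_pmf[of ?V]) (simp add: bind_assoc_pmf)
  also have "\<dots> = ?B \<bind> (\<lambda>v. ?H \<bind> (\<lambda>h. ?V \<bind> (\<lambda>vs. row h vs)) \<bind>
      (\<lambda>q. return_pmf (v # fst q, snd q)))"
    by (simp add: vertex_stationary[OF assms] pair_pmf_def bind_assoc_pmf bind_return_pmf)
  also have "\<dots> = pair_pmf (replicate_pmf (Suc n) ?B) ?H"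
    by (simp add: Suc.IH) (simp add: pair_pmf_def bind_assoc_pmf bind_return_pmf)
  finally show ?case .
qed

lemma box_stationary:
  assumes "0 \<le> s" "s \<le> 1"
  shows "replicate_pmf t (bernoulli_pmf (flux s)) \<bind> (\<lambda>hs.
     replicate_pmf n (bernoulli_pmf s) \<bind> (\<lambda>vs. box hs vs)) =
    pair_pmf (replicate_pmf t (bernoulli_pmf (flux s))) (replicate_pmf n (bernoulli_pmf s))"
proof (induction t)
  case 0
  have "box [] = (\<lambda>x::bool list. return_pmf ([], x))" by (rule ext) simp
  then show ?case by (simp add: bind_return_pmf pair_return_pmf1 map_pmf_def)
next
  case (Suc t)
  let ?V = "replicate_pmf n (bernoulli_pmf s)" and ?B = "bernoulli_pmf (flux s)"
  let ?H = "replicate_pmf t (bernoulli_pmf (flux s))"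
  have "replicate_pmf (Suc t) ?B \<bind> (\<lambda>hs. ?V \<bind> (\<lambda>vs. box hs vs)) =
    ?B \<bind> (\<lambda>h. ?H \<bind> (\<lambda>hs. ?V \<bind> (\<lambda>vs. row h vs) \<bind> (\<lambda>p. box hs (fst p) \<bind>
      (\<lambda>q. return_pmf (snd p # fst q, snd q)))))"
    by (simp add: bind_assoc_pmf bind_return_pmf box_Cons[abs_def])
  also have "\<dots> = ?B \<bind> (\<lambda>h. ?V \<bind> (\<lambda>vs. row h vs)) \<bind> (\<lambda>p. ?H \<bind> (\<lambda>hs. box hs (fst p) \<bind>
      (\<lambda>q. return_pmf (snd p # fst q, snd q))))"
    by (subst bind_commute_pmf[of ?H]) (simp add: bind_assoc_pmf)
  also have "\<dots> = ?B \<bind> (\<lambda>h. ?V \<bind> (\<lambda>vs. ?H \<bind> (\<lambda>hs. box hs vs \<bind>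
      (\<lambda>q. return_pmf (h # fst q, snd q)))))"
    unfolding row_stationary[OF assms] pair_pmf_def bind_assoc_pmf bind_return_pmf fst_conv snd_conv
    by (rule bind_commute_pmf)
  also have "\<dots> = ?B \<bind> (\<lambda>h. ?H \<bind> (\<lambda>hs. ?V \<bind> (\<lambda>vs. box hs vs)) \<bind>
      (\<lambda>q. return_pmf (h # fst q, snd q)))"
    unfolding bind_assoc_pmf by (subst bind_commute_pmf[of ?V]) (rule refl)
  also have "\<dots> = pair_pmf (replicate_pmf (Suc t) ?B) ?V"
    by (simp add: Suc.IH) (simp add: pair_pmf_def bind_assoc_pmf bind_return_pmf)
  finally show ?case .
qed

end

section \<open>Colouring the second class particles\<close>

context six_vertex
begin

text \<open>Going straight exchanges the labels of two second class particles. \<open>tau\<close> is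
  the ratio of the probabilities of such an exchange out of and into the order with the stronger
  colour at the larger label.\<close>

definition tau :: real where "tau = b1 / b2"

lemma tau: "0 < tau" "tau < 1" using b by (simp_all add: tau_def)

text \<open>The product of these Bernoulli laws over the labels of the second class particles is the
  blocking measure: exchanging neighbours \<open>k\<close>, \<open>k + 1\<close> with the six-vertex probabilities is
  reversible for it.\<close>

definition blk :: "int \<Rightarrow> real" where "blk k = 1 / (1 + tau powi k)"

lemma blk_bounds [simp]: "0 \<le> blk k" "blk k \<le> 1"
proof -
  have "tau powi k > 0" using tau by simp
  then show "0 \<le> blk k" "blk k \<le> 1" by (simp_all add: blk_def)
qed

lemma one_minus_blk: "1 - blk k = tau powi k / (1 + tau powi k)"
proof -
  have "1 + tau powi k > 0" using tau by (intro add_pos_pos) auto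
  then show ?thesis by (simp add: blk_def field_simps)
qed

text \<open>Geometric tails: colour 2 is rare at very negative labels and colour 1 at large positive
  ones.\<close>

lemma blk_le: "blk k \<le> tau powi (- k)" "1 - blk k \<le> tau powi k"
proof -
  have "tau powi k > 0" using tau by simp
  then show "blk k \<le> tau powi (- k)" "1 - blk k \<le> tau powi k"
    by (auto simp: blk_def one_minus_blk power_int_minus field_simps)
qed

lemma blk_balance: "blk k * (1 - blk (k + 1)) * b2 = (1 - blk k) * blk (k + 1) * b1"
proof -
  define x where "x = tau powi k"
  have x': "tau powi (k + 1) = x * tau" using tau by (simp add: x_def power_int_add)
  have *: "tau * b2 = b1" using b by (simp add: tau_def)
  have "blk k * (1 - blk (k + 1)) * b2 = x * (tau * b2) / ((1 + x) * (1 + x * tau))"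
    unfolding one_minus_blk unfolding blk_def x' x_def[symmetric] by simp
  then show ?thesis unfolding * one_minus_blk unfolding blk_def x' x_def[symmetric] by simp
qed

text \<open>Classes: 3 first class, 2 and 1 the two kinds of second class particles, 0 hole. Before
  colouring all second class particles carry class 2.\<close>

definition hue :: "int \<Rightarrow> nat \<Rightarrow> nat pmf" where
  "hue k c = (if c = 2 then map_pmf (\<lambda>x. if x then 2 else 1) (bernoulli_pmf (blk k)) else return_pmf c)"

definition sec :: "nat \<Rightarrow> int" where "sec c = (if c = 2 then 1 else 0)"

lemma expectation_hue:
  fixes f :: "nat \<Rightarrow> real"
  shows "E_pmf (hue k c) f = (if c = 2 then f 2 * blk k + f 1 * (1 - blk k) else f c)"
  by (simp add: hue_def)

lemma expectation_vertex:
  fixes f :: "'a::linorder \<times> 'a \<Rightarrow> real"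
  shows "E_pmf (vertex v h) f = (if v = h then f (v, h) else
    f (v, h) * (if h < v then b1 else b2) + f (h, v) * (1 - (if h < v then b1 else b2)))"
  by (simp add: vertex_def)

lemma pmf_vertex:
  "pmf (vertex v h) x = (if v = h then indicator {x} (v, h) else
    indicator {x} (v, h) * (if h < v then b1 else b2) + indicator {x} (h, v) * (1 - (if h < v then b1 else b2)))"
  by (simp add: vertex_def map_pmf_def pmf_bind)

text \<open>Before the vertex the smaller label belongs to the left input, after it to the vertical
  output. If at most one input is second class, its colour merely travels along. If both are, the
  uncoloured vertex is deterministic while the coloured one may exchange colours, and
  \<open>blk_balance\<close> makes the colouring invariant.\<close>

lemma vertex_hue:
  assumes "v \<in> {0, 2, 3}" "h \<in> {0, 2, 3}"
  shows "hue k h \<bind> (\<lambda>a. hue (k + sec h) v \<bind> (\<lambda>c. vertex c a)) =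
    vertex v h \<bind> (\<lambda>p. hue k (fst p) \<bind> (\<lambda>a. hue (k + sec (fst p)) (snd p) \<bind> (\<lambda>c. return_pmf (a, c))))"
    (is "?L = ?R")
proof (rule pmf_eqI)
  fix x :: "nat \<times> nat"
  define P where "P = blk k"
  define Q where "Q = blk (k + 1)"
  have "P * (1 - Q) * b2 = (1 - P) * Q * b1"
    unfolding P_def Q_def by (rule blk_balance)
  then have *: "P * (Q * b2) = P * b2 + P * (Q * b1) - Q * b1" by (simp add: algebra_simps)
  show "pmf ?L x = pmf ?R x"
  proof (cases "v = 2 \<and> h = 2")
    case True
    have "\<lbrakk>x \<noteq> (2,2); x \<noteq> (2,1); x \<noteq> (1,2); x \<noteq> (1,1)\<rbrakk> \<Longrightarrow> pmf ?L x = pmf ?R x"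
      by (auto simp: True pmf_bind expectation_hue expectation_vertex pmf_vertex sec_def)
    moreover have "pmf ?L (i, j) = pmf ?R (i, j)" if "i \<in> {1, 2}" "j \<in> {1, 2}" for i j
    proof -
      have "(i, j) \<in> {(1,1), (2,2)} \<Longrightarrow> ?thesis"
        by (auto simp: True pmf_bind expectation_hue expectation_vertex pmf_vertex sec_def)
      \<comment> \<open>Invariance of the two mixed colourings; both identities rearrange the
        detailed balance recorded above.\<close>
      moreover have "b2 * (1 - Q) * P + (1 - b1) * Q * (1 - P) = Q * (1 - P)"
        "(1 - b2) * (1 - Q) * P + b1 * Q * (1 - P) = (1 - Q) * P"
        using * by algebra+
      then have "(i, j) \<in> {(1,2), (2,1)} \<Longrightarrow> ?thesis"
        by (auto simp: True pmf_bind expectation_hue expectation_vertex pmf_vertex sec_def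
          P_def[symmetric] Q_def[symmetric])
      ultimately show ?thesis using that by auto
    qed
    ultimately show ?thesis by auto
  next
    case False
    with assms show ?thesis
      by (elim insertE emptyE; simp add: pmf_bind expectation_hue expectation_vertex pmf_vertex sec_def;
        simp add: algebra_simps)
  qed
qed

primrec color :: "int \<Rightarrow> nat list \<Rightarrow> nat list pmf" where
  "color k [] = return_pmf []"
| "color k (c # cs) = do {a \<leftarrow> hue k c; as \<leftarrow> color (k + sec c) cs; return_pmf (a # as)}"

text \<open>Vertical boundaries are listed upwards while labels decrease upwards, so the label is
  lowered before it is used. Thus \<open>color_down k\<close> uses \<open>k - 1, k - 2, ...\<close>
  and fits together with \<open>color k\<close>, which uses \<open>k, k + 1, ...\<close>.\<close>

primrec color_down :: "int \<Rightarrow> nat list \<Rightarrow> nat list pmf" where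
  "color_down k [] = return_pmf []"
| "color_down k (c # cs) =
     do {a \<leftarrow> hue (k - sec c) c; as \<leftarrow> color_down (k - sec c) cs; return_pmf (a # as)}"

definition secs :: "nat list \<Rightarrow> int" where "secs cs = (\<Sum>c\<leftarrow>cs. sec c)"

lemma secs_simps [simp]: "secs [] = 0" "secs (c # cs) = sec c + secs cs"
  by (simp_all add: secs_def)

lemma secs_count: "secs cs = int (count_list cs 2)"
  by (induction cs) (auto simp: sec_def)

lemma vertex_sec: "p \<in> set_pmf (vertex v h) \<Longrightarrow> sec (fst p) + sec (snd p) = sec v + sec h"
  by (auto dest: set_vertex)

lemma row_secs: "p \<in> set_pmf (row h vs) \<Longrightarrow> secs (fst p) + sec (snd p) = sec h + secs vs"
proof (induction vs arbitrary: h p)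
  case (Cons v vs)
  from Cons.prems obtain q r where q: "q \<in> set_pmf (vertex v h)" "r \<in> set_pmf (row (snd q) vs)"
    "p = (fst q # fst r, snd r)" by (auto simp: row_Cons)
  from vertex_sec[OF q(1)] Cons.IH[OF q(2)] q(3) show ?case by simp
qed simp

lemma box_secs: "p \<in> set_pmf (box hs vs) \<Longrightarrow> secs (fst p) + secs (snd p) = secs hs + secs vs"
proof (induction hs arbitrary: vs p)
  case (Cons h hs)
  from Cons.prems obtain q r where q: "q \<in> set_pmf (row h vs)" "r \<in> set_pmf (box hs (fst q))"
    "p = (snd q # fst r, snd r)" by (auto simp: box_Cons)
  from row_secs[OF q(1)] Cons.IH[OF q(2)] q(3) show ?case by simp
qed simp

lemma row_set: "p \<in> set_pmf (row h vs) \<Longrightarrow> set (fst p) \<subseteq> insert h (set vs) \<and> snd p \<in> insert h (set vs)"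
  by (metis insertI1 row_mset set_mset_add_mset_insert set_mset_mset subset_insertI)

lemma box_set: "p \<in> set_pmf (box hs vs) \<Longrightarrow> set (fst p) \<union> set (snd p) = set hs \<union> set vs"
  by (metis box_mset set_mset_mset set_mset_union)

text \<open>Among the inputs of a row the arrow has the first label, among the outputs the last one;
  every vertex moves it past one more site.\<close>

lemma row_color:
  assumes "h \<in> {0, 2, 3}" "set vs \<subseteq> {0, 2, 3}"
  shows "hue k h \<bind> (\<lambda>a. color (k + sec h) vs \<bind> (\<lambda>cs. row a cs)) =
    row h vs \<bind> (\<lambda>p. color k (fst p) \<bind> (\<lambda>cs. hue (k + secs (fst p)) (snd p) \<bind> (\<lambda>a. return_pmf (cs, a))))"
  using assms
proof (induction vs arbitrary: h k)
  case Nil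
  show ?case by (simp add: bind_return_pmf)
next
  case (Cons v vs)
  have v: "v \<in> {0, 2, 3}" using Cons.prems by auto
  have "hue k h \<bind> (\<lambda>a. color (k + sec h) (v # vs) \<bind> (\<lambda>cs. row a cs)) =
    hue k h \<bind> (\<lambda>a. hue (k + sec h) v \<bind> (\<lambda>c. color (k + sec h + sec v) vs \<bind> (\<lambda>cs.
      vertex c a \<bind> (\<lambda>p. row (snd p) cs \<bind> (\<lambda>q. return_pmf (fst p # fst q, snd q))))))"
    by (simp add: bind_assoc_pmf bind_return_pmf row_Cons)
  \<comment> \<open>The colours of the later sites are independent of this vertex and may be drawn
    after it, which isolates the left side of \<open>vertex_hue\<close>.\<close>
  also have "\<dots> = hue k h \<bind> (\<lambda>a. hue (k + sec h) v \<bind> (\<lambda>c. vertex c a)) \<bind>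
     (\<lambda>p. color (k + sec h + sec v) vs \<bind> (\<lambda>cs. row (snd p) cs \<bind> (\<lambda>q. return_pmf (fst p # fst q, snd q))))"
    unfolding bind_assoc_pmf by (subst bind_commute_pmf[of "color _ _"]) (rule refl)
  also have "\<dots> = vertex v h \<bind> (\<lambda>p. hue k (fst p) \<bind> (\<lambda>a. hue (k + sec (fst p)) (snd p) \<bind> (\<lambda>c.
      color (k + sec h + sec v) vs \<bind> (\<lambda>cs. row c cs \<bind> (\<lambda>q. return_pmf (a # fst q, snd q))))))"
    unfolding vertex_hue[OF v Cons.prems(1)] by (simp add: bind_assoc_pmf bind_return_pmf)
  also have "\<dots> = vertex v h \<bind> (\<lambda>p. hue k (fst p) \<bind> (\<lambda>a. (hue (k + sec (fst p)) (snd p) \<bind> (\<lambda>c.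
      color (k + sec (fst p) + sec (snd p)) vs \<bind> (\<lambda>cs. row c cs))) \<bind> (\<lambda>q. return_pmf (a # fst q, snd q))))"
    unfolding bind_assoc_pmf
    by (intro bind_pmf_cong refl) (auto dest!: vertex_sec intro!: arg_cong2[of _ _ _ _ color])
  also have "\<dots> = vertex v h \<bind> (\<lambda>p. hue k (fst p) \<bind> (\<lambda>a. (row (snd p) vs \<bind> (\<lambda>q.
      color (k + sec (fst p)) (fst q) \<bind> (\<lambda>cs. hue (k + sec (fst p) + secs (fst q)) (snd q) \<bind>
      (\<lambda>a. return_pmf (cs, a))))) \<bind> (\<lambda>q. return_pmf (a # fst q, snd q))))"
  proof (intro bind_pmf_cong refl)
    fix p a assume "p \<in> set_pmf (vertex v h)"
    then have "snd p \<in> {0, 2, 3}" using set_vertex v Cons.prems(1) by fastforce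
    moreover have "set vs \<subseteq> {0, 2, 3}" using Cons.prems(2) by auto
    ultimately show "hue (k + sec (fst p)) (snd p) \<bind> (\<lambda>c.
      color (k + sec (fst p) + sec (snd p)) vs \<bind> (\<lambda>cs. row c cs)) = row (snd p) vs \<bind> (\<lambda>q.
      color (k + sec (fst p)) (fst q) \<bind> (\<lambda>cs. hue (k + sec (fst p) + secs (fst q)) (snd q) \<bind>
      (\<lambda>a. return_pmf (cs, a))))" by (rule Cons.IH)
  qed
  also have "\<dots> = vertex v h \<bind> (\<lambda>p. row (snd p) vs \<bind> (\<lambda>q. hue k (fst p) \<bind> (\<lambda>a. 
      color (k + sec (fst p)) (fst q) \<bind> (\<lambda>cs. hue (k + sec (fst p) + secs (fst q)) (snd q) \<bind>
      (\<lambda>c. return_pmf (a # cs, c))))))"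
    unfolding bind_assoc_pmf bind_return_pmf fst_conv snd_conv
    by (subst bind_commute_pmf[of "hue _ _" "row _ _"]) (rule refl)
  finally show ?case by (simp add: row_Cons bind_assoc_pmf bind_return_pmf add.assoc)
qed

text \<open>Labels increase along every boundary path from the top left to the bottom right corner.
  Both corners keep their labels \<open>k - secs hs\<close> and \<open>k + secs vs\<close>, so the
  outgoing path is labelled from the first of these on top and down from the second on the
  right.\<close>

lemma box_color:
  assumes "set hs \<subseteq> {0, 2, 3}" "set vs \<subseteq> {0, 2, 3}"
  shows "color_down k hs \<bind> (\<lambda>as. color k vs \<bind> (\<lambda>cs. box as cs)) =
    box hs vs \<bind> (\<lambda>p. color_down (k + secs vs) (fst p) \<bind> (\<lambda>as. color (k - secs hs) (snd p) \<bind>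
      (\<lambda>cs. return_pmf (as, cs))))"
  using assms
proof (induction hs arbitrary: vs k)
  case Nil
  have "box [] = (\<lambda>x::nat list. return_pmf ([], x))" by (rule ext) simp
  then show ?case by (simp add: bind_return_pmf)
next
  case (Cons h hs)
  have h: "h \<in> {0, 2, 3}" using Cons.prems by auto
  let ?k = "k - sec h"
  have k: "color k vs = color (?k + sec h) vs" by simp
  have "color_down k (h # hs) \<bind> (\<lambda>as. color k vs \<bind> (\<lambda>cs. box as cs)) =
    hue ?k h \<bind> (\<lambda>a. color_down ?k hs \<bind> (\<lambda>as. color k vs \<bind> (\<lambda>cs. row a cs) \<bind> (\<lambda>p.
      box as (fst p) \<bind> (\<lambda>q. return_pmf (snd p # fst q, snd q)))))"
    by (simp add: bind_assoc_pmf bind_return_pmf box_Cons[abs_def])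
  also have "\<dots> = (hue ?k h \<bind> (\<lambda>a. color (?k + sec h) vs \<bind> (\<lambda>cs. row a cs))) \<bind> (\<lambda>p. color_down ?k hs \<bind> (\<lambda>as.
      box as (fst p) \<bind> (\<lambda>q. return_pmf (snd p # fst q, snd q))))"
    unfolding bind_assoc_pmf k
    by (subst bind_commute_pmf[of "color_down _ _"], subst bind_commute_pmf[of "color_down _ _"]) (rule refl)
  also have "\<dots> = row h vs \<bind> (\<lambda>p. color ?k (fst p) \<bind> (\<lambda>cs. hue (?k + secs (fst p)) (snd p) \<bind> (\<lambda>a.
     color_down ?k hs \<bind> (\<lambda>as. box as cs \<bind> (\<lambda>q. return_pmf (a # fst q, snd q))))))"
    unfolding row_color[OF h Cons.prems(2)] by (simp add: bind_assoc_pmf bind_return_pmf)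
  also have "\<dots> = row h vs \<bind> (\<lambda>p. hue (?k + secs (fst p)) (snd p) \<bind> (\<lambda>a.
     (color_down ?k hs \<bind> (\<lambda>as. color ?k (fst p) \<bind> (\<lambda>cs. box as cs))) \<bind> (\<lambda>q. return_pmf (a # fst q, snd q))))"
    unfolding bind_assoc_pmf
    by (subst bind_commute_pmf[of "color _ _"], subst bind_commute_pmf[of "color _ _"]) (rule refl)
  also have "\<dots> = row h vs \<bind> (\<lambda>p. hue (?k + secs (fst p)) (snd p) \<bind> (\<lambda>a.
     (box hs (fst p) \<bind> (\<lambda>q. color_down (?k + secs (fst p)) (fst q) \<bind> (\<lambda>as. color (?k - secs hs) (snd q) \<bind>
      (\<lambda>cs. return_pmf (as, cs))))) \<bind> (\<lambda>q. return_pmf (a # fst q, snd q))))"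
  proof (rule bind_pmf_cong[OF refl], rule bind_pmf_cong[OF refl], rule arg_cong[where f = "\<lambda>x. bind_pmf x _"])
    fix p assume p: "p \<in> set_pmf (row h vs)"
    have "set (fst p) \<subseteq> {0, 2, 3}" using row_set[OF p] h Cons.prems(2) by blast
    moreover have "set hs \<subseteq> {0, 2, 3}" using Cons.prems(1) by simp
    ultimately show "color_down ?k hs \<bind> (\<lambda>as. color ?k (fst p) \<bind> (\<lambda>cs. box as cs)) =
      box hs (fst p) \<bind> (\<lambda>q. color_down (?k + secs (fst p)) (fst q) \<bind> (\<lambda>as. color (?k - secs hs) (snd q) \<bind>
      (\<lambda>cs. return_pmf (as, cs))))"
      using Cons.IH[of "fst p" ?k] by simp
  qed
  also have "\<dots> = row h vs \<bind> (\<lambda>p. box hs (fst p) \<bind> (\<lambda>q. hue (?k + secs (fst p)) (snd p) \<bind> (\<lambda>a.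
     color_down (?k + secs (fst p)) (fst q) \<bind> (\<lambda>as. color (?k - secs hs) (snd q) \<bind>
      (\<lambda>cs. return_pmf (a # as, cs))))))"
    unfolding bind_assoc_pmf bind_return_pmf fst_conv snd_conv
    by (subst bind_commute_pmf[of "hue _ _" "box _ _"]) (rule refl)
  \<comment> \<open>Conservation of second class particles in the row: counting labels from its left
    end or back from its right end gives the same label for the outgoing arrow.\<close>
  also have "\<dots> = row h vs \<bind> (\<lambda>p. box hs (fst p) \<bind> (\<lambda>q. hue (k + secs vs - sec (snd p)) (snd p) \<bind> (\<lambda>a.
     color_down (k + secs vs - sec (snd p)) (fst q) \<bind> (\<lambda>as. color (?k - secs hs) (snd q) \<bind>
      (\<lambda>cs. return_pmf (a # as, cs))))))"
  proof (intro bind_pmf_cong refl)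
    fix p assume "p \<in> set_pmf (row h vs)"
    from row_secs[OF this] have "?k + secs (fst p) = k + secs vs - sec (snd p)" by simp
    then show "hue (?k + secs (fst p)) (snd p) = hue (k + secs vs - sec (snd p)) (snd p)"
      "color_down (?k + secs (fst p)) c = color_down (k + secs vs - sec (snd p)) c" for c by (simp_all only:)
  qed
  finally show ?case by (simp add: box_Cons bind_assoc_pmf bind_return_pmf diff_diff_eq)
qed

end

section \<open>Estimates for the blocking measure\<close>

lemma pmf_bind_Cons:
  "pmf (p \<bind> (\<lambda>a. q \<bind> (\<lambda>as. return_pmf (a # as)))) (x # xs) = pmf p x * pmf q xs"
proof -
  have "p \<bind> (\<lambda>a. q \<bind> (\<lambda>as. return_pmf (a # as))) = map_pmf (\<lambda>(a, as). a # as) (pair_pmf p q)"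
    by (simp add: pair_pmf_def map_pmf_def bind_assoc_pmf bind_return_pmf)
  moreover have "inj (\<lambda>(a, as). a # as)" by (auto simp: inj_def)
  ultimately show ?thesis
    using pmf_map_inj'[of "\<lambda>(a, as). a # as" "pair_pmf p q" "(x, xs)"] by (simp add: pmf_pair)
qed

lemma expectation_ge_atom:
  fixes F :: "'a \<Rightarrow> real"
  assumes "finite (set_pmf p)" "\<And>x. 0 \<le> F x"
  shows "pmf p x * F x \<le> E_pmf p F"
proof -
  have "E_pmf p F = (\<Sum>y\<in>insert x (set_pmf p). pmf p y * F y)"
    using assms by (subst integral_measure_pmf[of "insert x (set_pmf p)"]) auto
  also have "\<dots> \<ge> pmf p x * F x"
    using assms by (intro member_le_sum) auto
  finally show ?thesis .
qed

text \<open>Replaces the factors of a ground state probability by exponentials, so that the product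
  is governed by a geometric sum.\<close>

lemma exp_le_inverse: assumes "(0::real) < x" shows "exp (- x) \<le> 1 / (1 + x)"
  using assms exp_ge_add_one_self[of x] by (simp add: exp_minus field_simps)

lemma expectation_Cons:
  fixes f :: "'a \<Rightarrow> real" and g :: "'a list \<Rightarrow> real"
  assumes "finite (set_pmf p)" "finite (set_pmf q)"
  shows "E_pmf (p \<bind> (\<lambda>a. q \<bind> (\<lambda>as. return_pmf (a # as)))) (\<lambda>l. f (hd l) + g (tl l))
    = E_pmf p f + E_pmf q g"
proof -
  have "E_pmf (p \<bind> (\<lambda>a. q \<bind> (\<lambda>as. return_pmf (a # as)))) (\<lambda>l. f (hd l) + g (tl l))
    = E_pmf p (\<lambda>a. E_pmf q (\<lambda>as. f a + g as))"
    using assms by (simp add: expectation_bind_finite)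
  also have "\<dots> = E_pmf p (\<lambda>a. f a + E_pmf q g)"
    using assms by (simp add: integrable_measure_pmf_finite)
  also have "\<dots> = E_pmf p f + E_pmf q g"
    using assms by (simp add: integrable_measure_pmf_finite)
  finally show ?thesis .
qed

lemma expectation_count_Cons:
  assumes "finite (set_pmf p)" "finite (set_pmf q)"
  shows "E_pmf (p \<bind> (\<lambda>a. q \<bind> (\<lambda>as. return_pmf (a # as)))) (\<lambda>l. real (count_list l c))
    = pmf p c + E_pmf q (\<lambda>l. real (count_list l c))"
proof -
  have "E_pmf (p \<bind> (\<lambda>a. q \<bind> (\<lambda>as. return_pmf (a # as)))) (\<lambda>l. real (count_list l c)) =
    E_pmf (p \<bind> (\<lambda>a. q \<bind> (\<lambda>as. return_pmf (a # as))))
      (\<lambda>l. indicator {c} (hd l) + real (count_list (tl l) c))"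
    by (rule expectation_cong_pmf) auto
  then show ?thesis using expectation_Cons[OF assms, of "indicator {c}" "\<lambda>l. real (count_list l c)"]
    by (simp add: measure_pmf_single)
qed

context six_vertex
begin

lemma finite_hue [simp]: "finite (set_pmf (hue k c))"
  by (simp add: hue_def)

lemma finite_color [simp]: "finite (set_pmf (color k cs))"
  by (induction cs arbitrary: k) auto

lemma finite_color_down [simp]: "finite (set_pmf (color_down k cs))"
  by (induction cs arbitrary: k) auto

text \<open>Writes one term of the geometric series as a difference, so that sums over consecutive
  labels telescope in the inductions.\<close>

lemma geometric_telescope:
  "(tau powi k - tau powi (k + 1)) / (1 - tau) = tau powi k"
  using tau by (simp add: power_int_add field_simps)

lemma pmf_hue: "pmf (hue k c) x = (if c = 2 then (if x = 2 then blk k else if x = 1 then 1 - blk k else 0)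
    else if x = c then 1 else 0)"
proof -
  have *: "pmf (hue k c) x = E_pmf (hue k c) (indicator {x})"
    by (simp add: measure_pmf_single)
  show ?thesis unfolding * expectation_hue by auto
qed

text \<open>By \<open>blk_le\<close> a label \<open>i\<close> contributes at most
  \<open>tau powi (- i)\<close>, and these terms telescope. The bound is applied when all the labels
  are negative.\<close>

lemma color_count_le:
  "E_pmf (color k cs) (\<lambda>l. real (count_list l 2)) \<le>
    (tau powi (1 - (k + secs cs)) - tau powi (1 - k)) / (1 - tau)"
proof (induction cs arbitrary: k)
  case (Cons c cs)
  have "pmf (hue k c) 2 \<le> (tau powi (1 - (k + sec c)) - tau powi (1 - k)) / (1 - tau)"
    using geometric_telescope[of "- k"] blk_le[of k] by (simp add: pmf_hue sec_def)
  with Cons.IH[of "k + sec c"] show ?case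
    by (simp add: expectation_count_Cons diff_divide_distrib algebra_simps)
qed simp

lemma color_down_count_le:
  assumes "1 \<notin> set cs"
  shows "E_pmf (color_down k cs) (\<lambda>l. real (count_list l 1)) \<le>
    (tau powi (k - secs cs) - tau powi k) / (1 - tau)"
  using assms
proof (induction cs arbitrary: k)
  case (Cons c cs)
  then have c: "c \<noteq> 1" "1 \<notin> set cs" by auto
  have "pmf (hue (k - sec c) c) 1 \<le> (tau powi (k - sec c) - tau powi k) / (1 - tau)"
    using geometric_telescope[of "k - 1"] blk_le[of "k - 1"] c by (simp add: pmf_hue sec_def)
  with Cons.IH[OF c(2), of "k - sec c"] show ?case
    by (simp add: expectation_count_Cons diff_divide_distrib algebra_simps)
qed simp

text \<open>Giving colour 2 to every second class particle has as probability the product of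
  \<open>blk\<close> over the labels. For positive labels the exponent stays bounded however long
  the list is.\<close>

lemma color_ground:
  "exp (- (tau powi k - tau powi (k + secs cs)) / (1 - tau)) \<le> pmf (color k cs) cs"
proof (induction cs arbitrary: k)
  case (Cons c cs)
  have "exp (- ((tau powi k - tau powi (k + sec c)) / (1 - tau))) \<le> pmf (hue k c) c"
    using geometric_telescope[of k] exp_le_inverse[of "tau powi k"] tau
    by (simp add: pmf_hue sec_def blk_def)
  from mult_mono[OF this Cons.IH[of "k + sec c"]] show ?case
    by (simp add: pmf_bind_Cons flip: exp_add) (simp add: diff_divide_distrib algebra_simps)
qed simp

lemma color_down_ground:
  "exp (- (tau powi (1 - k) - tau powi (1 - (k - secs cs))) / (1 - tau)) \<le>
    pmf (color_down k cs) (map (\<lambda>c. if c = 2 then 1 else c) cs)"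
proof (induction cs arbitrary: k)
  case (Cons c cs)
  \<comment> \<open>Puts the probability of colour 1 into the shape of \<open>blk\<close> with the
    label reflected, so that \<open>exp_le_inverse\<close> applies again.\<close>
  have "1 - blk (k - 1) = 1 / (1 + tau powi (1 - k))"
  proof -
    define y where "y = tau powi (k - 1)"
    have y: "y > 0" "tau powi (1 - k) = 1 / y"
      using tau power_int_minus[of tau "k - 1"] by (simp_all add: y_def inverse_eq_divide)
    show ?thesis unfolding one_minus_blk y_def[symmetric] y(2) using y(1) by (simp add: divide_simps)
  qed
  then have "exp (- ((tau powi (1 - k) - tau powi (1 - (k - sec c))) / (1 - tau))) \<le>
      pmf (hue (k - sec c) c) (if c = 2 then 1 else c)"
    using geometric_telescope[of "1 - k"] exp_le_inverse[of "tau powi (1 - k)"] tau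
    by (simp add: pmf_hue sec_def)
  from mult_mono[OF this Cons.IH[of "k - sec c"]] show ?case
    by (simp add: pmf_bind_Cons flip: exp_add split del: if_split)
      (simp add: diff_divide_distrib algebra_simps split del: if_split)
qed simp

text \<open>The factor \<open>1 / (1 - tau)\<close> bounds the expectation under the blocking
  measure. The exponential is the price of starting from the ground state: two lists of inputs, each
  ground state having probability at least \<open>exp (- (1 / (1 - tau)))\<close>.\<close>

definition inversion_bound :: real where "inversion_bound = exp (2 / (1 - tau)) / (1 - tau)"

text \<open>By the second assumption the labels of \<open>vs\<close> end where those of
  \<open>hs\<close> begin. If this common label is at least 1, colour 1 is rare beyond it; if it is
  at most 0, colour 2 is rare before it. Either way one of the two counts has a small mean.\<close>

lemma color_min_le:
  assumes "1 \<notin> set hs" "l - secs hs = k + secs vs"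
  shows "E_pmf (color_down l hs \<bind> (\<lambda>as. color k vs \<bind> (\<lambda>cs. return_pmf (as, cs))))
    (\<lambda>p. real (min (count_list (fst p) 1) (count_list (snd p) 2))) \<le> 1 / (1 - tau)"
    (is "E_pmf ?Q ?F \<le> _")
proof (cases "l - secs hs \<ge> 1")
  case True
  have "E_pmf ?Q ?F \<le> E_pmf ?Q (\<lambda>p. real (count_list (fst p) 1))"
    by (rule expectation_mono_finite) auto
  also have "\<dots> = E_pmf (color_down l hs) (\<lambda>as. real (count_list as 1))"
    by (simp add: expectation_bind_finite)
  also have "\<dots> \<le> (tau powi (l - secs hs) - tau powi l) / (1 - tau)"
    by (rule color_down_count_le[OF assms(1)])
  also have "\<dots> \<le> 1 / (1 - tau)"
  proof (rule divide_right_mono)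
    have "tau powi (l - secs hs) \<le> 1" using tau True by (intro power_int_le_one) auto
    moreover have "0 < tau powi l" using tau by simp
    ultimately show "tau powi (l - secs hs) - tau powi l \<le> 1" by linarith
  qed (use tau in simp)
  finally show ?thesis .
next
  case False
  have "E_pmf ?Q ?F \<le> E_pmf ?Q (\<lambda>p. real (count_list (snd p) 2))"
    by (rule expectation_mono_finite) auto
  also have "\<dots> = E_pmf (color k vs) (\<lambda>as. real (count_list as 2))"
    by (simp add: expectation_bind_finite)
  also have "\<dots> \<le> (tau powi (1 - (k + secs vs)) - tau powi (1 - k)) / (1 - tau)"
    by (rule color_count_le)
  also have "\<dots> \<le> 1 / (1 - tau)"
  proof (rule divide_right_mono)
    have "tau powi (1 - (k + secs vs)) \<le> 1" using tau False assms(2) by (intro power_int_le_one) auto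
    moreover have "0 < tau powi (1 - k)" using tau by simp
    ultimately show "tau powi (1 - (k + secs vs)) - tau powi (1 - k) \<le> 1" by linarith
  qed (use tau in simp)
  finally show ?thesis .
qed

text \<open>The ground state has probability bounded below under the blocking measure, so the law started
  from it is dominated by a multiple of the stationary law.\<close>

lemma box_inversions_le:
  fixes hs vs :: "nat list"
  assumes "set hs \<subseteq> {0, 1, 3}" "set vs \<subseteq> {0, 2, 3}"
  shows "E_pmf (box hs vs) (\<lambda>p. real (min (count_list (fst p) 1) (count_list (snd p) 2)))
    \<le> inversion_bound"
proof -
  define F :: "nat list \<times> nat list \<Rightarrow> real"
    where "F = (\<lambda>p. real (min (count_list (fst p) 1) (count_list (snd p) 2)))"
  \<comment> \<open>The left inputs with their colour forgotten. Recolouring every second class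
    particle with 1 recovers \<open>hs\<close>, the ground state of
    \<open>color_down 1\<close>.\<close>
  define gs where "gs = map (\<lambda>c. if c = 1 then 2 else c) hs"
  have gs: "set gs \<subseteq> {0, 2, 3}" using assms(1) by (auto simp: gs_def)
  have hs: "map (\<lambda>c. if c = 2 then 1 else c) gs = hs"
    unfolding gs_def map_map by (rule map_idI) (use assms(1) in auto)
  let ?C = "color_down 1 gs" and ?D = "color 1 vs"
  have F0: "F p \<ge> 0" for p by (simp add: F_def)
  have E0: "E_pmf p F \<ge> 0" for p by (rule integral_nonneg_AE) (simp add: F0)
  \<comment> \<open>Keeps only the ground state atom of each colouring law; all discarded terms are
    nonnegative.\<close>
  have "pmf ?C hs * (pmf ?D vs * E_pmf (box hs vs) F) \<le>
    pmf ?C hs * E_pmf (?D \<bind> (\<lambda>cs. box hs cs)) F"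
    using expectation_ge_atom[of ?D "\<lambda>cs. E_pmf (box hs cs) F" vs]
    by (intro mult_left_mono) (simp_all add: expectation_bind_finite E0)
  also have "\<dots> \<le> E_pmf (?C \<bind> (\<lambda>as. ?D \<bind> (\<lambda>cs. box as cs))) F"
    using expectation_ge_atom[of ?C "\<lambda>as. E_pmf (?D \<bind> (\<lambda>cs. box as cs)) F" hs]
    by (subst expectation_bind_finite) (auto simp: E0)
  also have "\<dots> = E_pmf (box gs vs) (\<lambda>p. E_pmf
     (color_down (1 + secs vs) (fst p) \<bind> (\<lambda>as. color (1 - secs gs) (snd p) \<bind>
      (\<lambda>cs. return_pmf (as, cs)))) F)"
    unfolding box_color[OF gs assms(2)] by (rule expectation_bind_finite) auto
  also have "\<dots> \<le> E_pmf (box gs vs) (\<lambda>p. 1 / (1 - tau))"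
  proof (rule expectation_mono_finite)
    fix p assume p: "p \<in> set_pmf (box gs vs)"
    have "set (fst p) \<subseteq> {0, 2, 3}" using box_set[OF p] gs assms(2) by blast
    then have "1 \<notin> set (fst p)" by auto
    moreover have "1 + secs vs - secs (fst p) = 1 - secs gs + secs (snd p)" using box_secs[OF p] by simp
    ultimately show "E_pmf (color_down (1 + secs vs) (fst p) \<bind>
       (\<lambda>as. color (1 - secs gs) (snd p) \<bind> (\<lambda>cs. return_pmf (as, cs)))) F \<le> 1 / (1 - tau)"
      unfolding F_def by (rule color_min_le)
  qed simp
  finally have le: "pmf ?C hs * (pmf ?D vs * E_pmf (box hs vs) F) \<le> 1 / (1 - tau)" by simp
  \<comment> \<open>The starting label 1 puts the left particles at labels at most 0 and the bottom
    ones at labels at least 1. Both exponents are then partial sums of geometric series with first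
    term at most 1.\<close>
  have low: "exp (- (1 / (1 - tau))) \<le> pmf ?C hs" "exp (- (1 / (1 - tau))) \<le> pmf ?D vs"
  proof -
    have "exp (- (1 / (1 - tau))) \<le> exp (- (tau powi (1 - 1) - tau powi (1 - (1 - secs gs))) / (1 - tau))"
      using tau by (auto simp: divide_simps)
    also have "\<dots> \<le> pmf ?C hs" using color_down_ground[of 1 gs] by (simp add: hs)
    finally show "exp (- (1 / (1 - tau))) \<le> pmf ?C hs" .
    have "0 < tau powi (1 + secs vs)" using tau by simp
    then have "tau powi 1 - tau powi (1 + secs vs) \<le> 1" using tau unfolding power_int_1_right by linarith
    then have "exp (- (1 / (1 - tau))) \<le> exp (- (tau powi 1 - tau powi (1 + secs vs)) / (1 - tau))"
      using tau by (auto simp: divide_simps)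
    also have "\<dots> \<le> pmf ?D vs" using color_ground[of 1 vs] by simp
    finally show "exp (- (1 / (1 - tau))) \<le> pmf ?D vs" .
  qed
  have "exp (- (1 / (1 - tau))) * (exp (- (1 / (1 - tau))) * E_pmf (box hs vs) F)
     \<le> pmf ?C hs * (pmf ?D vs * E_pmf (box hs vs) F)"
    by (intro mult_mono low mult_nonneg_nonneg E0) auto
  with le have "exp (- (2 / (1 - tau))) * E_pmf (box hs vs) F \<le> 1 / (1 - tau)"
    by (simp add: mult.assoc[symmetric] flip: exp_add)
  then show ?thesis unfolding F_def inversion_bound_def by (simp add: exp_minus field_simps)
qed

end

section \<open>The quadrant with shock data\<close>

lemma count_list_nth: "real (count_list xs c) = (\<Sum>i<length xs. of_bool (xs ! i = c))"
  proof (induction xs)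
  case (Cons a xs)
  then show ?case
    by (simp only: list.size add_Suc_right add_0_right sum.lessThan_Suc_shift nth_Cons_0 nth_Cons_Suc)
      (auto simp: sum.lessThan_Suc_shift simp del: sum_of_bool_eq)
qed simp

lemma bernoulli_eqI:
  fixes M :: "bool pmf"
  assumes "pmf M True = p" shows "M = bernoulli_pmf p"
proof (rule pmf_eqI)
  have p: "0 \<le> p" "p \<le> 1" using pmf_nonneg[of M True] pmf_le_1[of M True] assms by auto
  have "pmf M True + pmf M False = 1"
    using sum_pmf_eq_1[of "UNIV :: bool set" M] by (simp add: UNIV_bool add.commute subset_eq)
  then show "pmf M x = pmf (bernoulli_pmf p) x" for x using assms p by (cases x) auto
qed

text \<open>Conditioning on the first entry shifts the centred count by \<open>1 - p\<close> or
  \<open>- p\<close>. The shift has mean zero, so each entry adds \<open>p * (1 - p)\<close> to the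
  second moment; this is bounded crudely by 1.\<close>

lemma expectation_bernoulli_count:
  assumes "0 \<le> p" "p \<le> 1"
  defines "M n \<equiv> replicate_pmf n (bernoulli_pmf p)"
  shows "E_pmf (M n) (\<lambda>l. real (count_list l True) - real n * p) = 0" (is "?A n")
    and "E_pmf (M n) (\<lambda>l. (real (count_list l True) - real n * p)\<^sup>2) \<le> real n" (is "?B n")
proof -
  have fin: "finite (set_pmf (M n))" for n by (simp add: M_def finite_set_replicate_pmf)
  have int: "integrable (M n) f" for n and f :: "bool list \<Rightarrow> real"
    using fin by (rule integrable_measure_pmf_finite)
  have step: "E_pmf (M (Suc n)) f = E_pmf (M n) (\<lambda>l. f (True # l)) * p + E_pmf (M n) (\<lambda>l. f (False # l)) * (1 - p)"
    for n f
    unfolding M_def replicate_pmf.simps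
    by (subst expectation_bind_finite) (simp_all add: assms expectation_bind_finite finite_set_replicate_pmf)
  let ?d = "\<lambda>n l. real (count_list l True) - real n * p"
  have A: "?A n" for n
  proof (induction n)
    case (Suc n)
    have "E_pmf (M (Suc n)) (?d (Suc n)) =
      E_pmf (M n) (\<lambda>l. ?d n l + (1 - p)) * p + E_pmf (M n) (\<lambda>l. ?d n l + (- p)) * (1 - p)"
      unfolding step by (simp add: algebra_simps)
    also have "\<dots> = 0" using Suc by (simp only: Bochner_Integration.integral_add int) simp
    finally show ?case .
  qed (simp add: M_def)
  have "?B n" for n
  proof (induction n)
    case (Suc n)
    have sq: "E_pmf (M n) (\<lambda>l. (?d n l + c)\<^sup>2) = E_pmf (M n) (\<lambda>l. (?d n l)\<^sup>2) + c\<^sup>2" for c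
    proof -
      have "E_pmf (M n) (\<lambda>l. (?d n l + c)\<^sup>2) = E_pmf (M n) (\<lambda>l. (?d n l)\<^sup>2 + ((2 * c) * ?d n l + c\<^sup>2))"
        by (simp add: power2_eq_square algebra_simps)
      also have "\<dots> = E_pmf (M n) (\<lambda>l. (?d n l)\<^sup>2) + c\<^sup>2"
        using A[of n] by (simp only: Bochner_Integration.integral_add int integral_mult_right_zero) simp
      finally show ?thesis .
    qed
    have "E_pmf (M (Suc n)) (\<lambda>l. (?d (Suc n) l)\<^sup>2) =
      E_pmf (M n) (\<lambda>l. (?d n l + (1 - p))\<^sup>2) * p + E_pmf (M n) (\<lambda>l. (?d n l + (- p))\<^sup>2) * (1 - p)"
      unfolding step by (simp add: algebra_simps)
    also have "\<dots> = E_pmf (M n) (\<lambda>l. (?d n l)\<^sup>2) + p * (1 - p)"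
      unfolding sq by (simp add: power2_eq_square algebra_simps)
    also have "\<dots> \<le> real n + 1 * 1" using Suc assms by (intro add_mono mult_mono) auto
    finally show ?case by simp
  qed (simp add: M_def)
  with A show "?A n" "?B n" by auto
qed

lemma expectation_bernoulli_deviation:
  assumes "0 \<le> p" "p \<le> 1"
  shows "E_pmf (replicate_pmf n (bernoulli_pmf p)) (\<lambda>l. \<bar>real (count_list l True) - real n * p\<bar>) \<le> sqrt (real n)"
proof -
  let ?M = "replicate_pmf n (bernoulli_pmf p)" and ?X = "\<lambda>l. \<bar>real (count_list l True) - real n * p\<bar>"
  have int: "integrable ?M f" for f :: "bool list \<Rightarrow> real"
    by (intro integrable_measure_pmf_finite finite_set_replicate_pmf) simp
  \<comment> \<open>Jensen's inequality for the square, in the form of a nonnegative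
    variance.\<close>
  have "(E_pmf ?M ?X)\<^sup>2 \<le> E_pmf ?M (\<lambda>l. (?X l)\<^sup>2)"
    using measure_pmf.variance_positive[of ?M ?X] measure_pmf.variance_eq[of ?M ?X] int by simp
  also have "\<dots> \<le> real n" using expectation_bernoulli_count(2)[OF assms, of n] by simp
  finally show ?thesis by (rule real_le_rsqrt)
qed

context six_vertex
begin

lemma flux_mono: assumes "0 \<le> x" "x < y" shows "flux x < flux y"
proof -
  have "0 < (1 - b1) * (1 - b2) * (y - x)" using b assms by auto
  then have "(1 - b1) * x * ((b2 - b1) * y + (1 - b2)) < (1 - b1) * y * ((b2 - b1) * x + (1 - b2))"
    by (simp add: algebra_simps)
  then show ?thesis using flux_den_pos[of x] flux_den_pos[of y] assms by (simp add: flux_alt divide_simps)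
qed

definition quadrant :: "nat \<Rightarrow> nat \<Rightarrow> 'a::linorder pmf \<Rightarrow> 'a pmf \<Rightarrow> ('a list \<times> 'a list) pmf" where
  "quadrant t m l b = replicate_pmf t l \<bind> (\<lambda>hs. replicate_pmf m b \<bind> (\<lambda>vs. box hs vs))"

lemma quadrant_map:
  assumes "mono f"
  shows "map_pmf (map_prod (map f) (map f)) (quadrant t m l b) = quadrant t m (map_pmf f l) (map_pmf f b)"
  unfolding quadrant_def map_bind_pmf replicate_pmf_map bind_map_pmf box_map[OF assms, symmetric] ..

lemma quadrant_stationary:
  assumes "0 \<le> s" "s \<le> 1"
  shows "quadrant t m (bernoulli_pmf (flux s)) (bernoulli_pmf s) =
    pair_pmf (replicate_pmf t (bernoulli_pmf (flux s))) (replicate_pmf m (bernoulli_pmf s))"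
  unfolding quadrant_def by (rule box_stationary[OF assms])

lemma finite_quadrant:
  "finite (set_pmf l) \<Longrightarrow> finite (set_pmf b) \<Longrightarrow> finite (set_pmf (quadrant t m l b))"
  unfolding quadrant_def by (auto simp: finite_set_replicate_pmf)

lemma quadrant_length:
  assumes "p \<in> set_pmf (quadrant t m l b)" shows "length (fst p) = t" "length (snd p) = m"
  using assms by (auto simp: quadrant_def set_replicate_pmf dest!: box_length)

lemma quadrant_append:
  "quadrant t (m + n) l b = quadrant t m l b \<bind> (\<lambda>p. replicate_pmf n b \<bind> (\<lambda>vs. box (fst p) vs \<bind>
     (\<lambda>q. return_pmf (fst q, snd p @ snd q))))"
proof -
  have "quadrant t (m + n) l b = replicate_pmf t l \<bind> (\<lambda>hs. replicate_pmf m b \<bind> (\<lambda>us.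
    replicate_pmf n b \<bind> (\<lambda>vs. box hs us \<bind> (\<lambda>p. box (fst p) vs \<bind> (\<lambda>q. return_pmf (fst q, snd p @ snd q))))))"
    unfolding quadrant_def replicate_pmf_distrib bind_assoc_pmf bind_return_pmf box_append ..
  also have "\<dots> = replicate_pmf t l \<bind> (\<lambda>hs. replicate_pmf m b \<bind> (\<lambda>us. box hs us \<bind> (\<lambda>p.
    replicate_pmf n b \<bind> (\<lambda>vs. box (fst p) vs \<bind> (\<lambda>q. return_pmf (fst q, snd p @ snd q))))))"
    by (subst bind_commute_pmf[of "replicate_pmf n b"]) (rule refl)
  finally show ?thesis by (simp add: quadrant_def bind_assoc_pmf)
qed

text \<open>Columns do not influence those to their left. The top outputs are therefore consistent
  in the width, and densities of single sites are well defined.\<close>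

lemma quadrant_take:
  "map_pmf (\<lambda>p. take m (snd p)) (quadrant t (m + n) l b) = map_pmf snd (quadrant t m l b)"
proof -
  have "map_pmf (\<lambda>p. take m (snd p)) (quadrant t (m + n) l b) =
    quadrant t m l b \<bind> (\<lambda>p. replicate_pmf n b \<bind> (\<lambda>vs. box (fst p) vs \<bind>
     (\<lambda>q. return_pmf (take m (snd p @ snd q)))))"
    by (simp add: quadrant_append map_bind_pmf)
  also have "\<dots> = quadrant t m l b \<bind> (\<lambda>p. replicate_pmf n b \<bind> (\<lambda>vs. box (fst p) vs \<bind>
     (\<lambda>q. return_pmf (snd p))))"
    by (intro bind_pmf_cong refl) (auto dest: quadrant_length)
  finally show ?thesis by (simp add: map_pmf_def)
qed

text \<open>Nested Bernoulli variables of means \<open>q\<close> and \<open>p\<close>: the ratio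
  \<open>q / p\<close> thins the outer layer to the inner one, and class \<open>a\<close> marks the
  difference. Taking \<open>a = 0\<close> removes the marked layer.\<close>

definition layered :: "real \<Rightarrow> real \<Rightarrow> nat \<Rightarrow> nat pmf" where
  "layered p q a = bernoulli_pmf p \<bind> (\<lambda>x. bernoulli_pmf (q / p) \<bind>
     (\<lambda>y. return_pmf (if x then if y then 3 else a else 0)))"

lemma set_layered: "set_pmf (layered p q a) \<subseteq> {0, a, 3}"
  by (auto simp: layered_def split: if_splits)

lemma finite_layered [simp]: "finite (set_pmf (layered p q a))"
  using set_layered by (rule finite_subset) simp

lemma map_layered:
  assumes "0 < p" "p \<le> 1" "0 \<le> q" "q \<le> p" "\<not> P 0" "P 3"
  shows "map_pmf P (layered p q a) = bernoulli_pmf (if P a then p else q)"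
proof (rule bernoulli_eqI)
  have "q / p \<le> 1" "0 \<le> q / p" using assms by auto
  then show "pmf (map_pmf P (layered p q a)) True = (if P a then p else q)"
    using assms by (simp add: layered_def map_pmf_def pmf_bind bind_assoc_pmf bind_return_pmf)
qed

end

section \<open>The four-class coupling\<close>

locale shock = six_vertex +
  fixes \<theta> \<rho> :: real
  assumes dens: "0 \<le> \<theta>" "\<theta> < \<rho>" "\<rho> \<le> 1"
begin

lemma dens_simps [simp]: "0 \<le> \<rho>" "0 < \<rho>" "\<theta> \<le> 1" "\<theta> \<le> \<rho>" using dens by auto
lemmas [simp] = dens(1,3)

lemma flux_simps [simp]: "0 \<le> flux \<theta>" "flux \<theta> \<le> 1" "0 \<le> flux \<rho>" "flux \<rho> \<le> 1" "0 < flux \<rho>" "flux \<theta> \<le> flux \<rho>"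
  using flux_bounds[of \<theta>] flux_bounds[of \<rho>] flux_mono[of \<theta> \<rho>] dens by auto

definition left :: "nat pmf" where "left = layered (flux \<rho>) (flux \<theta>) 1"
definition bottom :: "nat pmf" where "bottom = layered \<rho> \<theta> 2"

lemma set_left: "set_pmf left \<subseteq> {0, 1, 3}" and set_bottom: "set_pmf bottom \<subseteq> {0, 2, 3}"
  unfolding left_def bottom_def by (rule set_layered)+

lemma finite_left [simp]: "finite (set_pmf left)" and finite_bottom [simp]: "finite (set_pmf bottom)"
  by (simp_all add: left_def bottom_def)

lemma map_left: "map_pmf ((\<le>) 1) left = bernoulli_pmf (flux \<rho>)" "map_pmf ((\<le>) 2) left = bernoulli_pmf (flux \<theta>)"
    "map_pmf ((\<le>) 3) left = bernoulli_pmf (flux \<theta>)"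
  by (simp_all add: left_def map_layered)

lemma map_bottom: "map_pmf ((\<le>) 1) bottom = bernoulli_pmf \<rho>" "map_pmf ((\<le>) 2) bottom = bernoulli_pmf \<rho>"
    "map_pmf ((\<le>) 3) bottom = bernoulli_pmf \<theta>"
  by (simp_all add: bottom_def map_layered)

definition coupled :: "nat \<Rightarrow> nat \<Rightarrow> (nat list \<times> nat list) pmf" where
  "coupled t m = quadrant t m left bottom"

definition shock_law :: "nat \<Rightarrow> nat \<Rightarrow> (bool list \<times> bool list) pmf" where
  "shock_law t m = quadrant t m (bernoulli_pmf (flux \<theta>)) (bernoulli_pmf \<rho>)"

lemma mono_threshold: "mono ((\<le>) (k::nat))" by (auto simp: mono_def)

text \<open>Threshold 3 sees \<open>\<theta>\<close> and threshold 1 sees \<open>\<rho>\<close> on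
  both sides, hence stationary models. Threshold 2 keeps a second class particle only if it came
  from below: \<open>flux \<theta>\<close> on the left and \<open>\<rho>\<close> at the bottom, the
  shock data.\<close>

lemma coupled_threshold:
  "map_pmf (map_prod (map ((\<le>) 3)) (map ((\<le>) 3))) (coupled t m) =
     pair_pmf (replicate_pmf t (bernoulli_pmf (flux \<theta>))) (replicate_pmf m (bernoulli_pmf \<theta>))"
  "map_pmf (map_prod (map ((\<le>) 2)) (map ((\<le>) 2))) (coupled t m) = shock_law t m"
  "map_pmf (map_prod (map ((\<le>) 1)) (map ((\<le>) 1))) (coupled t m) =
     pair_pmf (replicate_pmf t (bernoulli_pmf (flux \<rho>))) (replicate_pmf m (bernoulli_pmf \<rho>))"
  unfolding coupled_def shock_law_def quadrant_map[OF mono_threshold] map_left map_bottom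
  by (simp_all add: quadrant_stationary)

lemma finite_coupled [simp]: "finite (set_pmf (coupled t m))"
  and finite_shock_law [simp]: "finite (set_pmf (shock_law t m))"
  by (simp_all add: coupled_def shock_law_def finite_quadrant)

lemma integrable_coupled: "integrable (coupled t m) (f :: _ \<Rightarrow> real)"
  by (rule integrable_measure_pmf_finite) simp

text \<open>Columns are counted from 0, so column \<open>x\<close> stands for the lattice site
  \<open>x + 1\<close>, the first one to the right of the origin being column 0.\<close>

definition site_density :: "nat \<Rightarrow> nat \<Rightarrow> real" where
  "site_density t x = E_pmf (shock_law t (Suc x)) (\<lambda>p. of_bool (snd p ! x))"

lemma density_eq:
  assumes "x < m" shows "E_pmf (shock_law t m) (\<lambda>p. of_bool (snd p ! x)) = site_density t x"
proof -
  obtain n where m: "m = Suc x + n" using assms less_iff_Suc_add by (metis add_Suc)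
  have "E_pmf (shock_law t m) (\<lambda>p. of_bool (snd p ! x)) =
    E_pmf (map_pmf (\<lambda>p. take (Suc x) (snd p)) (shock_law t m)) (\<lambda>l. of_bool (l ! x))"
    by simp
  also have "\<dots> = site_density t x"
    unfolding shock_law_def m quadrant_take site_density_def by simp
  finally show ?thesis .
qed

lemma coupled_density:
  assumes "x < m"
  shows "E_pmf (coupled t m) (\<lambda>p. of_bool (3 \<le> snd p ! x)) = \<theta>"
    and "E_pmf (coupled t m) (\<lambda>p. of_bool (2 \<le> snd p ! x)) = site_density t x"
    and "E_pmf (coupled t m) (\<lambda>p. of_bool (1 \<le> snd p ! x)) = \<rho>"
proof -
  have thr: "E_pmf (coupled t m) (\<lambda>p. of_bool (k \<le> snd p ! x)) =
    E_pmf (map_pmf (map_prod (map ((\<le>) k)) (map ((\<le>) k))) (coupled t m)) (\<lambda>p. of_bool (snd p ! x))" for k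
    using assms by (simp, intro expectation_cong_pmf) (auto simp: coupled_def dest: quadrant_length)
  have iid: "E_pmf (replicate_pmf m (bernoulli_pmf s)) (\<lambda>l. of_bool (l ! x)) = s" if "0 \<le> s" "s \<le> 1" for s
    using assms
  proof (induction m arbitrary: x)
    case (Suc m)
    then show ?case using that
      by (cases x) (simp_all add: expectation_bind_finite finite_set_replicate_pmf)
  qed simp
  show "E_pmf (coupled t m) (\<lambda>p. of_bool (2 \<le> snd p ! x)) = site_density t x"
    unfolding thr coupled_threshold using density_eq[OF assms] by simp
  have pr: "E_pmf (pair_pmf p q) (\<lambda>p. of_bool (snd p ! x)) = E_pmf q (\<lambda>l. of_bool (l ! x))"
    for p :: "bool list pmf" and q
    using integral_map_pmf[of snd "pair_pmf p q" "\<lambda>l. of_bool (l ! x) :: real"] by (simp add: map_snd_pair_pmf)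
  show "E_pmf (coupled t m) (\<lambda>p. of_bool (3 \<le> snd p ! x)) = \<theta>"
    "E_pmf (coupled t m) (\<lambda>p. of_bool (1 \<le> snd p ! x)) = \<rho>"
    unfolding thr coupled_threshold pr by (simp_all add: iid)
qed

text \<open>A single class is the difference of two consecutive thresholds. The excess over
  \<open>\<theta>\<close> is thus carried by colour 2 and the deficit to \<open>\<rho>\<close> by
  colour 1, which turns density bounds into particle counts.\<close>

lemma coupled_class_prob:
  assumes "x < m"
  shows "E_pmf (coupled t m) (\<lambda>p. of_bool (snd p ! x = 2)) = site_density t x - \<theta>"
    and "E_pmf (coupled t m) (\<lambda>p. of_bool (snd p ! x = 1)) = \<rho> - site_density t x"
proof -
  have *: "of_bool (c = (2::nat)) = (of_bool (2 \<le> c) - of_bool (3 \<le> c) :: real)"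
     "of_bool (c = (1::nat)) = (of_bool (1 \<le> c) - of_bool (2 \<le> c) :: real)" for c
    by auto
  show "E_pmf (coupled t m) (\<lambda>p. of_bool (snd p ! x = 2)) = site_density t x - \<theta>"
    "E_pmf (coupled t m) (\<lambda>p. of_bool (snd p ! x = 1)) = \<rho> - site_density t x"
    unfolding * using coupled_density[OF assms] by (simp_all add: integrable_coupled)
qed

lemma density_bounds: "\<theta> \<le> site_density t x" "site_density t x \<le> \<rho>"
proof -
  have "0 \<le> E_pmf (coupled t (Suc x)) (\<lambda>p. of_bool (snd p ! x = c))" for c
    by (rule integral_nonneg_AE) simp
  from this[of 2] this[of 1] show "\<theta> \<le> site_density t x" "site_density t x \<le> \<rho>"
    using coupled_class_prob[OF lessI, of t x] by linarith+
qed

end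

section \<open>Second class particles leaving a box\<close>

lemma count_list_map_ge:
  assumes "set xs \<subseteq> {0, 1, 2, 3::nat}"
  shows "count_list (map ((\<le>) 1) xs) True = count_list xs 1 + count_list xs 2 + count_list xs 3"
    and "count_list (map ((\<le>) 3) xs) True = count_list xs 3"
  using assms by (induction xs) auto

context shock
begin

text \<open>Mean of colour 2 on top minus colour 1 on the right, that is, of the second class
  particles entering from below minus all those leaving on the right. Its sign tells on which side
  of the shock the column \<open>m\<close> lies at time \<open>t\<close>.\<close>

definition drift :: "nat \<Rightarrow> nat \<Rightarrow> real" where
  "drift t m = real m * (\<rho> - \<theta>) - real t * (flux \<rho> - flux \<theta>)"

text \<open>The bound on inversions together with the deviations of four Bernoulli counts, two of
  length \<open>m\<close> and two of length \<open>t\<close>.\<close>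

definition fluct :: "nat \<Rightarrow> nat \<Rightarrow> real" where
  "fluct t m = inversion_bound + 2 * sqrt (real m) + 2 * sqrt (real t)"

text \<open>Keeps the bottom input in the sample, because the conserved difference compares the
  outputs with it.\<close>

definition traced :: "nat \<Rightarrow> nat \<Rightarrow> (nat list \<times> nat list \<times> nat list) pmf" where
  "traced t m = replicate_pmf t left \<bind> (\<lambda>hs. replicate_pmf m bottom \<bind> (\<lambda>vs. box hs vs \<bind> (\<lambda>p. return_pmf (vs, p))))"

lemma traced_snd: "map_pmf snd (traced t m) = coupled t m"
  by (simp add: traced_def coupled_def quadrant_def map_bind_pmf bind_return_pmf')

lemma traced_fst: "map_pmf fst (traced t m) = replicate_pmf m bottom"
  by (simp add: traced_def map_bind_pmf bind_return_pmf')

lemma finite_traced [simp]: "finite (set_pmf (traced t m))"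
  by (auto simp: traced_def finite_set_replicate_pmf)

lemma integrable_traced: "integrable (traced t m) (f :: _ \<Rightarrow> real)"
  by (rule integrable_measure_pmf_finite) simp

text \<open>The difference of the two second class counts is a function of stationary counts only.\<close>

lemma traced_difference:
  assumes "(vs, ho, vo) \<in> set_pmf (traced t m)"
  shows "real (count_list vo 2) - real (count_list ho 1) =
    (real (count_list (map ((\<le>) 1) vs) True) - real (count_list (map ((\<le>) 3) vs) True)) -
    (real (count_list (map ((\<le>) 1) ho) True) - real (count_list (map ((\<le>) 3) ho) True))"
proof -
  from assms obtain hs where hs: "hs \<in> set_pmf (replicate_pmf t left)" and vs: "vs \<in> set_pmf (replicate_pmf m bottom)"
    and p: "(ho, vo) \<in> set_pmf (box hs vs)" by (auto simp: traced_def)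
  have shs: "set hs \<subseteq> {0, 1, 3}" using hs set_left by (auto simp: set_replicate_pmf)
  have svs: "set vs \<subseteq> {0, 2, 3}" using vs set_bottom by (auto simp: set_replicate_pmf)
  have sho: "set ho \<subseteq> {0, 1, 2, 3}" using box_set[OF p] shs svs by auto
  \<comment> \<open>Colour 2 enters only from below and colour 1 only from the left. Hence colour 2
    on top is the whole second class input from below minus the colour 2 that leaves on the
    right.\<close>
  have "count_list hs 2 = 0" "count_list vs 1 = 0"
    using shs svs by (auto simp: count_list_0_iff)
  moreover have "count_list ho 2 + count_list vo 2 = count_list hs 2 + count_list vs 2"
    using box_secs[OF p] by (simp add: secs_count)
  moreover have "set vs \<subseteq> {0, 1, 2, 3}" using svs by auto
  ultimately show ?thesis using count_list_map_ge[OF sho] count_list_map_ge[of vs] by simp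
qed

text \<open>After centring there remain four Bernoulli counts: the bottom inputs are Bernoulli by
  construction, the right outputs by stationarity at thresholds 1 and 3.\<close>

lemma traced_deviation:
  "E_pmf (traced t m) (\<lambda>(vs, ho, vo). \<bar>real (count_list vo 2) - real (count_list ho 1) - drift t m\<bar>)
    \<le> 2 * sqrt (real m) + 2 * sqrt (real t)"
proof -
  let ?c = "\<lambda>k xs. real (count_list (map ((\<le>) (k::nat)) xs) True)"
  let ?d1 = "\<lambda>q. \<bar>?c 1 (fst q) - real m * \<rho>\<bar>" and ?d2 = "\<lambda>q. \<bar>?c 3 (fst q) - real m * \<theta>\<bar>"
  let ?d3 = "\<lambda>q. \<bar>?c 1 (fst (snd q)) - real t * flux \<rho>\<bar>" and ?d4 = "\<lambda>q. \<bar>?c 3 (fst (snd q)) - real t * flux \<theta>\<bar>"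
  have "E_pmf (traced t m) (\<lambda>(vs, ho, vo). \<bar>real (count_list vo 2) - real (count_list ho 1) - drift t m\<bar>) \<le>
    E_pmf (traced t m) (\<lambda>q. (?d1 q + ?d2 q) + (?d3 q + ?d4 q))"
  proof (rule expectation_mono_finite)
    fix q assume "q \<in> set_pmf (traced t m)"
    moreover obtain vs ho vo where q: "q = (vs, ho, vo)" by (cases q)
    moreover have *: "\<bar>(x - y) - (z - w) - (real m * (\<rho> - \<theta>) - real t * (flux \<rho> - flux \<theta>))\<bar> \<le>
      (\<bar>x - real m * \<rho>\<bar> + \<bar>y - real m * \<theta>\<bar>) + (\<bar>z - real t * flux \<rho>\<bar> + \<bar>w - real t * flux \<theta>\<bar>)" for x y z w
      unfolding right_diff_distrib by linarith
    ultimately show "(case q of (vs, ho, vo) \<Rightarrow> \<bar>real (count_list vo 2) - real (count_list ho 1) - drift t m\<bar>)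
      \<le> (?d1 q + ?d2 q) + (?d3 q + ?d4 q)"
      using *[of "?c 1 vs" "?c 3 vs" "?c 1 ho" "?c 3 ho"] traced_difference[of vs ho vo t m] by (simp only: drift_def prod.case fst_conv snd_conv)
  qed simp
  also have "\<dots> = (E_pmf (traced t m) ?d1 + E_pmf (traced t m) ?d2) + (E_pmf (traced t m) ?d3 + E_pmf (traced t m) ?d4)"
    by (simp only: Bochner_Integration.integral_add integrable_traced)
  also have "\<dots> \<le> (sqrt (real m) + sqrt (real m)) + (sqrt (real t) + sqrt (real t))"
  proof (intro add_mono)
    have bot: "E_pmf (traced t m) (\<lambda>q. \<bar>?c k (fst q) - z\<bar>) =
      E_pmf (replicate_pmf m (map_pmf ((\<le>) k) bottom)) (\<lambda>l. \<bar>real (count_list l True) - z\<bar>)" for k z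
      unfolding replicate_pmf_map traced_fst[of t m, symmetric] by simp
    show "E_pmf (traced t m) ?d1 \<le> sqrt (real m)" "E_pmf (traced t m) ?d2 \<le> sqrt (real m)"
      unfolding bot map_bottom by (simp_all add: expectation_bernoulli_deviation)
    have right: "E_pmf (traced t m) (\<lambda>q. \<bar>?c k (fst (snd q)) - z\<bar>) =
      E_pmf (map_pmf fst (map_pmf (map_prod (map ((\<le>) k)) (map ((\<le>) k))) (coupled t m)))
        (\<lambda>l. \<bar>real (count_list l True) - z\<bar>)" for k z
      unfolding traced_snd[of t m, symmetric] by simp
    show "E_pmf (traced t m) ?d3 \<le> sqrt (real t)" "E_pmf (traced t m) ?d4 \<le> sqrt (real t)"
      unfolding right coupled_threshold map_fst_pair_pmf by (simp_all add: expectation_bernoulli_deviation)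
  qed
  finally show ?thesis by simp
qed

lemma coupled_inversions_le:
  "E_pmf (coupled t m) (\<lambda>p. real (min (count_list (fst p) 1) (count_list (snd p) 2))) \<le> inversion_bound"
proof -
  let ?F = "\<lambda>p. real (min (count_list (fst p) 1) (count_list (snd p) 2))"
  have "E_pmf (coupled t m) ?F = E_pmf (replicate_pmf t left) (\<lambda>hs. E_pmf (replicate_pmf m bottom) (\<lambda>vs. E_pmf (box hs vs) ?F))"
    unfolding coupled_def quadrant_def by (simp add: expectation_bind_finite finite_set_replicate_pmf)
  also have "\<dots> \<le> E_pmf (replicate_pmf t left) (\<lambda>hs. E_pmf (replicate_pmf m bottom) (\<lambda>vs. inversion_bound))"
    using set_left set_bottom
    by (intro expectation_mono_finite finite_set_replicate_pmf box_inversions_le)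
      (auto simp: set_replicate_pmf)
  finally show ?thesis by simp
qed

text \<open>For \<open>d \<le> 0\<close> any numbers satisfy
  \<open>x \<le> min x y + \<bar>x - y - d\<bar>\<close>, and for \<open>0 \<le> d\<close> the same
  bound holds for \<open>y\<close>. The two terms are controlled by
  \<open>coupled_inversions_le\<close> and \<open>traced_deviation\<close>.\<close>

lemma second_class_le:
  shows "drift t m \<le> 0 \<Longrightarrow> E_pmf (coupled t m) (\<lambda>p. real (count_list (snd p) 2)) \<le> fluct t m"
    and "0 \<le> drift t m \<Longrightarrow> E_pmf (coupled t m) (\<lambda>p. real (count_list (fst p) 1)) \<le> fluct t m"
proof -
  let ?F = "\<lambda>p. real (min (count_list (fst p) 1) (count_list (snd p) 2))"
  let ?K = "\<lambda>(vs, ho, vo). \<bar>real (count_list vo 2) - real (count_list ho 1) - drift t m\<bar>"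
  have bd: "E_pmf (coupled t m) G \<le> fluct t m"
    if G: "\<And>vs ho vo. G (ho, vo) \<le> ?F (ho, vo) + ?K (vs, ho, vo)" for G
  proof -
    have "E_pmf (coupled t m) G = E_pmf (traced t m) (\<lambda>q. G (snd q))"
      unfolding traced_snd[symmetric] by simp
    also have "\<dots> \<le> E_pmf (traced t m) (\<lambda>q. ?F (snd q) + ?K q)"
      using G by (intro expectation_mono_finite) auto
    also have "\<dots> = E_pmf (traced t m) (\<lambda>q. ?F (snd q)) + E_pmf (traced t m) ?K"
      by (simp only: Bochner_Integration.integral_add integrable_traced)
    also have "E_pmf (traced t m) (\<lambda>q. ?F (snd q)) = E_pmf (coupled t m) ?F"
      unfolding traced_snd[symmetric] by simp
    finally show ?thesis using coupled_inversions_le[of t m] traced_deviation[of t m] by (simp add: fluct_def)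
  qed
  show "drift t m \<le> 0 \<Longrightarrow> E_pmf (coupled t m) (\<lambda>p. real (count_list (snd p) 2)) \<le> fluct t m"
    "0 \<le> drift t m \<Longrightarrow> E_pmf (coupled t m) (\<lambda>p. real (count_list (fst p) 1)) \<le> fluct t m"
    by (rule bd; simp add: min_def abs_if)+
qed

lemma density_sum_low:
  assumes "drift t m \<le> 0"
  shows "(\<Sum>x<m. site_density t x - \<theta>) \<le> fluct t m"
proof -
  have "(\<Sum>x<m. site_density t x - \<theta>) = (\<Sum>x<m. E_pmf (coupled t m) (\<lambda>p. of_bool (snd p ! x = 2)))"
    by (intro sum.cong refl) (simp add: coupled_class_prob)
  also have "\<dots> = E_pmf (coupled t m) (\<lambda>p. (\<Sum>x<m. of_bool (snd p ! x = 2)))"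
    by (simp only: Bochner_Integration.integral_sum integrable_coupled)
  also have "\<dots> = E_pmf (coupled t m) (\<lambda>p. real (count_list (snd p) 2))"
    by (rule expectation_cong_pmf) (auto simp: count_list_nth coupled_def quadrant_length simp del: sum_of_bool_eq)
  finally show ?thesis using second_class_le(1)[OF assms] by simp
qed

text \<open>Colour 1 never enters from below. A particle of colour 1 found on top beyond column
  \<open>m\<close> must therefore have left the box of width \<open>m\<close> through its right
  side.\<close>

lemma density_sum_high:
  assumes "0 \<le> drift t m"
  shows "(\<Sum>x<n. \<rho> - site_density t (m + x)) \<le> fluct t m"
proof -
  have "(\<Sum>x<n. \<rho> - site_density t (m + x)) = (\<Sum>x<n. E_pmf (coupled t (m + n)) (\<lambda>p. of_bool (snd p ! (m + x) = 1)))"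
    by (intro sum.cong refl, subst coupled_class_prob(2)) auto
  also have "\<dots> = E_pmf (coupled t (m + n)) (\<lambda>p. (\<Sum>x<n. of_bool (snd p ! (m + x) = 1)))"
    by (simp only: Bochner_Integration.integral_sum integrable_coupled)
  also have "\<dots> = E_pmf (coupled t (m + n)) (\<lambda>p. real (count_list (drop m (snd p)) 1))"
    unfolding count_list_nth
    by (rule expectation_cong_pmf) (auto simp: coupled_def quadrant_length simp del: sum_of_bool_eq)
  also have "\<dots> = E_pmf (coupled t m) (\<lambda>p. E_pmf (replicate_pmf n bottom) (\<lambda>vs. E_pmf (box (fst p) vs)
     (\<lambda>q. real (count_list (drop m (snd p @ snd q)) 1))))"
    unfolding coupled_def quadrant_append
    by (simp add: expectation_bind_finite finite_set_replicate_pmf finite_quadrant)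
  also have "\<dots> \<le> E_pmf (coupled t m) (\<lambda>p. E_pmf (replicate_pmf n bottom) (\<lambda>vs. E_pmf (box (fst p) vs)
     (\<lambda>q. real (count_list (fst p) 1))))"
  proof (intro expectation_mono_finite)
    fix p vs q assume p: "p \<in> set_pmf (coupled t m)" and vs: "vs \<in> set_pmf (replicate_pmf n bottom)"
      and q: "q \<in> set_pmf (box (fst p) vs)"
    have "1 \<notin> set vs" using vs set_bottom by (auto simp: set_replicate_pmf)
    then have "count_list vs 1 = 0" by (simp add: count_list_0_iff)
    moreover have "count (mset (fst q) + mset (snd q)) 1 = count (mset (fst p) + mset vs) 1"
      using box_mset[OF q] by simp
    then have "count_list (fst q) 1 + count_list (snd q) 1 = count_list (fst p) 1 + count_list vs 1"
      by (simp add: count_mset)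
    moreover have "drop m (snd p @ snd q) = snd q" using p by (simp add: coupled_def quadrant_length)
    ultimately show "real (count_list (drop m (snd p @ snd q)) 1) \<le> real (count_list (fst p) 1)" by simp
  qed (auto simp: finite_set_replicate_pmf)
  finally show ?thesis using second_class_le(2)[OF assms] by simp
qed

end

section \<open>Monotone densities and the comparison of windows\<close>

lemma pmf_as_expectation: "pmf (map_pmf f p) z = E_pmf p (\<lambda>x. of_bool (f x = z))"
proof -
  have "(\<lambda>x. of_bool (f x = z)) = (\<lambda>x. indicator {z} (f x) :: real)" by (auto simp: indicator_def)
  then have "E_pmf p (\<lambda>x. of_bool (f x = z)) = E_pmf (map_pmf f p) (indicator {z})"
    by (simp only: integral_map_pmf)
  also have "\<dots> = pmf (map_pmf f p) z" by (simp only: Bochner_Integration.integral_indicator) (simp add: measure_pmf_single)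
  finally show ?thesis ..
qed

lemma drop_replicate_pmf: "map_pmf (drop a) (replicate_pmf (a + k) p) = replicate_pmf k p"
  by (induction a) (simp_all add: map_bind_pmf map_pmf_def[symmetric] pmf.map_comp o_def)

context shock
begin

text \<open>Lowering the density of the first column from \<open>\<rho>\<close> to \<open>\<theta>\<close> makes that column stationary, so
  that the rest is the same process translated by one site.\<close>

lemma density_mono_Suc: "site_density t x \<le> site_density t (Suc x)"
proof -
  \<comment> \<open>With third parameter 0, the inputs \<open>l\<close> and \<open>d\<close> take
    only the classes 0 and 3 and look the same at thresholds 2 and 3. Only the first bottom site
    \<open>c\<close> differs: density \<open>\<rho>\<close> at threshold 2 and
    \<open>\<theta>\<close> at threshold 3.\<close>
  define l :: "nat pmf" where "l = layered (flux \<rho>) (flux \<theta>) 0"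
  define c :: "nat pmf" where "c = layered \<rho> \<theta> 2"
  define d :: "nat pmf" where "d = layered 1 \<rho> 0"
  have l: "map_pmf ((\<le>) 2) l = bernoulli_pmf (flux \<theta>)" "map_pmf ((\<le>) 3) l = bernoulli_pmf (flux \<theta>)"
    unfolding l_def by (subst map_layered; simp)+
  have c: "map_pmf ((\<le>) 2) c = bernoulli_pmf \<rho>" "map_pmf ((\<le>) 3) c = bernoulli_pmf \<theta>"
    unfolding c_def by (subst map_layered; simp)+
  have d: "map_pmf ((\<le>) 2) d = bernoulli_pmf \<rho>" "map_pmf ((\<le>) 3) d = bernoulli_pmf \<rho>"
    unfolding d_def by (subst map_layered; simp)+
  define J where "J = replicate_pmf t l \<bind> (\<lambda>hs. c \<bind> (\<lambda>v. replicate_pmf (Suc x) d \<bind> (\<lambda>vs. box hs (v # vs))))"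
  have map_J: "map_pmf (map_prod (map ((\<le>) k)) (map ((\<le>) k))) J =
    replicate_pmf t (map_pmf ((\<le>) k) l) \<bind> (\<lambda>hs. map_pmf ((\<le>) k) c \<bind> (\<lambda>v.
      replicate_pmf (Suc x) (map_pmf ((\<le>) k) d) \<bind> (\<lambda>vs. box hs (v # vs))))" for k
    unfolding J_def map_bind_pmf replicate_pmf_map bind_map_pmf box_map[OF mono_threshold]
      list.map(2)[symmetric] ..
  have fin: "finite (set_pmf J)"
    by (auto simp: J_def l_def c_def d_def finite_set_replicate_pmf)
  have len: "length (snd p) = Suc (Suc x)" if "p \<in> set_pmf J" for p
    using that by (auto simp: J_def set_replicate_pmf dest!: box_length)
  have thr: "E_pmf J (\<lambda>p. of_bool (k \<le> snd p ! Suc x)) =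
    E_pmf (map_pmf (map_prod (map ((\<le>) k)) (map ((\<le>) k))) J) (\<lambda>p. of_bool (snd p ! Suc x))" for k
    by (simp, intro expectation_cong_pmf) (auto simp: len)
  have "map_pmf (map_prod (map ((\<le>) 2)) (map ((\<le>) 2))) J = shock_law t (Suc (Suc x))"
    unfolding map_J l c d shock_law_def quadrant_def replicate_pmf.simps(2)[of "Suc x"]
    by (simp only: bind_assoc_pmf bind_return_pmf)
  then have hi: "E_pmf J (\<lambda>p. of_bool (2 \<le> snd p ! Suc x)) = site_density t (Suc x)"
    unfolding thr by (simp only: site_density_def)
  let ?H = "replicate_pmf t (bernoulli_pmf (flux \<theta>))" and ?V = "replicate_pmf (Suc x) (bernoulli_pmf \<rho>)"
  let ?k = "\<lambda>v p. ?V \<bind> (\<lambda>vs. box (fst p) vs \<bind> (\<lambda>q. return_pmf (fst q, v @ snd q)))"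
  have "map_pmf (map_prod (map ((\<le>) 3)) (map ((\<le>) 3))) J =
    ?H \<bind> (\<lambda>hs. bernoulli_pmf \<theta> \<bind> (\<lambda>v. ?V \<bind> (\<lambda>vs. box hs [v] \<bind> (\<lambda>p. box (fst p) vs \<bind>
      (\<lambda>q. return_pmf (fst q, snd p @ snd q))))))"
    unfolding map_J l c d using box_append[of _ "[_]"]
    by (intro bind_pmf_cong refl) (simp only: append.simps)
  also have "\<dots> = ?H \<bind> (\<lambda>hs. bernoulli_pmf \<theta> \<bind> (\<lambda>v. box hs [v] \<bind> (\<lambda>p. ?V \<bind> (\<lambda>vs. box (fst p) vs \<bind>
      (\<lambda>q. return_pmf (fst q, snd p @ snd q))))))"
    by (subst bind_commute_pmf[of ?V]) (rule refl)
  also have "\<dots> = quadrant t 1 (bernoulli_pmf (flux \<theta>)) (bernoulli_pmf \<theta>) \<bind> (\<lambda>p. ?V \<bind> (\<lambda>vs. box (fst p) vs \<bind>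
      (\<lambda>q. return_pmf (fst q, snd p @ snd q))))"
    unfolding quadrant_def replicate_pmf_1 bind_map_pmf bind_assoc_pmf ..
  also have "\<dots> = replicate_pmf 1 (bernoulli_pmf \<theta>) \<bind> (\<lambda>v. ?H \<bind> (\<lambda>hs. ?V \<bind> (\<lambda>vs. box hs vs \<bind>
      (\<lambda>q. return_pmf (fst q, v @ snd q)))))"
    unfolding quadrant_stationary[OF dens(1) dens_simps(3)] pair_pmf_def bind_assoc_pmf bind_return_pmf fst_conv snd_conv
    by (rule bind_commute_pmf)
  also have "\<dots> = replicate_pmf 1 (bernoulli_pmf \<theta>) \<bind> (\<lambda>v. shock_law t (Suc x) \<bind>
      (\<lambda>q. return_pmf (fst q, v @ snd q)))"
    unfolding shock_law_def quadrant_def bind_assoc_pmf ..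
  finally have m3: "map_pmf (map_prod (map ((\<le>) 3)) (map ((\<le>) 3))) J = \<dots>" .
  have "E_pmf J (\<lambda>p. of_bool (3 \<le> snd p ! Suc x)) =
    E_pmf (replicate_pmf 1 (bernoulli_pmf \<theta>)) (\<lambda>v. E_pmf (shock_law t (Suc x)) (\<lambda>q. of_bool ((v @ snd q) ! Suc x)))"
    unfolding thr m3 by (simp add: expectation_bind_finite finite_set_replicate_pmf del: replicate_pmf.simps)
  also have "\<dots> = E_pmf (replicate_pmf 1 (bernoulli_pmf \<theta>)) (\<lambda>v. site_density t x)"
    unfolding site_density_def
    by (rule expectation_cong_pmf) (auto simp: set_replicate_pmf nth_append simp del: replicate_pmf.simps)
  finally have lo: "E_pmf J (\<lambda>p. of_bool (3 \<le> snd p ! Suc x)) = site_density t x" by simp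
  show ?thesis unfolding hi[symmetric] lo[symmetric]
    by (rule expectation_mono_finite[OF fin]) auto
qed

lemma density_mono: "x \<le> y \<Longrightarrow> site_density t x \<le> site_density t y"
  using density_mono_Suc by (rule lift_Suc_mono_le)

text \<open>By monotonicity the excess at \<open>y\<close> is the smallest among the sites from
  \<open>y\<close> up to \<open>m\<close>, so the summed bound controls \<open>m - y\<close> times
  its value. \<open>density_high\<close> mirrors this ahead of the shock.\<close>

lemma density_low:
  assumes "drift t m \<le> 0" "y \<le> m"
  shows "real (m - y) * (site_density t y - \<theta>) \<le> fluct t m"
proof -
  have "real (m - y) * (site_density t y - \<theta>) = (\<Sum>x\<in>{y..<m}. site_density t y - \<theta>)" by simp
  also have "\<dots> \<le> (\<Sum>x\<in>{y..<m}. site_density t x - \<theta>)"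
    by (intro sum_mono) (auto intro: density_mono)
  also have "\<dots> \<le> (\<Sum>x<m. site_density t x - \<theta>)"
    by (intro sum_mono2) (auto simp: density_bounds)
  also have "\<dots> \<le> fluct t m" by (rule density_sum_low[OF assms(1)])
  finally show ?thesis .
qed

lemma density_high:
  assumes "0 \<le> drift t m" "m \<le> y"
  shows "real (y - m) * (\<rho> - site_density t y) \<le> fluct t m"
proof -
  have "real (y - m) * (\<rho> - site_density t y) = (\<Sum>x<y - m. \<rho> - site_density t y)" by simp
  also have "\<dots> \<le> (\<Sum>x<y - m. \<rho> - site_density t (m + x))"
    by (intro sum_mono) (auto intro: density_mono)
  also have "\<dots> \<le> fluct t m" by (rule density_sum_high[OF assms(1)])
  finally show ?thesis .
qed

text \<open>The two thresholds disagree only at sites of class \<open>bad\<close>, so their laws on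
  the window differ at most by a union bound over these sites.\<close>

lemma window_compare:
  assumes "\<And>c. c \<noteq> bad \<Longrightarrow> c \<le> 3 \<Longrightarrow> (i \<le> c) = (j \<le> (c::nat))"
  shows "\<bar>pmf (map_pmf (\<lambda>p. map ((\<le>) i) (drop a (snd p))) (coupled t (a + k))) zs -
          pmf (map_pmf (\<lambda>p. map ((\<le>) j) (drop a (snd p))) (coupled t (a + k))) zs\<bar>
    \<le> (\<Sum>x\<in>{a..<a+k}. E_pmf (coupled t (a + k)) (\<lambda>p. of_bool (snd p ! x = bad)))"
proof -
  let ?J = "coupled t (a + k)"
  let ?f = "\<lambda>i p. of_bool (map ((\<le>) i) (drop a (snd p)) = zs) :: real"
  have "\<bar>E_pmf ?J (?f i) - E_pmf ?J (?f j)\<bar> = \<bar>E_pmf ?J (\<lambda>p. ?f i p - ?f j p)\<bar>"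
    by (simp only: Bochner_Integration.integral_diff integrable_coupled)
  also have "\<dots> \<le> E_pmf ?J (\<lambda>p. \<bar>?f i p - ?f j p\<bar>)"
    by (rule integral_abs_bound)
  also have "\<dots> \<le> E_pmf ?J (\<lambda>p. \<Sum>x\<in>{a..<a+k}. of_bool (snd p ! x = bad))"
  proof (rule expectation_mono_finite)
    fix p assume p: "p \<in> set_pmf ?J"
    then have len: "length (snd p) = a + k" by (simp add: coupled_def quadrant_length)
    have "set (snd p) \<subseteq> {0..3}"
    proof -
      from p obtain hs vs where "hs \<in> set_pmf (replicate_pmf t left)" "vs \<in> set_pmf (replicate_pmf (a+k) bottom)"
        "p \<in> set_pmf (box hs vs)" by (auto simp: coupled_def quadrant_def)
      then have "set (fst p) \<union> set (snd p) = set hs \<union> set vs" "set hs \<subseteq> set_pmf left" "set vs \<subseteq> set_pmf bottom"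
        using box_set[of p hs vs] by (auto simp: set_replicate_pmf)
      then have "set (snd p) \<subseteq> {0, 1, 3} \<union> {0, 2, 3}" using set_left set_bottom by blast
      then show ?thesis by auto
    qed
    then have le3: "x < a + k \<Longrightarrow> snd p ! x \<le> 3" for x using len
      by (metis atLeastAtMost_iff nth_mem subsetD)
    show "\<bar>?f i p - ?f j p\<bar> \<le> (\<Sum>x\<in>{a..<a+k}. of_bool (snd p ! x = bad))"
    proof (cases "\<exists>x\<in>{a..<a+k}. snd p ! x = bad")
      case True
      then obtain x where "x \<in> {a..<a+k}" "snd p ! x = bad" by auto
      then have "(1::real) \<le> (\<Sum>x\<in>{a..<a+k}. of_bool (snd p ! x = bad))"
        using member_le_sum[of x "{a..<a+k}" "\<lambda>x. of_bool (snd p ! x = bad) :: real"] by simp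
      moreover have "\<bar>?f i p - ?f j p\<bar> \<le> 1" by auto
      ultimately show ?thesis by linarith
    next
      case False
      then have "map ((\<le>) i) (drop a (snd p)) = map ((\<le>) j) (drop a (snd p))"
        using len by (intro nth_equalityI) (auto intro!: assms le3)
      then have "?f i p = ?f j p" by (simp only:)
      then show ?thesis by (simp only: diff_self abs_zero) (simp add: sum_nonneg del: sum_of_bool_eq)
    qed
  qed simp
  also have "\<dots> = (\<Sum>x\<in>{a..<a+k}. E_pmf ?J (\<lambda>p. of_bool (snd p ! x = bad)))"
    by (simp only: Bochner_Integration.integral_sum integrable_coupled)
  finally show ?thesis unfolding pmf_as_expectation .
qed

lemma window_threshold:
  "map_pmf (\<lambda>p. map ((\<le>) 3) (drop a (snd p))) (coupled t (a + k)) = replicate_pmf k (bernoulli_pmf \<theta>)"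
  "map_pmf (\<lambda>p. map ((\<le>) 2) (drop a (snd p))) (coupled t (a + k)) = map_pmf (\<lambda>p. drop a (snd p)) (shock_law t (a + k))"
  "map_pmf (\<lambda>p. map ((\<le>) 1) (drop a (snd p))) (coupled t (a + k)) = replicate_pmf k (bernoulli_pmf \<rho>)"
proof -
  have *: "map_pmf (\<lambda>p. map ((\<le>) i) (drop a (snd p))) (coupled t (a + k)) =
    map_pmf (\<lambda>p. drop a (snd p)) (map_pmf (map_prod (map ((\<le>) i)) (map ((\<le>) i))) (coupled t (a + k)))" for i
    by (simp add: pmf.map_comp o_def drop_map)
  have **: "map_pmf (\<lambda>p. drop a (snd p)) (pair_pmf p q) = map_pmf (drop a) q" for p :: "bool list pmf" and q :: "bool list pmf"
    using pmf.map_comp[of "drop a" snd "pair_pmf p q"] by (simp add: map_snd_pair_pmf o_def)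
  show "map_pmf (\<lambda>p. map ((\<le>) 3) (drop a (snd p))) (coupled t (a + k)) = replicate_pmf k (bernoulli_pmf \<theta>)"
  "map_pmf (\<lambda>p. map ((\<le>) 2) (drop a (snd p))) (coupled t (a + k)) = map_pmf (\<lambda>p. drop a (snd p)) (shock_law t (a + k))"
  "map_pmf (\<lambda>p. map ((\<le>) 1) (drop a (snd p))) (coupled t (a + k)) = replicate_pmf k (bernoulli_pmf \<rho>)"
    unfolding * coupled_threshold ** drop_replicate_pmf by (rule refl)+
qed

text \<open>By monotonicity the excess over \<open>\<theta>\<close> inside the window is at most the
  one at the site just after it. In \<open>window_high\<close> the deficit is largest at the first
  site instead.\<close>

lemma window_low:
  "\<bar>pmf (map_pmf (\<lambda>p. drop a (snd p)) (shock_law t (a + k))) zs - pmf (replicate_pmf k (bernoulli_pmf \<theta>)) zs\<bar>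
    \<le> real k * (site_density t (a + k) - \<theta>)"
proof -
  have "(\<Sum>x\<in>{a..<a+k}. E_pmf (coupled t (a + k)) (\<lambda>p. of_bool (snd p ! x = 2))) = (\<Sum>x\<in>{a..<a+k}. site_density t x - \<theta>)"
    by (intro sum.cong refl coupled_class_prob) auto
  also have "\<dots> \<le> (\<Sum>x\<in>{a..<a+k}. site_density t (a + k) - \<theta>)"
    by (intro sum_mono diff_right_mono density_mono) auto
  finally have *: "(\<Sum>x\<in>{a..<a+k}. E_pmf (coupled t (a + k)) (\<lambda>p. of_bool (snd p ! x = 2))) \<le>
    real k * (site_density t (a + k) - \<theta>)" by simp
  have "\<And>c. c \<noteq> 2 \<Longrightarrow> c \<le> 3 \<Longrightarrow> (2 \<le> c) = (3 \<le> (c::nat))" by linarith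
  from window_compare[OF this, where a = a and t = t and k = k and zs = zs] * show ?thesis unfolding window_threshold by (rule order_trans)
qed

lemma window_high:
  "\<bar>pmf (map_pmf (\<lambda>p. drop a (snd p)) (shock_law t (a + k))) zs - pmf (replicate_pmf k (bernoulli_pmf \<rho>)) zs\<bar>
    \<le> real k * (\<rho> - site_density t a)"
proof -
  have "(\<Sum>x\<in>{a..<a+k}. E_pmf (coupled t (a + k)) (\<lambda>p. of_bool (snd p ! x = 1))) = (\<Sum>x\<in>{a..<a+k}. \<rho> - site_density t x)"
    by (intro sum.cong refl coupled_class_prob) auto
  also have "\<dots> \<le> (\<Sum>x\<in>{a..<a+k}. \<rho> - site_density t a)"
    by (intro sum_mono diff_left_mono density_mono) auto
  finally have *: "(\<Sum>x\<in>{a..<a+k}. E_pmf (coupled t (a + k)) (\<lambda>p. of_bool (snd p ! x = 1))) \<le>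
    real k * (\<rho> - site_density t a)" by simp
  have "\<And>c. c \<noteq> 1 \<Longrightarrow> c \<le> 3 \<Longrightarrow> (2 \<le> c) = (1 \<le> (c::nat))" by linarith
  from window_compare[OF this, where a = a and t = t and k = k and zs = zs] * show ?thesis unfolding window_threshold by (rule order_trans)
qed

section \<open>Limits on either side of the shock\<close>

definition speed :: real where "speed = (flux \<rho> - flux \<theta>) / (\<rho> - \<theta>)"

lemma drift_alt: "drift t m = (real m - speed * real t) * (\<rho> - \<theta>)"
  using dens by (simp add: drift_def speed_def field_simps)

lemma inversion_bound_nonneg: "0 \<le> inversion_bound"
  using tau by (simp add: inversion_bound_def)

text \<open>Square root fluctuations against a linear number of sites. The \<open>+ 1\<close> leaves
  room for rounding the column \<open>m\<close> up in \<open>density_limit_high\<close>.\<close>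

lemma fluct_negligible:
  assumes "0 < d" "0 \<le> c"
  shows "((\<lambda>T. (inversion_bound + 2 * sqrt (c * real T + 1) + 2 * sqrt (real T)) / (d * real T)) \<longlongrightarrow> 0) at_top"
proof -
  have lim: "((\<lambda>T. (inversion_bound + 2 * sqrt ((c + 1) * real T) + 2 * sqrt (real T)) / (d * real T)) \<longlongrightarrow> 0) at_top"
    using assms by real_asymp
  have nonneg: "0 \<le> (inversion_bound + 2 * sqrt (c * real T + 1) + 2 * sqrt (real T)) / (d * real T)" for T
    using assms inversion_bound_nonneg by simp
  have le: "eventually (\<lambda>T. (inversion_bound + 2 * sqrt (c * real T + 1) + 2 * sqrt (real T)) / (d * real T) \<le>
    (inversion_bound + 2 * sqrt ((c + 1) * real T) + 2 * sqrt (real T)) / (d * real T)) at_top"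
    using eventually_ge_at_top[of 1]
  proof eventually_elim
    case (elim T)
    then have "c * real T + 1 \<le> (c + 1) * real T" by (simp add: algebra_simps)
    then have "sqrt (c * real T + 1) \<le> sqrt ((c + 1) * real T)" by simp
    then show ?case using assms by (intro divide_right_mono) auto
  qed
  show ?thesis
    by (rule tendsto_sandwich[OF always_eventually[OF allI[OF nonneg]] le tendsto_const lim])
qed

lemma fluct_le: "real m \<le> c * real t + 1 \<Longrightarrow>
    fluct t m \<le> inversion_bound + 2 * sqrt (c * real t + 1) + 2 * sqrt (real t)"
  by (simp add: fluct_def)

lemma density_limit_low:
  fixes a :: "nat \<Rightarrow> nat"
  assumes a: "((\<lambda>T. real (a T) / real T) \<longlongrightarrow> u) at_top" and u: "0 \<le> u" "u < speed"
  shows "((\<lambda>T. site_density T (a T)) \<longlongrightarrow> \<theta>) at_top"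
proof -
  \<comment> \<open>The column \<open>v * T\<close> lies strictly between the window and the shock,
    and four steps of size \<open>d\<close> separate \<open>u\<close> from \<open>v\<close>. They
    absorb the error of \<open>a T / T\<close> and the rounding of \<open>m\<close>, with
    \<open>d * T\<close> columns to spare.\<close>
  define v where "v = (u + speed) / 2"
  define d where "d = (v - u) / 4"
  have v: "u < v" "v < speed" and d: "0 < d" and v0: "0 \<le> v" using u by (auto simp: v_def d_def)
  let ?b = "\<lambda>T. (inversion_bound + 2 * sqrt (v * real T + 1) + 2 * sqrt (real T)) / (d * real T)"
  have "eventually (\<lambda>T. real (a T) / real T < u + d) at_top" using a d by (intro order_tendstoD) auto
  moreover have "eventually (\<lambda>T. 1 \<le> d * real T) at_top" using d by real_asymp
  ultimately have "eventually (\<lambda>T. site_density T (a T) - \<theta> \<le> ?b T) at_top" using eventually_gt_at_top[of 0]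
  proof eventually_elim
    case (elim T)
    define m where "m = nat \<lfloor>v * real T\<rfloor>"
    have m: "real m \<le> v * real T" "v * real T - 1 \<le> real m"
      using v0 by (auto simp: m_def)
    have "real m \<le> speed * real T" by (rule order_trans[OF m(1)]) (use v in \<open>simp add: mult_right_mono\<close>)
    then have dr: "drift T m \<le> 0" using dens by (simp add: drift_alt mult_nonpos_nonneg)
    have "real (a T) < (u + d) * real T" using elim by (simp add: field_simps)
    moreover have "v = u + 4 * d" by (simp add: d_def field_simps)
    then have "v * real T = u * real T + 4 * (d * real T)" by (simp add: algebra_simps)
    ultimately have gap: "d * real T \<le> real m - real (a T)" using m elim by (simp add: algebra_simps)
    then have am: "a T \<le> m" using d elim by (simp add: order_trans)
    have dT: "d * real T > 0" using d elim by simp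
    have "d * real T * (site_density T (a T) - \<theta>) \<le> real (m - a T) * (site_density T (a T) - \<theta>)"
      using gap am by (intro mult_right_mono) (auto simp: density_bounds of_nat_diff)
    also have "\<dots> \<le> fluct T m" by (rule density_low[OF dr am])
    also have "\<dots> \<le> inversion_bound + 2 * sqrt (v * real T + 1) + 2 * sqrt (real T)"
      by (rule fluct_le) (use m in simp)
    finally show ?case using dT by (simp add: pos_le_divide_eq mult.commute)
  qed
  moreover have "0 \<le> site_density T (a T) - \<theta>" for T by (simp add: density_bounds)
  ultimately have "((\<lambda>T. site_density T (a T) - \<theta>) \<longlongrightarrow> 0) at_top"
    by (intro tendsto_sandwich[OF _ _ tendsto_const fluct_negligible[OF d v0]]) auto
  then show ?thesis by (simp add: LIM_zero_iff)
qed

lemma density_limit_high: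
  fixes a :: "nat \<Rightarrow> nat"
  assumes a: "((\<lambda>T. real (a T) / real T) \<longlongrightarrow> u) at_top" and u: "speed < u"
  shows "((\<lambda>T. site_density T (a T)) \<longlongrightarrow> \<rho>) at_top"
proof -
  define v where "v = (u + speed) / 2"
  define d where "d = (u - v) / 4"
  have s0: "0 \<le> speed" using dens by (simp add: speed_def)
  have v: "v < u" "speed < v" and d: "0 < d" and v0: "0 \<le> v" using u s0 by (auto simp: v_def d_def)
  let ?b = "\<lambda>T. (inversion_bound + 2 * sqrt (v * real T + 1) + 2 * sqrt (real T)) / (d * real T)"
  have "eventually (\<lambda>T. real (a T) / real T > u - d) at_top" using a d by (intro order_tendstoD) auto
  moreover have "eventually (\<lambda>T. 1 \<le> d * real T) at_top" using d by real_asymp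
  ultimately have "eventually (\<lambda>T. \<rho> - site_density T (a T) \<le> ?b T) at_top" using eventually_gt_at_top[of 0]
  proof eventually_elim
    case (elim T)
    define m where "m = nat \<lceil>v * real T\<rceil>"
    have m: "real m \<le> v * real T + 1" "v * real T \<le> real m"
      using v0 by (auto simp: m_def)
    have "speed * real T \<le> real m" by (rule order_trans[OF _ m(2)]) (use v in \<open>simp add: mult_right_mono\<close>)
    then have dr: "0 \<le> drift T m" using dens by (simp add: drift_alt)
    have "(u - d) * real T < real (a T)" using elim by (simp add: field_simps)
    moreover have "v = u - 4 * d" by (simp add: d_def field_simps)
    then have "v * real T = u * real T - 4 * (d * real T)" by (simp only: left_diff_distrib mult.assoc)
    ultimately have gap: "d * real T \<le> real (a T) - real m" using m elim by (simp add: algebra_simps)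
    then have am: "m \<le> a T" using d elim by (simp add: order_trans)
    have dT: "d * real T > 0" using d elim by simp
    have "d * real T * (\<rho> - site_density T (a T)) \<le> real (a T - m) * (\<rho> - site_density T (a T))"
      using gap am by (intro mult_right_mono) (auto simp: density_bounds of_nat_diff)
    also have "\<dots> \<le> fluct T m" by (rule density_high[OF dr am])
    also have "\<dots> \<le> inversion_bound + 2 * sqrt (v * real T + 1) + 2 * sqrt (real T)"
      by (rule fluct_le) (use m in simp)
    finally show ?case using dT by (simp add: pos_le_divide_eq mult.commute)
  qed
  moreover have "0 \<le> \<rho> - site_density T (a T)" for T by (simp add: density_bounds)
  ultimately have "((\<lambda>T. \<rho> - site_density T (a T)) \<longlongrightarrow> 0) at_top"
    by (intro tendsto_sandwich[OF _ _ tendsto_const fluct_negligible[OF d v0]]) auto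
  then have "((\<lambda>T. \<rho> - (\<rho> - site_density T (a T))) \<longlongrightarrow> \<rho> - 0) at_top"
    by (intro tendsto_diff tendsto_const)
  then show ?thesis by simp
qed

lemma window_limit:
  fixes a :: "nat \<Rightarrow> nat"
  assumes a: "((\<lambda>T. real (a T) / real T) \<longlongrightarrow> u) at_top" and u: "0 \<le> u" "u \<noteq> speed"
  shows "((\<lambda>T. pmf (map_pmf (\<lambda>p. drop (a T) (snd p)) (shock_law T (a T + k))) zs) \<longlongrightarrow>
    pmf (replicate_pmf k (bernoulli_pmf (if u < speed then \<theta> else \<rho>))) zs) at_top"
proof (cases "u < speed")
  case True
  have "((\<lambda>T. real (a T) / real T + real k / real T) \<longlongrightarrow> u + 0) at_top"
    by (intro tendsto_add a lim_const_over_n)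
  then have "((\<lambda>T. real (a T + k) / real T) \<longlongrightarrow> u) at_top" by (simp add: add_divide_distrib)
  from density_limit_low[OF this u(1) True]
  have "((\<lambda>T. real k * (site_density T (a T + k) - \<theta>)) \<longlongrightarrow> real k * (\<theta> - \<theta>)) at_top"
    by (rule tendsto_mult[OF tendsto_const tendsto_diff[OF _ tendsto_const]])
  then have lim: "((\<lambda>T. real k * (site_density T (a T + k) - \<theta>)) \<longlongrightarrow> 0) at_top" by simp
  have "((\<lambda>T. pmf (map_pmf (\<lambda>p. drop (a T) (snd p)) (shock_law T (a T + k))) zs -
      pmf (replicate_pmf k (bernoulli_pmf \<theta>)) zs) \<longlongrightarrow> 0) at_top"
    by (rule Lim_null_comparison[OF _ lim], rule always_eventually, unfold real_norm_def) (blast intro: window_low)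
  with True show ?thesis by (simp add: LIM_zero_iff)
next
  case False
  then have "speed < u" using u by simp
  from density_limit_high[OF a this]
  have "((\<lambda>T. real k * (\<rho> - site_density T (a T))) \<longlongrightarrow> real k * (\<rho> - \<rho>)) at_top"
    by (rule tendsto_mult[OF tendsto_const tendsto_diff[OF tendsto_const]])
  then have lim: "((\<lambda>T. real k * (\<rho> - site_density T (a T))) \<longlongrightarrow> 0) at_top" by simp
  have "((\<lambda>T. pmf (map_pmf (\<lambda>p. drop (a T) (snd p)) (shock_law T (a T + k))) zs -
      pmf (replicate_pmf k (bernoulli_pmf \<rho>)) zs) \<longlongrightarrow> 0) at_top"
    by (rule Lim_null_comparison[OF _ lim], rule always_eventually, unfold real_norm_def) (blast intro: window_high)
  with False show ?thesis by (simp add: LIM_zero_iff)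
qed

end

section \<open>The process on the line\<close>

definition prev :: "config \<Rightarrow> int \<Rightarrow> int \<Rightarrow> bool" where
  "prev eta z x \<longleftrightarrow> z < x \<and> eta z \<and> (\<forall>y. z < y \<and> y < x \<longrightarrow> \<not> eta y)"

text \<open>\<open>LEAST\<close> over the integers is meaningful here because the candidates are
  bounded below by \<open>x\<close>; minimising the distance to \<open>x\<close> produces the
  witness.\<close>

lemma nxt_Some_iff: "nxt eta x = Some w \<longleftrightarrow> x < w \<and> eta w \<and> (\<forall>y. x < y \<and> y < w \<longrightarrow> \<not> eta y)"
proof -
  have least: "(LEAST y. x < y \<and> eta y) = w"
    if "x < w" "eta w" "\<forall>y. x < y \<and> y < w \<longrightarrow> \<not> eta y" for w
    using that by (intro Least_equality) (auto simp: not_less[symmetric])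
  show ?thesis
  proof (cases "\<exists>y>x. eta y")
    case True
    then obtain w' where w': "x < w' \<and> eta w'" "\<forall>y. x < y \<and> eta y \<longrightarrow> nat (w' - x) \<le> nat (y - x)"
      using ex_has_least_nat[of "\<lambda>y. x < y \<and> eta y" _ "\<lambda>y. nat (y - x)"] by auto
    then have *: "x < w'" "eta w'" "\<forall>y. x < y \<and> y < w' \<longrightarrow> \<not> eta y" by fastforce+
    have "nxt eta x = Some w'" using True least[OF *] by (simp add: nxt_def)
    then show ?thesis using * by (metis linorder_less_linear option.inject)
  qed (auto simp: nxt_def)
qed

lemma prev_unique: "prev eta z x \<Longrightarrow> prev eta z' x \<Longrightarrow> z = z'"
  unfolding prev_def by (meson linorder_less_linear)

lemma prev_exists:
  assumes "eta y" "y < x" obtains z where "prev eta z x" "y \<le> z"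
proof -
  obtain z where z: "eta z \<and> z < x" "\<forall>y. eta y \<and> y < x \<longrightarrow> nat (x - z) \<le> nat (x - y)"
    using ex_has_least_nat[of "\<lambda>y. eta y \<and> y < x" y "\<lambda>y. nat (x - y)"] assms by auto
  have "\<not> eta y'" if "z < y'" "y' < x" for y'
  proof
    assume "eta y'"
    with z(2) that have "nat (x - z) \<le> nat (x - y')" by blast
    then show False using that by linarith
  qed
  then have "prev eta z x" using z(1) by (simp add: prev_def)
  moreover have "nat (x - z) \<le> nat (x - y)" using z(2) assms by blast
  then have "y \<le> z" using assms by linarith
  ultimately show ?thesis by (rule that)
qed

text \<open>Unfolds the chain of pushes at its last link: the particle starts by itself, or its left
  neighbour moves and reaches it.\<close>

lemma moves_iff:
  assumes "eta x"
  shows "moves eta chi j x \<longleftrightarrow> \<not> chi x \<or> (\<exists>z. prev eta z x \<and> moves eta chi j z \<and> x \<le> z + int (j z))"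
proof
  assume "moves eta chi j x"
  then obtain y where y: "y \<le> x" "eta y" "\<not> chi y"
    "\<And>z. \<lbrakk>y \<le> z; z < x; eta z\<rbrakk> \<Longrightarrow> (case nxt eta z of None \<Rightarrow> False | Some w \<Rightarrow> w \<le> z + int (j z))"
    unfolding moves_def by blast
  show "\<not> chi x \<or> (\<exists>z. prev eta z x \<and> moves eta chi j z \<and> x \<le> z + int (j z))"
  proof (cases "y = x")
    case False
    then have "y < x" using y by simp
    obtain z where z: "prev eta z x" "y \<le> z" by (rule prev_exists[of eta y x, OF y(2) \<open>y < x\<close>])
    then have "nxt eta z = Some x" using assms by (simp add: prev_def nxt_Some_iff)
    then have "x \<le> z + int (j z)" using y(4)[of z] z by (simp add: prev_def)
    moreover have "moves eta chi j z" unfolding moves_def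
      using y z by (intro exI[of _ y]) (auto simp: prev_def)
    ultimately show ?thesis using z by blast
  qed (use y in auto)
next
  assume "\<not> chi x \<or> (\<exists>z. prev eta z x \<and> moves eta chi j z \<and> x \<le> z + int (j z))"
  then show "moves eta chi j x"
  proof
    assume "\<not> chi x" then show ?thesis using assms by (auto simp: moves_def)
  next
    assume "\<exists>z. prev eta z x \<and> moves eta chi j z \<and> x \<le> z + int (j z)"
    then obtain z y where z: "prev eta z x" "x \<le> z + int (j z)" and y: "y \<le> z" "eta y" "\<not> chi y"
      "\<And>z'. \<lbrakk>y \<le> z'; z' < z; eta z'\<rbrakk> \<Longrightarrow> (case nxt eta z' of None \<Rightarrow> False | Some w \<Rightarrow> w \<le> z' + int (j z'))"
      unfolding moves_def by blast
    have "nxt eta z = Some x" using assms z by (simp add: prev_def nxt_Some_iff)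
    have "(case nxt eta z' of None \<Rightarrow> False | Some w \<Rightarrow> w \<le> z' + int (j z'))"
      if "y \<le> z'" "z' < x" "eta z'" for z'
    proof (cases "z' = z")
      case False
      then have "z' < z" using z(1) that unfolding prev_def by (meson linorder_less_linear)
      then show ?thesis using y(4)[of z'] that by simp
    qed (use \<open>nxt eta z = Some x\<close> z in simp)
    then show ?thesis unfolding moves_def using y z by (intro exI[of _ y]) (auto simp: prev_def)
  qed
qed

text \<open>Valid for every noise configuration, hence the case \<open>j x = 0\<close>, where a
  particle moves without leaving its site. Under \<open>noise_pmf\<close> jumps are at least
  1.\<close>

lemma sv_step_iff:
  "sv_step eta chi j x \<longleftrightarrow> (eta x \<and> (\<not> moves eta chi j x \<or> j x = 0)) \<or>
    (\<exists>z. prev eta z x \<and> moves eta chi j z \<and> (if eta x then x \<le> z + int (j z) else x = z + int (j z)))"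
  (is "_ \<longleftrightarrow> ?A \<or> ?B")
proof
  assume "sv_step eta chi j x"
  then obtain z where z: "eta z" "newpos eta chi j z = x" unfolding sv_step_def by auto
  show "?A \<or> ?B"
  proof (cases "moves eta chi j z")
    case False
    then show ?thesis using z by (simp add: newpos_def)
  next
    case True
    show ?thesis
    proof (cases "nxt eta z")
      case None
      then have "\<not> eta y" if "z < y" for y using that by (auto simp: nxt_def split: if_splits)
      moreover have x: "x = z + int (j z)" using z True None by (simp add: newpos_def)
      ultimately have "prev eta z x" if "j z \<noteq> 0" "\<not> eta x" using that z by (auto simp: prev_def)
      moreover have "\<not> eta x" if "j z \<noteq> 0" using that x \<open>\<And>y. z < y \<Longrightarrow> \<not> eta y\<close> by simp
      ultimately have "j z \<noteq> 0 \<Longrightarrow> ?B" using x True by auto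
      then show ?thesis using z x True by (cases "j z = 0") auto
    next
      case (Some w)
      then have w: "z < w" "eta w" "\<And>y. \<lbrakk>z < y; y < w\<rbrakk> \<Longrightarrow> \<not> eta y" by (auto simp: nxt_Some_iff)
      have x: "x = min (z + int (j z)) w" using z True Some by (simp add: newpos_def)
      show ?thesis
      proof (cases "j z = 0")
        case True
        then have "x = z" using x w by simp
        then show ?thesis using z True by simp
      next
        case False
        then have "z < x" using x w by simp
        then have "prev eta z x" using z w x by (auto simp: prev_def)
        moreover have "if eta x then x \<le> z + int (j z) else x = z + int (j z)"
          using x w by (auto simp: min_def split: if_splits)
        ultimately show ?thesis using True by blast
      qed
    qed
  qed
next
  assume "?A \<or> ?B"
  then show "sv_step eta chi j x"
  proof
    assume ?A
    then have "newpos eta chi j x = x"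
      by (auto simp: newpos_def nxt_Some_iff min_def split: option.splits)
    then show ?thesis using \<open>?A\<close> unfolding sv_step_def by blast
  next
    assume ?B
    then obtain z where z: "prev eta z x" "moves eta chi j z"
      "if eta x then x \<le> z + int (j z) else x = z + int (j z)" by blast
    have "newpos eta chi j z = x"
    proof (cases "eta x")
      case True
      then have "nxt eta z = Some x" using z by (simp add: prev_def nxt_Some_iff)
      then show ?thesis using z True by (simp add: newpos_def min_def)
    next
      case False
      then have x: "x = z + int (j z)" using z by simp
      show ?thesis
      proof (cases "nxt eta z")
        case (Some w)
        then have "x \<le> w" using z by (auto simp: nxt_Some_iff prev_def not_less[symmetric])
        then show ?thesis using Some x z by (simp add: newpos_def min_def)
      qed (use z x in \<open>simp add: newpos_def\<close>)
    qed
    then show ?thesis using z unfolding sv_step_def prev_def by blast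
  qed
qed

text \<open>If an arrow enters \<open>x\<close>, the moving particle would come to rest at \<open>x + load - 1\<close> were it not
  stopped before; \<open>load = 0\<close> means that no arrow enters.\<close>

definition load :: "config \<Rightarrow> config \<Rightarrow> (int \<Rightarrow> nat) \<Rightarrow> int \<Rightarrow> nat" where
  "load eta chi j x = (if \<exists>z. prev eta z x \<and> moves eta chi j z
     then nat ((THE z. prev eta z x) + int (j (THE z. prev eta z x)) + 1 - x) else 0)"

lemma load_prev:
  assumes "prev eta z x"
  shows "load eta chi j x = (if moves eta chi j z then nat (z + int (j z) + 1 - x) else 0)"
proof -
  have "(THE z. prev eta z x) = z" using assms prev_unique by (intro the_equality) auto
  moreover have "(\<exists>z. prev eta z x \<and> moves eta chi j z) \<longleftrightarrow> moves eta chi j z"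
    using assms prev_unique by blast
  ultimately show ?thesis unfolding load_def by (simp only:)
qed

lemma load_none: "\<nexists>z. prev eta z x \<Longrightarrow> load eta chi j x = 0"
  by (auto simp: load_def)

text \<open>Across an empty site the load drops by one, truncated at zero when no arrow enters. An
  occupied site absorbs the arriving particle and, if its own particle moves, sends on that
  particle's jump.\<close>

lemma load_Suc:
  "load eta chi j (x + 1) = (if eta x then if moves eta chi j x then j x else 0 else load eta chi j x - 1)"
proof (cases "eta x")
  case True
  then have "prev eta x (x + 1)" by (auto simp: prev_def)
  from load_prev[OF this] show ?thesis using True by simp
next
  case False
  then have *: "prev eta z (x + 1) \<longleftrightarrow> prev eta z x" for z
    unfolding prev_def by (metis zle_add1_eq_le order_le_less)
  show ?thesis
  proof (cases "\<exists>z. prev eta z x")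
    case True
    then obtain z where z: "prev eta z x" by auto
    then have "prev eta z (x + 1)" by (simp add: *)
    moreover have "nat (z + int (j z) + 1 - (x + 1)) = nat (z + int (j z) + 1 - x) - 1" by linarith
    ultimately show ?thesis using False load_prev[OF z, of chi j] load_prev[of eta z "x + 1" chi j] by simp
  qed (use False in \<open>simp add: load_none *\<close>)
qed

lemma moves_load: "eta x \<Longrightarrow> moves eta chi j x \<longleftrightarrow> \<not> chi x \<or> load eta chi j x \<ge> 1"
proof (cases "\<exists>z. prev eta z x")
  case True
  then obtain z where z: "prev eta z x" by auto
  then have "(\<exists>z'. prev eta z' x \<and> moves eta chi j z' \<and> x \<le> z' + int (j z')) \<longleftrightarrow> moves eta chi j z \<and> x \<le> z + int (j z)"
    using prev_unique by blast
  then show "eta x \<Longrightarrow> ?thesis" using load_prev[OF z, of chi j] moves_iff[of eta x chi j] by auto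
qed (use moves_iff[of eta x chi j] in \<open>simp add: load_none\<close>)

lemma sv_step_load:
  "sv_step eta chi j x \<longleftrightarrow> (if eta x then load eta chi j x \<ge> 1 \<or> chi x \<or> j x = 0 else load eta chi j x = 1)"
proof -
  have "(\<exists>z. prev eta z x \<and> moves eta chi j z \<and> (if eta x then x \<le> z + int (j z) else x = z + int (j z))) \<longleftrightarrow>
    (if eta x then load eta chi j x \<ge> 1 else load eta chi j x = 1)"
  proof (cases "\<exists>z. prev eta z x")
    case True
    then obtain z where z: "prev eta z x" by auto
    then have "(\<exists>z'. prev eta z' x \<and> moves eta chi j z' \<and> (if eta x then x \<le> z' + int (j z') else x = z' + int (j z')))
      \<longleftrightarrow> moves eta chi j z \<and> (if eta x then x \<le> z + int (j z) else x = z + int (j z))"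
      using prev_unique by blast
    then show ?thesis using load_prev[OF z, of chi j] by auto
  qed (simp add: load_none)
  then show ?thesis unfolding sv_step_iff by (auto simp: moves_load)
qed

text \<open>The transfer rule of one vertex, from incoming load, occupation and noise to new
  occupation and outgoing load. The load replaces the Boolean arrow because it also remembers the
  remaining jump.\<close>

definition site :: "nat \<Rightarrow> bool \<Rightarrow> bool \<times> nat \<Rightarrow> bool \<times> nat" where
  "site s a n = (if a then (s \<ge> 1 \<or> fst n \<or> snd n = 0, if s \<ge> 1 \<or> \<not> fst n then snd n else 0) else (s = 1, s - 1))"

primrec scan :: "nat \<Rightarrow> bool list \<Rightarrow> (bool \<times> nat) list \<Rightarrow> bool list \<times> nat" where
  "scan s [] ns = ([], s)"
| "scan s (a # as) ns = (fst (site s a (hd ns)) # fst (scan (snd (site s a (hd ns))) as (tl ns)),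
     snd (scan (snd (site s a (hd ns))) as (tl ns)))"

definition window :: "(int \<Rightarrow> 'a) \<Rightarrow> int \<Rightarrow> nat \<Rightarrow> 'a list" where
  "window f a n = map (\<lambda>i. f (a + int i)) [0..<n]"

lemma window_0 [simp]: "window f a 0 = []" by (simp add: window_def)

lemma window_Suc: "window f a (Suc n) = f a # window f (a + 1) n"
  unfolding window_def by (subst upt_conv_Cons) (auto simp: map_Suc_upt[symmetric] algebra_simps simp del: upt_Suc)

lemma length_window [simp]: "length (window f a n) = n" by (simp add: window_def)

lemma window_append: "window f a (m + n) = window f a m @ window f (a + int m) n"
  by (induction m arbitrary: a) (simp_all add: window_Suc ac_simps)

text \<open>All influence of the configuration to the left of the window sits in the load that
  enters it; given that load, the update is a finite computation.\<close>

lemma scan_window: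
  "scan (load eta chi j a) (window eta a n) (window (\<lambda>x. (chi x, j x)) a n) =
    (window (sv_step eta chi j) a n, load eta chi j (a + int n))"
proof (induction n arbitrary: a)
  case (Suc n)
  have "site (load eta chi j a) (eta a) (chi a, j a) = (sv_step eta chi j a, load eta chi j (a + 1))"
    by (auto simp: site_def sv_step_load load_Suc moves_load)
  with Suc[of "a + 1"] show ?case by (simp add: window_Suc ac_simps)
qed simp

text \<open>Once the sites up to \<open>- N\<close> are emptied, no arrow reaches
  \<open>1 - N\<close>, so a scan from there starts with load 0.\<close>

definition cut :: "nat \<Rightarrow> config \<Rightarrow> config" where
  "cut N eta = (\<lambda>x. - int N < x \<and> eta x)"

lemma prev_cut: "prev (cut N eta) z x \<longleftrightarrow> - int N < z \<and> prev eta z x"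
  by (auto simp: prev_def cut_def)

lemma load_cut_start: "load (cut N eta) chi j (1 - int N) = 0"
  by (rule load_none) (auto simp: prev_cut, auto simp: prev_def)

lemma moves_cut: "moves (cut N eta) chi j x \<longleftrightarrow> (\<exists>y\<le>x. - int N < y \<and> eta y \<and> \<not> chi y \<and>
        (\<forall>z. y \<le> z \<and> z < x \<and> eta z \<longrightarrow>
           (case nxt eta z of None \<Rightarrow> False | Some w \<Rightarrow> w \<le> z + int (j z))))"
proof -
  have n: "nxt (cut N eta) z = nxt eta z" if "- int N < z" for z
  proof -
    have "nxt (cut N eta) z = Some w \<longleftrightarrow> nxt eta z = Some w" for w
      using that by (auto simp: nxt_Some_iff cut_def)
    then show ?thesis by (metis not_Some_eq)
  qed
  have "cut N eta y \<and> \<not> chi y \<and> (\<forall>z. y \<le> z \<and> z < x \<and> cut N eta z \<longrightarrow>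
           (case nxt (cut N eta) z of None \<Rightarrow> False | Some w \<Rightarrow> w \<le> z + int (j z))) \<longleftrightarrow>
        - int N < y \<and> eta y \<and> \<not> chi y \<and> (\<forall>z. y \<le> z \<and> z < x \<and> eta z \<longrightarrow>
           (case nxt eta z of None \<Rightarrow> False | Some w \<Rightarrow> w \<le> z + int (j z)))" for y
    using n by (auto simp: cut_def)
  then show ?thesis unfolding moves_def by blast
qed

text \<open>A chain of pushes has a first particle \<open>y\<close>, and it survives every cut to
  the left of \<open>y\<close>. In the other direction, a chain in the cut configuration is also one
  in the full configuration.\<close>

lemma eventually_moves_cut: "eventually (\<lambda>N. moves (cut N eta) chi j x = moves eta chi j x) at_top"
proof (cases "moves eta chi j x")
  case True
  then obtain y where y: "y \<le> x" "eta y" "\<not> chi y" "\<forall>z. y \<le> z \<and> z < x \<and> eta z \<longrightarrow>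
           (case nxt eta z of None \<Rightarrow> False | Some w \<Rightarrow> w \<le> z + int (j z))"
    unfolding moves_def by blast
  have "eventually (\<lambda>N. nat (- y) < N) at_top" by (rule eventually_gt_at_top)
  then show ?thesis
  proof eventually_elim
    case (elim N)
    then have "- int N < y" by linarith
    then show ?case using True y unfolding moves_cut by blast
  qed
next
  case False
  then show ?thesis unfolding moves_cut unfolding moves_def by (intro always_eventually) blast
qed

lemma eventually_load_cut: "eventually (\<lambda>N. load (cut N eta) chi j x = load eta chi j x) at_top"
proof (cases "\<exists>z. prev eta z x")
  case True
  then obtain z where z: "prev eta z x" by auto
  have "eventually (\<lambda>N. nat (- z) < N) at_top" by (rule eventually_gt_at_top)
  with eventually_moves_cut[of eta chi j z] show ?thesis
  proof eventually_elim
    case (elim N)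
    then have "- int N < z" by linarith
    with z have "prev (cut N eta) z x" by (simp add: prev_cut)
    from load_prev[OF this] load_prev[OF z] elim show ?case by simp
  qed
qed (simp add: load_none prev_cut)

lemma eventually_sv_step_cut:
  "eventually (\<lambda>N. sv_step (cut N eta) chi j x = sv_step eta chi j x) at_top"
proof -
  have "eventually (\<lambda>N. nat (- x) < N) at_top" by (rule eventually_gt_at_top)
  with eventually_load_cut[of eta chi j x] show ?thesis
    by eventually_elim (auto simp: sv_step_load cut_def)
qed

lemma eventually_window_cut:
  "eventually (\<lambda>N. window (sv_step (cut N eta) chi j) a n = window (sv_step eta chi j) a n) at_top"
proof -
  have "eventually (\<lambda>N. \<forall>i\<in>{..<n}. sv_step (cut N eta) chi j (a + int i) = sv_step eta chi j (a + int i)) at_top"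
    by (simp add: eventually_ball_finite_distrib eventually_sv_step_cut)
  then show ?thesis by eventually_elim (auto simp: window_def)
qed

section \<open>Geometric jumps and vertex weights\<close>

context six_vertex
begin

definition geo :: "nat pmf" where "geo = map_pmf Suc (geometric_pmf (1 - b2))"

text \<open>By memorylessness the remaining jump of an entering particle has law \<open>geo\<close>
  at every site it reaches, so only the presence of the arrow has to be remembered.\<close>

definition carry :: "bool \<Rightarrow> nat pmf" where "carry h = (if h then geo else return_pmf 0)"

lemma set_geo: "s \<in> set_pmf geo \<Longrightarrow> s \<ge> 1" by (auto simp: geo_def)

lemma geo_unfold: "geo = bernoulli_pmf b2 \<bind> (\<lambda>c. if c then map_pmf Suc geo else return_pmf 1)"
proof -
  have "bernoulli_pmf (1 - b2) = map_pmf Not (bernoulli_pmf b2)"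
    by (rule bernoulli_eqI[symmetric]) (simp add: map_pmf_def pmf_bind)
  then have "geometric_pmf (1 - b2) = bernoulli_pmf b2 \<bind> (\<lambda>c. if \<not> c then return_pmf 0 else map_pmf Suc (geometric_pmf (1 - b2)))"
    using geometric_bind_pmf_unfold[of "1 - b2"] b by (simp add: bind_map_pmf)
  also have "\<dots> = bernoulli_pmf b2 \<bind> (\<lambda>c. if c then map_pmf Suc (geometric_pmf (1 - b2)) else return_pmf 0)"
    by (intro bind_pmf_cong refl) auto
  finally have "geo = map_pmf Suc (bernoulli_pmf b2 \<bind> (\<lambda>c. if c then map_pmf Suc (geometric_pmf (1 - b2)) else return_pmf 0))"
    unfolding geo_def by (rule arg_cong)
  also have "\<dots> = bernoulli_pmf b2 \<bind> (\<lambda>c. if c then map_pmf Suc geo else return_pmf 1)"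
    unfolding map_bind_pmf geo_def by (intro bind_pmf_cong refl) auto
  finally show ?thesis .
qed

text \<open>With only an arrow, memorylessness lets it stop with probability \<open>1 - b2\<close>
  or continue with a fresh load. With both, the arriving particle stays and the resident one leaves
  with its own jump. With only a resident, the coin of mean \<open>b1\<close> decides. These are the
  vertex weights.\<close>

lemma site_law:
  "carry h \<bind> (\<lambda>s. noise_pmf b1 b2 \<bind> (\<lambda>n. return_pmf (site s a n))) =
    vertex a h \<bind> (\<lambda>p. carry (snd p) \<bind> (\<lambda>s. return_pmf (fst p, s)))"
proof -
  have noise: "noise_pmf b1 b2 = bernoulli_pmf b1 \<bind> (\<lambda>c. geo \<bind> (\<lambda>j. return_pmf (c, j)))"
    by (simp add: noise_pmf_def geo_def pair_pmf_def)
  consider "\<not> a" "\<not> h" | "\<not> a" "h" | "a" "h" | "a" "\<not> h" by blast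
  then show ?thesis
  proof cases
    case 1
    then show ?thesis by (simp add: carry_def site_def vertex_def bind_return_pmf)
  next
    case 2
    have "carry h \<bind> (\<lambda>s. noise_pmf b1 b2 \<bind> (\<lambda>n. return_pmf (site s a n))) = geo \<bind> (\<lambda>s. return_pmf (s = 1, s - 1))"
      using 2 by (simp add: carry_def site_def)
    also have "\<dots> = bernoulli_pmf b2 \<bind> (\<lambda>c. if c then geo \<bind> (\<lambda>s. return_pmf (Suc s = 1, s)) else return_pmf (True, 0))"
      by (subst geo_unfold) (auto simp: bind_assoc_pmf bind_map_pmf bind_return_pmf intro!: bind_pmf_cong)
    also have "\<dots> = bernoulli_pmf b2 \<bind> (\<lambda>c. if c then geo \<bind> (\<lambda>s. return_pmf (False, s)) else return_pmf (True, 0))"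
      by (intro bind_pmf_cong refl if_cong) (auto dest: set_geo)
    also have "\<dots> = bernoulli_pmf b2 \<bind> (\<lambda>c. carry c \<bind> (\<lambda>s. return_pmf (\<not> c, s)))"
      by (intro bind_pmf_cong refl) (auto simp: carry_def bind_return_pmf)
    also have "\<dots> = vertex a h \<bind> (\<lambda>p. carry (snd p) \<bind> (\<lambda>s. return_pmf (fst p, s)))"
      using 2 unfolding vertex_def by (simp add: bind_map_pmf, intro bind_pmf_cong refl) auto
    finally show ?thesis .
  next
    case 3
    have "carry h \<bind> (\<lambda>s. noise_pmf b1 b2 \<bind> (\<lambda>n. return_pmf (site s a n))) =
      geo \<bind> (\<lambda>s. noise_pmf b1 b2 \<bind> (\<lambda>n. return_pmf (True, snd n)))"
      unfolding carry_def using 3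
      by (simp only: if_True, intro bind_pmf_cong refl) (auto simp: site_def dest: set_geo)
    then show ?thesis using 3 by (simp add: noise bind_assoc_pmf bind_return_pmf vertex_def carry_def)
  next
    case 4
    have "carry h \<bind> (\<lambda>s. noise_pmf b1 b2 \<bind> (\<lambda>n. return_pmf (site s a n))) =
      bernoulli_pmf b1 \<bind> (\<lambda>c. geo \<bind> (\<lambda>j. return_pmf (site 0 True (c, j))))"
      using 4 by (simp add: carry_def noise bind_assoc_pmf bind_return_pmf)
    also have "\<dots> = bernoulli_pmf b1 \<bind> (\<lambda>c. geo \<bind> (\<lambda>j. return_pmf (c, if c then 0 else j)))"
      by (intro bind_pmf_cong refl) (auto simp: site_def dest: set_geo)
    also have "\<dots> = bernoulli_pmf b1 \<bind> (\<lambda>c. carry (\<not> c) \<bind> (\<lambda>s. return_pmf (c, s)))"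
      by (rule bind_pmf_cong[OF refl], rename_tac c, case_tac c) (simp_all add: carry_def bind_return_pmf)
    also have "\<dots> = vertex a h \<bind> (\<lambda>p. carry (snd p) \<bind> (\<lambda>s. return_pmf (fst p, s)))"
    proof -
      have "vertex a h = map_pmf (\<lambda>c. (c, \<not> c)) (bernoulli_pmf b1)"
        using 4 by (simp add: vertex_def) (rule map_pmf_cong, auto)
      then show ?thesis by (simp only: bind_map_pmf fst_conv snd_conv)
    qed
    finally show ?thesis .
  qed
qed

lemma scan_law:
  "carry h \<bind> (\<lambda>s. replicate_pmf (length as) (noise_pmf b1 b2) \<bind> (\<lambda>ns. return_pmf (scan s as ns))) =
    row h as \<bind> (\<lambda>p. carry (snd p) \<bind> (\<lambda>s. return_pmf (fst p, s)))"
proof (induction as arbitrary: h)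
  case Nil
  show ?case by (simp add: bind_return_pmf)
next
  case (Cons a as)
  let ?N = "noise_pmf b1 b2" and ?R = "replicate_pmf (length as) (noise_pmf b1 b2)"
  have "carry h \<bind> (\<lambda>s. replicate_pmf (length (a # as)) ?N \<bind> (\<lambda>ns. return_pmf (scan s (a # as) ns))) =
    (carry h \<bind> (\<lambda>s. ?N \<bind> (\<lambda>n. return_pmf (site s a n)))) \<bind> (\<lambda>q. ?R \<bind> (\<lambda>ns.
      return_pmf (scan (snd q) as ns) \<bind> (\<lambda>r. return_pmf (fst q # fst r, snd r))))"
    by (simp add: bind_assoc_pmf bind_return_pmf)
  also have "\<dots> = vertex a h \<bind> (\<lambda>p. (carry (snd p) \<bind> (\<lambda>s. ?R \<bind> (\<lambda>ns.
      return_pmf (scan s as ns)))) \<bind> (\<lambda>r. return_pmf (fst p # fst r, snd r)))"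
    unfolding site_law by (simp add: bind_assoc_pmf bind_return_pmf)
  also have "\<dots> = row h (a # as) \<bind> (\<lambda>p. carry (snd p) \<bind> (\<lambda>s. return_pmf (fst p, s)))"
    unfolding Cons.IH by (simp add: row_Cons bind_assoc_pmf bind_return_pmf)
  finally show ?case .
qed

lemma scan_law_fst:
  "map_pmf (\<lambda>ns. fst (scan 0 as ns)) (replicate_pmf (length as) (noise_pmf b1 b2)) = map_pmf fst (row False as)"
proof -
  have "map_pmf (\<lambda>ns. fst (scan 0 as ns)) (replicate_pmf (length as) (noise_pmf b1 b2)) = map_pmf fst
    (carry False \<bind> (\<lambda>s. replicate_pmf (length as) (noise_pmf b1 b2) \<bind> (\<lambda>ns. return_pmf (scan s as ns))))"
    by (simp add: carry_def bind_return_pmf map_bind_pmf) (simp add: map_pmf_def)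
  also have "\<dots> = map_pmf fst (row False as)"
    unfolding scan_law by (simp add: map_bind_pmf) (simp add: map_pmf_def)
  finally show ?thesis .
qed

end

section \<open>Product measures and measurability of the update\<close>

lemma PiM_mix:
  fixes M :: "'i \<Rightarrow> 'a measure"
  assumes "\<And>i. prob_space (M i)"
  shows "distr (PiM UNIV M \<Otimes>\<^sub>M PiM UNIV M) (PiM UNIV M) (\<lambda>(f, g) i. if i \<in> K then f i else g i) = PiM UNIV M"
proof -
  interpret M: prob_space "M i" for i by fact
  interpret P: product_prob_space M UNIV by unfold_locales
  let ?N = "PiM UNIV M"
  let ?mix = "\<lambda>(f, g) i. if i \<in> K then f i else g i"
  interpret PP: pair_prob_space ?N ?N by unfold_locales
  have "(\<lambda>p i. if i \<in> K then fst p i else snd p i) \<in> ?N \<Otimes>\<^sub>M ?N \<rightarrow>\<^sub>M ?N"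
    by (rule measurable_PiM_single') (auto simp: space_pair_measure space_PiM PiE_iff)
  then have mix [measurable]: "?mix \<in> ?N \<Otimes>\<^sub>M ?N \<rightarrow>\<^sub>M ?N" by (simp add: case_prod_unfold)
  show ?thesis
  proof (rule P.PiM_eq)
    fix J F assume J: "finite J" and F: "\<And>j. j \<in> J \<Longrightarrow> F j \<in> sets (M j)"
    let ?E = "\<lambda>J. {x \<in> space ?N. \<forall>i\<in>J. x i \<in> F i}"
    have emb: "prod_emb UNIV M J (PiE J F) = ?E J"
      unfolding prod_emb_def by (auto simp: space_PiM Pi_iff PiE_iff)
    have sets: "?E J' \<in> sets ?N" if "J' \<subseteq> J" for J'
    proof -
      have "?E J' = prod_emb UNIV M J' (PiE J' F)"
        unfolding prod_emb_def by (auto simp: space_PiM Pi_iff PiE_iff)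
      then show ?thesis using that J F by (auto intro!: sets_PiM_I finite_subset[of J' J])
    qed
    have "emeasure (distr (?N \<Otimes>\<^sub>M ?N) ?N ?mix) (?E J) = emeasure (?N \<Otimes>\<^sub>M ?N) (?E (J \<inter> K) \<times> ?E (J - K))"
      using sets[of J]
      by (subst emeasure_distr) (auto simp: space_pair_measure space_PiM PiE_iff intro!: arg_cong2[where f = emeasure])
    also have "\<dots> = emeasure ?N (?E (J \<inter> K)) * emeasure ?N (?E (J - K))"
      by (intro P.emeasure_pair_measure_Times sets) auto
    also have "\<dots> = (\<Prod>j\<in>J \<inter> K. emeasure (M j) (F j)) * (\<Prod>j\<in>J - K. emeasure (M j) (F j))"
      using J F by (subst (1 2) P.emeasure_PiM_Collect) auto
    also have "\<dots> = (\<Prod>j\<in>J. emeasure (M j) (F j))"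
      using prod.union_disjoint[of "J \<inter> K" "J - K" "\<lambda>j. emeasure (M j) (F j)"] J
      by (simp add: Int_Diff_disjoint Int_Diff_Un)
    finally show "emeasure (distr (?N \<Otimes>\<^sub>M ?N) ?N ?mix) (prod_emb UNIV M J (PiE J F)) = (\<Prod>j\<in>J. emeasure (M j) (F j))"
      by (simp add: emb)
  qed simp
qed

lemma (in prob_space) law_eq_pmf:
  fixes F :: "'a \<Rightarrow> 'b::countable"
  assumes F: "F \<in> M \<rightarrow>\<^sub>M count_space UNIV" and eq: "\<And>x. prob {w \<in> space M. F w = x} = pmf p x"
  shows "prob {w \<in> space M. P (F w)} = measure_pmf.prob p {x. P x}"
proof -
  have "distr M (count_space UNIV) F = measure_pmf p"
  proof (rule measure_eqI_countable)
    show "emeasure (distr M (count_space UNIV) F) {a} = emeasure (measure_pmf p) {a}" for a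
      using F eq[of a] by (simp add: emeasure_distr emeasure_eq_measure emeasure_pmf_single vimage_def Int_def conj_commute)
  qed auto
  then have "measure_pmf.prob p {x. P x} = measure (distr M (count_space UNIV) F) {x. P x}" by simp
  also have "\<dots> = prob {w \<in> space M. P (F w)}"
    using F by (subst measure_distr) (auto simp: vimage_def Int_def conj_commute)
  finally show ?thesis ..
qed

lemma window_eq_iff: "window f a n = zs \<longleftrightarrow> length zs = n \<and> (\<forall>i<n. f (a + int i) = zs ! i)"
  unfolding window_def by (auto simp: list_eq_iff_nth_eq)

lemma drop_window: "window f (a + int k) n = drop k (window f a (k + n))"
  by (simp add: window_append)

lemma measurable_moves:
  assumes [measurable]: "\<And>x. Measurable.pred M (\<lambda>w. f w x)" "\<And>x. Measurable.pred M (\<lambda>w. c w x)"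
    and j: "\<And>x. (\<lambda>w. j w x) \<in> M \<rightarrow>\<^sub>M count_space UNIV"
  shows "Measurable.pred M (\<lambda>w. moves (f w) (c w) (j w) x)"
proof -
  have [measurable]: "Measurable.pred M (\<lambda>w. P (j w x))" for P x
    by (rule measurable_compose[OF j]) simp
  \<comment> \<open>Rewrites the successor by quantifiers over the integers; countability then gives
    measurability.\<close>
  have *: "(case nxt e z of None \<Rightarrow> False | Some w \<Rightarrow> w \<le> z + int (i z)) \<longleftrightarrow>
     (\<exists>w. (z < w \<and> e w \<and> (\<forall>y. z < y \<and> y < w \<longrightarrow> \<not> e y)) \<and> w \<le> z + int (i z))"
    for e z and i :: "int \<Rightarrow> nat" unfolding nxt_Some_iff[symmetric] by (auto split: option.splits)
  show ?thesis unfolding moves_def * by measurable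
qed

lemma measurable_sv_step:
  assumes [measurable]: "\<And>x. Measurable.pred M (\<lambda>w. f w x)" "\<And>x. Measurable.pred M (\<lambda>w. c w x)"
    and j: "\<And>x. (\<lambda>w. j w x) \<in> M \<rightarrow>\<^sub>M count_space UNIV"
  shows "Measurable.pred M (\<lambda>w. sv_step (f w) (c w) (j w) x)"
proof -
  note [measurable] = measurable_moves[OF assms]
  have [measurable]: "Measurable.pred M (\<lambda>w. P (j w x))" for P x
    by (rule measurable_compose[OF j]) simp
  show ?thesis unfolding sv_step_iff prev_def if_bool_eq_conj by measurable
qed

lemma measurable_window:
  fixes f :: "'a \<Rightarrow> int \<Rightarrow> 'b::countable"
  assumes [measurable]: "\<And>x. (\<lambda>w. f w x) \<in> M \<rightarrow>\<^sub>M count_space UNIV"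
  shows "(\<lambda>w. window (f w) a n) \<in> M \<rightarrow>\<^sub>M count_space UNIV"
proof (rule measurable_count_space_eq2_countable[THEN iffD2])
  show "(\<lambda>w. window (f w) a n) \<in> space M \<rightarrow> UNIV \<and> (\<forall>zs\<in>UNIV. (\<lambda>w. window (f w) a n) -` {zs} \<inter> space M \<in> sets M)"
  proof (intro conjI ballI)
    fix zs :: "'b list"
    have "(\<lambda>w. window (f w) a n) -` {zs} \<inter> space M = {w \<in> space M. length zs = n \<and> (\<forall>i<n. f w (a + int i) = zs ! i)}"
      unfolding vimage_def Int_def mem_Collect_eq singleton_iff window_eq_iff by blast
    also have "\<dots> \<in> sets M" by measurable
    finally show "(\<lambda>w. window (f w) a n) -` {zs} \<inter> space M \<in> sets M" .
  qed simp
qed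

lemma PiM_window_prob:
  fixes p :: "int \<Rightarrow> 'a pmf"
  assumes "length zs = n"
  shows "measure (PiM UNIV (\<lambda>i. measure_pmf (p i))) {f. window f a n = zs} = (\<Prod>i<n. pmf (p (a + int i)) (zs ! i))"
proof -
  interpret P: product_prob_space "\<lambda>i. measure_pmf (p i)" UNIV by unfold_locales
  let ?J = "(\<lambda>i. a + int i) ` {..<n}"
  have inj: "inj_on (\<lambda>i. a + int i) {..<n}" by (auto simp: inj_on_def)
  have "{f. window f a n = zs} = {f \<in> space (PiM UNIV (\<lambda>i. measure_pmf (p i))). \<forall>x\<in>?J. f x \<in> {zs ! nat (x - a)}}"
    using assms by (auto simp: window_eq_iff space_PiM)
  then have "emeasure (PiM UNIV (\<lambda>i. measure_pmf (p i))) {f. window f a n = zs} = (\<Prod>x\<in>?J. emeasure (p x) {zs ! nat (x - a)})"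
    by (simp only:) (rule P.emeasure_PiM_Collect, auto)
  also have "\<dots> = (\<Prod>i<n. ennreal (pmf (p (a + int i)) (zs ! i)))"
    using inj by (simp add: prod.reindex emeasure_pmf_single)
  finally show ?thesis unfolding measure_def by (simp add: prod_ennreal prod_nonneg)
qed

lemma pmf_replicate: "pmf (replicate_pmf n p) zs = (if length zs = n then \<Prod>i<n. pmf p (zs ! i) else 0)"
proof (cases "length zs = n")
  case True
  then show ?thesis
  proof (induction n arbitrary: zs)
    case (Suc n)
    then obtain z ys where zs: "zs = z # ys" "length ys = n" by (cases zs) auto
    have "pmf (replicate_pmf (Suc n) p) zs = pmf p z * pmf (replicate_pmf n p) ys"
      unfolding zs replicate_pmf.simps by (rule pmf_bind_Cons)
    then show ?case using Suc.IH[of ys] zs by (simp add: prod.lessThan_Suc_shift del: prod.lessThan_Suc)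
  qed simp
next
  case False
  then have "zs \<notin> set_pmf (replicate_pmf n p)" by (auto simp: set_replicate_pmf)
  then show ?thesis using False by (simp add: set_pmf_iff)
qed

lemma pmf_append:
  assumes "\<And>xs. xs \<in> set_pmf p \<Longrightarrow> length xs = n"
  shows "pmf (p \<bind> (\<lambda>xs. q \<bind> (\<lambda>ys. return_pmf (xs @ ys)))) zs = pmf p (take n zs) * pmf q (drop n zs)"
proof -
  have *: "pmf (q \<bind> (\<lambda>ys. return_pmf (xs @ ys))) zs = indicator {take n zs} xs * pmf q (drop n zs)"
    if "xs \<in> set_pmf p" for xs
  proof (cases "xs = take n zs")
    case True
    then have zs: "zs = xs @ drop n zs" by simp
    have "pmf (map_pmf ((@) xs) q) (xs @ drop n zs) = pmf q (drop n zs)"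
      by (rule pmf_map_inj') (simp add: inj_def)
    then show ?thesis using True zs[symmetric] by (simp add: map_pmf_def)
  next
    case False
    then have "zs \<noteq> xs @ ys" for ys using assms[OF that] by auto
    then have "zs \<notin> set_pmf (q \<bind> (\<lambda>ys. return_pmf (xs @ ys)))" by auto
    then have "pmf (q \<bind> (\<lambda>ys. return_pmf (xs @ ys))) zs = 0" by (simp only: set_pmf_iff not_not)
    then show ?thesis using False by simp
  qed
  have "pmf (p \<bind> (\<lambda>xs. q \<bind> (\<lambda>ys. return_pmf (xs @ ys)))) zs =
    E_pmf p (\<lambda>xs. indicator {take n zs} xs * pmf q (drop n zs))"
    unfolding pmf_bind[of p] by (rule expectation_cong_pmf) (rule *)
  also have "\<dots> = pmf p (take n zs) * pmf q (drop n zs)"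
    by (simp add: measure_pmf_single)
  finally show ?thesis .
qed

lemma sv_iter_cong:
  assumes "\<And>s x. s < t \<Longrightarrow> w (s, x) = w' (s, x)"
  shows "sv_iter t eta w = sv_iter t eta w'"
  using assms by (induction t) simp_all

context shock
begin

definition noise :: "(nat \<times> int \<Rightarrow> bool \<times> nat) measure" where "noise = noise_space b1 b2"
definition init :: "config measure" where "init = Upsilon2 \<theta> \<rho>"
definition world :: "(config \<times> (nat \<times> int \<Rightarrow> bool \<times> nat)) measure" where "world = init \<Otimes>\<^sub>M noise"
definition state :: "nat \<Rightarrow> config \<times> (nat \<times> int \<Rightarrow> bool \<times> nat) \<Rightarrow> config" where
  "state t w = sv_iter t (fst w) (snd w)"

lemma prob_noise: "prob_space noise"
  unfolding noise_def noise_space_def by (rule prob_space_PiM) (rule measure_pmf.prob_space_axioms)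

lemma prob_init: "prob_space init"
  unfolding init_def Upsilon2_def by (rule prob_space_PiM) (rule measure_pmf.prob_space_axioms)

lemma prob_world: "prob_space world"
proof -
  interpret N: prob_space noise by (rule prob_noise)
  interpret I: prob_space init by (rule prob_init)
  interpret pair_prob_space init noise by unfold_locales
  show ?thesis unfolding world_def by unfold_locales
qed

lemma space_noise [simp]: "space noise = UNIV" by (simp add: noise_def noise_space_def space_PiM)
lemma space_init [simp]: "space init = UNIV" by (simp add: init_def Upsilon2_def space_PiM)
lemma space_world [simp]: "space world = UNIV" by (simp add: world_def space_pair_measure)

lemma measurable_noise [measurable]: "(\<lambda>w. w i) \<in> noise \<rightarrow>\<^sub>M count_space UNIV"
proof -
  have "(\<lambda>w. w i) \<in> noise \<rightarrow>\<^sub>M measure_pmf (noise_pmf b1 b2)"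
    unfolding noise_def noise_space_def by (rule measurable_component_singleton) simp
  then show ?thesis by (simp cong: measurable_cong_sets)
qed

lemma measurable_init [measurable]: "Measurable.pred init (\<lambda>w. w i)"
proof -
  have "(\<lambda>w. w i) \<in> init \<rightarrow>\<^sub>M measure_pmf (bernoulli_pmf (if i \<le> 0 then \<theta> else \<rho>))"
    unfolding init_def Upsilon2_def by (rule measurable_component_singleton) simp
  then show ?thesis by (simp add: pred_def cong: measurable_cong_sets)
qed

lemma measurable_sv_iter:
  assumes [measurable]: "\<And>x. Measurable.pred M (\<lambda>w. f w x)" "\<And>i. (\<lambda>w. g w i) \<in> M \<rightarrow>\<^sub>M count_space UNIV"
  shows "Measurable.pred M (\<lambda>w. sv_iter t (f w) (g w) x)"
proof (induction t arbitrary: x)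
  case (Suc t)
  have [measurable]: "(\<lambda>w. fst (g w i)) \<in> M \<rightarrow>\<^sub>M count_space UNIV" "(\<lambda>w. snd (g w i)) \<in> M \<rightarrow>\<^sub>M count_space UNIV" for i
    by (rule measurable_compose[OF assms(2)]; simp)+
  show ?case unfolding sv_iter.simps by (rule measurable_sv_step) (use Suc in measurable)
qed simp

lemma measurable_state [measurable]: "Measurable.pred world (\<lambda>w. state t w x)"
  unfolding state_def world_def by (rule measurable_sv_iter) measurable

lemma measurable_world_noise [measurable]: "(\<lambda>w. snd w i) \<in> world \<rightarrow>\<^sub>M count_space UNIV"
  unfolding world_def by measurable

end

section \<open>Window laws for the process on the line\<close>

lemma replicate_pmf_snoc:
  "replicate_pmf (Suc t) l = replicate_pmf t l \<bind> (\<lambda>hs. l \<bind> (\<lambda>h. return_pmf (hs @ [h])))"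
  using replicate_pmf_distrib[of t 1 l] by (simp add: bind_assoc_pmf bind_return_pmf)

context six_vertex
begin

lemma box_snoc:
  "box (hs @ [h]) vs = box hs vs \<bind> (\<lambda>p. row h (snd p) \<bind> (\<lambda>q. return_pmf (fst p @ [snd q], fst q)))"
  by (induction hs arbitrary: vs) (simp_all add: box_Cons bind_assoc_pmf bind_return_pmf)

text \<open>Time adds rows on top, whereas \<open>box\<close> recurses from the bottom. The newest
  left input is independent of the lower rows and may be drawn in advance.\<close>

lemma quadrant_Suc:
  "map_pmf snd (quadrant (Suc t) m l b) = l \<bind> (\<lambda>h. map_pmf snd (quadrant t m l b) \<bind> (\<lambda>vs. map_pmf fst (row h vs)))"
proof -
  have "map_pmf snd (quadrant (Suc t) m l b) = replicate_pmf t l \<bind> (\<lambda>hs. l \<bind> (\<lambda>h. replicate_pmf m b \<bind> (\<lambda>vs.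
    box hs vs \<bind> (\<lambda>p. map_pmf fst (row h (snd p))))))"
    unfolding quadrant_def replicate_pmf_snoc by (simp add: bind_assoc_pmf bind_return_pmf box_snoc map_bind_pmf) (simp add: map_pmf_def)
  also have "\<dots> = l \<bind> (\<lambda>h. replicate_pmf t l \<bind> (\<lambda>hs. replicate_pmf m b \<bind> (\<lambda>vs.
    box hs vs \<bind> (\<lambda>p. map_pmf fst (row h (snd p))))))"
    by (rule bind_commute_pmf)
  finally show ?thesis by (simp add: quadrant_def bind_map_pmf bind_assoc_pmf)
qed

text \<open>Probability that an arrow leaves \<open>k\<close> sites of density \<open>s\<close> on
  the right when none enters on the left.\<close>

primrec arrow_prob :: "real \<Rightarrow> nat \<Rightarrow> real" where
  "arrow_prob s 0 = 0"
| "arrow_prob s (Suc k) = (1 - s) * (b2 * arrow_prob s k) + s * (1 - b1 + b1 * arrow_prob s k)"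

lemma arrow_prob_bounds: assumes "0 \<le> s" "s \<le> 1" shows "0 \<le> arrow_prob s k" "arrow_prob s k \<le> 1"
proof -
  have "0 \<le> arrow_prob s k \<and> arrow_prob s k \<le> 1"
  proof (induction k)
    case (Suc k)
    have "b2 * arrow_prob s k \<le> 1" "b1 * arrow_prob s k \<le> b1" using Suc by (auto intro: mult_le_one mult_left_le)
    then have "(1 - s) * (b2 * arrow_prob s k) + s * (1 - b1 + b1 * arrow_prob s k) \<le> (1 - s) * 1 + s * 1"
      using assms by (intro add_mono mult_left_mono) auto
    moreover have "0 \<le> b1 * arrow_prob s k" "0 \<le> b2 * arrow_prob s k" using Suc by auto
    ultimately show ?case using assms by auto
  qed simp
  then show "0 \<le> arrow_prob s k" "arrow_prob s k \<le> 1" by auto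
qed

text \<open>The recursion is affine with fixed point \<open>flux s\<close>, by
  \<open>flux_balance\<close>, and slope \<open>c\<close>, which is at most \<open>b2\<close>; the
  error decays geometrically.\<close>

lemma arrow_prob_limit:
  assumes "0 \<le> s" "s \<le> 1" shows "(\<lambda>k. arrow_prob s k) \<longlonglongrightarrow> flux s"
proof -
  define c where "c = (1 - s) * b2 + s * b1"
  have stat: "flux s = (1 - s) * (b2 * flux s) + s * (1 - b1 + b1 * flux s)"
    using flux_balance[OF assms] by (simp add: algebra_simps)
  have "flux s - arrow_prob s k = c ^ k * flux s" for k
  proof (induction k)
    case (Suc k)
    have "flux s - arrow_prob s (Suc k) = c * (flux s - arrow_prob s k)"
      using stat by (simp add: c_def algebra_simps)
    then show ?case by (simp add: Suc)
  qed simp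
  then have *: "arrow_prob s k = flux s - c ^ k * flux s" for k by (metis add_diff_cancel_left' diff_add_cancel)
  have "0 \<le> c" "c < 1"
  proof -
    show "0 \<le> c" using assms b by (simp add: c_def)
    have "c \<le> (1 - s) * b2 + s * b2" unfolding c_def using assms b by (intro add_mono mult_left_mono) auto
    also have "\<dots> = b2" by (simp add: algebra_simps)
    finally show "c < 1" using b by simp
  qed
  then have "(\<lambda>k. c ^ k) \<longlonglongrightarrow> 0" by (intro LIMSEQ_power_zero) auto
  then have "(\<lambda>k. flux s - c ^ k * flux s) \<longlonglongrightarrow> flux s - 0 * flux s"
    by (intro tendsto_diff tendsto_mult tendsto_const)
  then show ?thesis by (simp add: *)
qed

lemma row_arrow:
  assumes "0 \<le> s" "s \<le> 1"
  shows "replicate_pmf k (bernoulli_pmf s) \<bind> (\<lambda>us. map_pmf snd (row False us)) = bernoulli_pmf (arrow_prob s k)"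
proof (induction k)
  case 0
  have "bernoulli_pmf 0 = return_pmf False" by (rule bernoulli_eqI[symmetric]) simp
  then show ?case by (simp add: bind_return_pmf)
next
  case (Suc k)
  let ?B = "bernoulli_pmf s" and ?R = "replicate_pmf k (bernoulli_pmf s)"
  have "replicate_pmf (Suc k) ?B \<bind> (\<lambda>us. map_pmf snd (row False us)) =
    ?R \<bind> (\<lambda>us. ?B \<bind> (\<lambda>v. row False us \<bind> (\<lambda>p. vertex v (snd p) \<bind> (\<lambda>q. return_pmf (snd q)))))"
    unfolding replicate_pmf_snoc by (simp add: bind_assoc_pmf bind_return_pmf row_append row_Cons map_bind_pmf)
  also have "\<dots> = (?R \<bind> (\<lambda>us. map_pmf snd (row False us))) \<bind> (\<lambda>h. ?B \<bind> (\<lambda>v. vertex v h \<bind> (\<lambda>q. return_pmf (snd q))))"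
    unfolding bind_assoc_pmf bind_map_pmf by (subst bind_commute_pmf[of ?B]) (rule refl)
  also have "\<dots> = bernoulli_pmf (arrow_prob s (Suc k))"
    unfolding Suc using assms arrow_prob_bounds[OF assms, of k]
    by (intro bernoulli_eqI) (simp add: pmf_bind expectation_vertex algebra_simps)
  finally show ?case .
qed

end

context shock
begin

text \<open>Candidate for the law of the sites from \<open>1 - n\<close> to \<open>m\<close> at time
  \<open>t\<close>. The sites up to the origin remain Bernoulli of density \<open>\<theta>\<close>
  and independent of those to its right, which they feed with independent arrows.\<close>

definition line_law :: "nat \<Rightarrow> nat \<Rightarrow> nat \<Rightarrow> bool list pmf" where
  "line_law t n m = replicate_pmf n (bernoulli_pmf \<theta>) \<bind> (\<lambda>xs. map_pmf snd (shock_law t m) \<bind> (\<lambda>ys. return_pmf (xs @ ys)))"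

lemma line_law_add:
  "line_law t (k + n) m = replicate_pmf k (bernoulli_pmf \<theta>) \<bind> (\<lambda>us. line_law t n m \<bind> (\<lambda>ws. return_pmf (us @ ws)))"
  unfolding line_law_def replicate_pmf_distrib bind_assoc_pmf bind_return_pmf by simp

text \<open>A stationary arrow crosses the stationary sites; by \<open>row_stationary\<close> a
  stationary arrow, independent of their new state, arrives at the quadrant.\<close>

lemma line_law_Suc:
  "line_law (Suc t) n m = bernoulli_pmf (flux \<theta>) \<bind> (\<lambda>h. line_law t n m \<bind> (\<lambda>ws. map_pmf fst (row h ws)))"
proof -
  let ?H = "bernoulli_pmf (flux \<theta>)" and ?R = "replicate_pmf n (bernoulli_pmf \<theta>)" and ?S = "map_pmf snd (shock_law t m)"
  have "?H \<bind> (\<lambda>h. line_law t n m \<bind> (\<lambda>ws. map_pmf fst (row h ws))) =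
    ?H \<bind> (\<lambda>h. ?R \<bind> (\<lambda>xs. ?S \<bind> (\<lambda>ys. row h xs \<bind> (\<lambda>p. row (snd p) ys \<bind> (\<lambda>q. return_pmf (fst p @ fst q))))))"
    unfolding line_law_def bind_assoc_pmf bind_return_pmf row_append map_bind_pmf map_return_pmf fst_conv ..
  also have "\<dots> = (?H \<bind> (\<lambda>h. ?R \<bind> (\<lambda>xs. row h xs))) \<bind> (\<lambda>p. ?S \<bind> (\<lambda>ys. row (snd p) ys \<bind> (\<lambda>q. return_pmf (fst p @ fst q))))"
    unfolding bind_assoc_pmf by (subst bind_commute_pmf[of ?S]) (rule refl)
  also have "\<dots> = ?R \<bind> (\<lambda>xs. ?H \<bind> (\<lambda>h. ?S \<bind> (\<lambda>ys. row h ys \<bind> (\<lambda>q. return_pmf (xs @ fst q)))))"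
    unfolding row_stationary[OF dens(1) dens_simps(3)] pair_pmf_def bind_assoc_pmf bind_return_pmf fst_conv snd_conv ..
  also have "\<dots> = line_law (Suc t) n m"
    unfolding line_law_def shock_law_def quadrant_Suc by (simp add: bind_assoc_pmf bind_map_pmf)
  finally show ?thesis ..
qed

text \<open>Starting without an arrow \<open>k\<close> sites further left, these sites serve only to
  produce an arrow, which enters the window with probability
  \<open>arrow_prob \<theta> k\<close>.\<close>

lemma line_law_cut:
  "map_pmf (drop k) (line_law t (k + n) m \<bind> (\<lambda>ws. map_pmf fst (row False ws))) =
    bernoulli_pmf (arrow_prob \<theta> k) \<bind> (\<lambda>h. line_law t n m \<bind> (\<lambda>ws. map_pmf fst (row h ws)))"
proof -
  let ?R = "replicate_pmf k (bernoulli_pmf \<theta>)" and ?L = "line_law t n m"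
  have "map_pmf (drop k) (line_law t (k + n) m \<bind> (\<lambda>ws. map_pmf fst (row False ws))) =
    ?R \<bind> (\<lambda>us. ?L \<bind> (\<lambda>ws. row False us \<bind> (\<lambda>p. row (snd p) ws \<bind> (\<lambda>q. return_pmf (drop k (fst p @ fst q))))))"
    unfolding line_law_add bind_assoc_pmf bind_return_pmf row_append map_bind_pmf map_return_pmf fst_conv ..
  also have "\<dots> = ?R \<bind> (\<lambda>us. ?L \<bind> (\<lambda>ws. row False us \<bind> (\<lambda>p. row (snd p) ws \<bind> (\<lambda>q. return_pmf (fst q)))))"
  proof (intro bind_pmf_cong refl)
    fix us p and q :: "bool list \<times> bool" assume "us \<in> set_pmf ?R" "p \<in> set_pmf (row False us)"
    then have "length (fst p) = k" using row_length[of p False us] by (simp add: set_replicate_pmf)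
    then show "return_pmf (drop k (fst p @ fst q)) = return_pmf (fst q)" by simp
  qed
  also have "\<dots> = (?R \<bind> (\<lambda>us. map_pmf snd (row False us))) \<bind> (\<lambda>h. ?L \<bind> (\<lambda>ws. row h ws \<bind> (\<lambda>q. return_pmf (fst q))))"
    unfolding bind_assoc_pmf bind_map_pmf by (subst bind_commute_pmf[of ?L]) (rule refl)
  also have "\<dots> = bernoulli_pmf (arrow_prob \<theta> k) \<bind> (\<lambda>h. ?L \<bind> (\<lambda>ws. map_pmf fst (row h ws)))"
    unfolding row_arrow[OF dens(1) dens_simps(3)] by (simp add: map_pmf_def)
  finally show ?thesis .
qed

text \<open>Only the law of the single entering arrow depends on \<open>k\<close>, so the
  probability is an affine function of \<open>arrow_prob \<theta> k\<close>.\<close>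

lemma line_law_limit:
  "(\<lambda>k. pmf (map_pmf (drop k) (line_law t (k + n) m \<bind> (\<lambda>ws. map_pmf fst (row False ws)))) zs)
    \<longlonglongrightarrow> pmf (line_law (Suc t) n m) zs"
proof -
  define f where "f h = pmf (line_law t n m \<bind> (\<lambda>ws. map_pmf fst (row h ws))) zs" for h
  have 1: "pmf (map_pmf (drop k) (line_law t (k + n) m \<bind> (\<lambda>ws. map_pmf fst (row False ws)))) zs =
    f True * arrow_prob \<theta> k + f False * (1 - arrow_prob \<theta> k)" for k
    unfolding line_law_cut using arrow_prob_bounds[of \<theta> k] by (subst pmf_bind) (simp add: f_def)
  have 2: "pmf (line_law (Suc t) n m) zs = f True * flux \<theta> + f False * (1 - flux \<theta>)"
    unfolding line_law_Suc by (subst pmf_bind) (simp add: f_def)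
  show ?thesis unfolding 1 2 by (intro tendsto_intros arrow_prob_limit) simp_all
qed

definition noise_row :: "nat \<Rightarrow> config \<times> (nat \<times> int \<Rightarrow> bool \<times> nat) \<Rightarrow> int \<Rightarrow> bool \<times> nat" where
  "noise_row t w = (\<lambda>x. snd w (t, x))"

lemma measurable_noise_row [measurable]: "(\<lambda>w. noise_row t w x) \<in> world \<rightarrow>\<^sub>M count_space UNIV"
  unfolding noise_row_def by measurable

lemma noise_window_prob:
  "measure noise {w. window (\<lambda>x. w (t, x)) a n = bs} = pmf (replicate_pmf n (noise_pmf b1 b2)) bs"
proof (cases "length bs = n")
  case True
  interpret P: product_prob_space "\<lambda>i :: nat \<times> int. measure_pmf (noise_pmf b1 b2)" UNIV by unfold_locales
  let ?J = "(\<lambda>i. (t, a + int i)) ` {..<n}"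
  have inj: "inj_on (\<lambda>i. (t, a + int i)) {..<n}" by (auto simp: inj_on_def)
  have "{w. window (\<lambda>x. w (t, x)) a n = bs} = {w \<in> space (PiM UNIV (\<lambda>i. measure_pmf (noise_pmf b1 b2))).
      \<forall>i\<in>?J. w i \<in> {bs ! nat (snd i - a)}}"
    using True by (auto simp: window_eq_iff space_PiM)
  then have "emeasure noise {w. window (\<lambda>x. w (t, x)) a n = bs} = (\<Prod>i\<in>?J. emeasure (noise_pmf b1 b2) {bs ! nat (snd i - a)})"
    unfolding noise_def noise_space_def by (simp only:) (rule P.emeasure_PiM_Collect, auto)
  also have "\<dots> = (\<Prod>i<n. ennreal (pmf (noise_pmf b1 b2) (bs ! i)))"
    using inj by (simp add: prod.reindex emeasure_pmf_single)
  finally show ?thesis using True unfolding measure_def pmf_replicate by (simp add: prod_ennreal prod_nonneg)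
next
  case False
  then have "{w. window (\<lambda>x. w (t, x)) a n = bs} = {}" by auto
  then show ?thesis using False by (simp add: pmf_replicate)
qed

text \<open>Take the noise before time \<open>t\<close> from one copy and all other noise from an
  independent copy. By \<open>PiM_mix\<close> the law is unchanged, while
  \<open>S \<inter> R\<close> becomes a rectangle.\<close>

lemma noise_past_independent:
  assumes S: "S \<in> sets noise" "\<And>w w'. (\<And>s x. s < t \<Longrightarrow> w (s, x) = w' (s, x)) \<Longrightarrow> w \<in> S \<longleftrightarrow> w' \<in> S"
    and R: "R \<in> sets noise" "\<And>w w'. (\<And>x. w (t, x) = w' (t, x)) \<Longrightarrow> w \<in> R \<longleftrightarrow> w' \<in> R"
  shows "emeasure noise (S \<inter> R) = emeasure noise S * emeasure noise R"
proof -
  interpret N: prob_space noise by (rule prob_noise)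
  let ?mix = "\<lambda>(f, g) i. if i \<in> {i. fst i < t} then f i else g i"
  have mix: "distr (noise \<Otimes>\<^sub>M noise) noise ?mix = noise"
    unfolding noise_def noise_space_def by (rule PiM_mix) (rule measure_pmf.prob_space_axioms)
  have meas: "?mix \<in> noise \<Otimes>\<^sub>M noise \<rightarrow>\<^sub>M noise"
  proof -
    have "(\<lambda>p i. if i \<in> {i. fst i < t} then fst p i else snd p i) \<in> noise \<Otimes>\<^sub>M noise \<rightarrow>\<^sub>M noise"
      unfolding noise_def noise_space_def
      by (rule measurable_PiM_single') (auto simp: space_pair_measure space_PiM)
    then show ?thesis by (simp add: case_prod_unfold)
  qed
  have "emeasure noise (S \<inter> R) = emeasure (distr (noise \<Otimes>\<^sub>M noise) noise ?mix) (S \<inter> R)" by (simp only: mix)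
  also have "\<dots> = emeasure (noise \<Otimes>\<^sub>M noise) (?mix -` (S \<inter> R) \<inter> space (noise \<Otimes>\<^sub>M noise))"
    by (rule emeasure_distr[OF meas]) (use S R in auto)
  also have "?mix -` (S \<inter> R) \<inter> space (noise \<Otimes>\<^sub>M noise) = S \<times> R"
  proof -
    have "(\<lambda>i. if fst i < t then f i else g i) \<in> S \<longleftrightarrow> f \<in> S" "(\<lambda>i. if fst i < t then f i else g i) \<in> R \<longleftrightarrow> g \<in> R" for f g
      by (rule S(2), simp) (rule R(2), simp)
    then show ?thesis by (auto simp: space_pair_measure)
  qed
  also have "emeasure (noise \<Otimes>\<^sub>M noise) (S \<times> R) = emeasure noise S * emeasure noise R"
    by (rule N.emeasure_pair_measure_Times) (use S R in auto)
  finally show ?thesis .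
qed

text \<open>For a fixed initial configuration the state at time \<open>t\<close> reads only earlier
  noise, so \<open>noise_past_independent\<close> applies section by section and Fubini
  finishes.\<close>

lemma joint_window_prob:
  "measure world {w. window (state t w) a n = as \<and> window (noise_row t w) a n = bs} =
    measure world {w. window (state t w) a n = as} * pmf (replicate_pmf n (noise_pmf b1 b2)) bs"
proof -
  interpret W: prob_space world by (rule prob_world)
  interpret N: prob_space noise by (rule prob_noise)
  interpret I: prob_space init by (rule prob_init)
  note [measurable] = measurable_window
  let ?A = "{w. window (state t w) a n = as}" and ?B = "{w. window (noise_row t w) a n = bs}"
  have ms: "?A \<in> sets world" "?B \<in> sets world"
  proof -
    have "(\<lambda>w. window (state t w) a n) \<in> world \<rightarrow>\<^sub>M count_space UNIV"
      "(\<lambda>w. window (noise_row t w) a n) \<in> world \<rightarrow>\<^sub>M count_space UNIV" by measurable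
    then show "?A \<in> sets world" "?B \<in> sets world"
      using measurable_sets[of _ world "count_space UNIV" "{as}"] measurable_sets[of _ world "count_space UNIV" "{bs}"]
      by (fastforce simp: vimage_def)+
  qed
  define S where "S eta = {w. window (sv_iter t eta w) a n = as}" for eta
  define R where "R = {w. window (\<lambda>x. w (t, x)) a n = bs}"
  have cut: "Pair eta -` ?A = S eta" "Pair eta -` (?A \<inter> ?B) = S eta \<inter> R" for eta
    by (auto simp: S_def R_def state_def noise_row_def)
  have S: "S eta \<in> sets noise" for eta
    using sets_Pair1[of ?A init noise eta] ms by (simp only: cut world_def)
  have R: "R \<in> sets noise"
    using sets_Pair1[of ?B init noise undefined] ms by (simp add: world_def R_def noise_row_def vimage_def)
  have "emeasure world (?A \<inter> ?B) = (\<integral>\<^sup>+eta. emeasure noise (S eta \<inter> R) \<partial>init)"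
    using N.emeasure_pair_measure_alt[of "?A \<inter> ?B" init] ms by (simp only: world_def cut sets.Int)
  also have "\<dots> = (\<integral>\<^sup>+eta. emeasure noise (S eta) * emeasure noise R \<partial>init)"
  proof (intro nn_integral_cong)
    fix eta
    show "emeasure noise (S eta \<inter> R) = emeasure noise (S eta) * emeasure noise R"
    proof (rule noise_past_independent[OF S _ R])
      fix w w' :: "nat \<times> int \<Rightarrow> bool \<times> nat"
      assume "\<And>s x. s < t \<Longrightarrow> w (s, x) = w' (s, x)"
      then show "w \<in> S eta \<longleftrightarrow> w' \<in> S eta" unfolding S_def using sv_iter_cong[of t w w' eta] by simp
    qed (simp add: R_def)
  qed
  also have "\<dots> = (\<integral>\<^sup>+eta. emeasure noise (S eta) \<partial>init) * emeasure noise R"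
  proof (rule nn_integral_multc)
    have "(\<lambda>eta. emeasure noise (Pair eta -` ?A)) \<in> borel_measurable init"
      using ms(1) unfolding world_def by (rule N.measurable_emeasure_Pair)
    then show "(\<lambda>eta. emeasure noise (S eta)) \<in> borel_measurable init" by (simp only: cut)
  qed
  also have "(\<integral>\<^sup>+eta. emeasure noise (S eta) \<partial>init) = emeasure world ?A"
    using N.emeasure_pair_measure_alt[of "?A" init] ms by (simp only: world_def cut)
  finally have "measure world (?A \<inter> ?B) = measure world ?A * measure noise R"
    by (simp add: measure_def enn2real_mult)
  then show ?thesis unfolding R_def noise_window_prob by (simp add: Collect_conj_eq)
qed

lemma init_window_prob:
  "measure world {w. window (state 0 w) (1 - int n) (n + m) = zs} = pmf (line_law 0 n m) zs"
proof -
  interpret N: prob_space noise by (rule prob_noise)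
  interpret I: prob_space init by (rule prob_init)
  let ?p = "\<lambda>x::int. bernoulli_pmf (if x \<le> 0 then \<theta> else \<rho>)"
  have law0: "map_pmf snd (shock_law 0 m) = replicate_pmf m (bernoulli_pmf \<rho>)"
    by (simp add: shock_law_def quadrant_def bind_return_pmf map_bind_pmf bind_return_pmf')
  have meas: "{eta. window eta (1 - int n) (n + m) = zs} \<in> sets init"
  proof -
    have "(\<lambda>eta. window eta (1 - int n) (n + m)) \<in> init \<rightarrow>\<^sub>M count_space UNIV"
      by (rule measurable_window) (simp add: measurable_init)
    from measurable_sets[OF this, of "{zs}"] show ?thesis by (simp add: vimage_def)
  qed
  have "{w. window (state 0 w) (1 - int n) (n + m) = zs} = {eta. window eta (1 - int n) (n + m) = zs} \<times> space noise"
    by (auto simp: state_def)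
  then have "emeasure world {w. window (state 0 w) (1 - int n) (n + m) = zs} =
    emeasure init {eta. window eta (1 - int n) (n + m) = zs}"
    unfolding world_def using N.emeasure_pair_measure_Times[OF meas sets.top] N.emeasure_space_1 by simp
  then have eq: "measure world {w. window (state 0 w) (1 - int n) (n + m) = zs} =
    measure init {eta. window eta (1 - int n) (n + m) = zs}" by (simp add: measure_def)
  show ?thesis
  proof (cases "length zs = n + m")
    case True
    have "measure init {eta. window eta (1 - int n) (n + m) = zs} =
      (\<Prod>i<n + m. pmf (?p (1 - int n + int i)) (zs ! i))"
      unfolding init_def Upsilon2_def by (rule PiM_window_prob[OF True])
    also have "\<dots> = (\<Prod>i<n. pmf (?p (1 - int n + int i)) (zs ! i)) * (\<Prod>i<m. pmf (?p (1 - int n + int (n + i))) (zs ! (n + i)))"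
      by (induction m) (simp_all add: mult.assoc)
    also have "(\<Prod>i<n. pmf (?p (1 - int n + int i)) (zs ! i)) = (\<Prod>i<n. pmf (bernoulli_pmf \<theta>) (take n zs ! i))"
      by (intro prod.cong) auto
    also have "(\<Prod>i<m. pmf (?p (1 - int n + int (n + i))) (zs ! (n + i))) = (\<Prod>i<m. pmf (bernoulli_pmf \<rho>) (drop n zs ! i))"
      using True by (intro prod.cong) auto
    finally show ?thesis unfolding eq line_law_def law0 using True
      by (subst pmf_append[where n = n]) (auto simp: set_replicate_pmf pmf_replicate)
  next
    case False
    then have "{eta :: config. window eta (1 - int n) (n + m) = zs} = {}" by auto
    moreover have "zs \<notin> set_pmf (line_law 0 n m)"
      using False unfolding line_law_def law0 by (auto simp: set_replicate_pmf)
    ultimately show ?thesis unfolding eq by (simp add: set_pmf_iff)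
  qed
qed

lemma line_law_length: "zs \<in> set_pmf (line_law t n m) \<Longrightarrow> length zs = n + m"
  by (auto simp: line_law_def set_replicate_pmf shock_law_def dest!: quadrant_length)

text \<open>Induction over time for windows reaching arbitrarily far to the left. The law of the
  update with a cut is computed from the scan, and the cut is then moved to minus infinity.\<close>

lemma state_window_prob:
  "measure world {w. window (state t w) (1 - int n) (n + m) = zs} = pmf (line_law t n m) zs"
proof (induction t arbitrary: n zs)
  case 0
  show ?case by (rule init_window_prob)
next
  case (Suc t)
  interpret W: prob_space world by (rule prob_world)
  let ?step = "\<lambda>w eta. sv_step eta (\<lambda>x. fst (noise_row t w x)) (\<lambda>x. snd (noise_row t w x))"
  have state_Suc: "state (Suc t) w = ?step w (state t w)" for w
    by (simp add: state_def noise_row_def)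
  \<comment> \<open>The induction hypothesis is applied to the wider window that reaches to the cut;
    the scan starts there with load 0, and the first \<open>k\<close> outputs are dropped.\<close>
  have cut_prob: "measure world {w. window (?step w (cut (k + n) (state t w))) (1 - int n) (n + m) = zs} =
    pmf (map_pmf (drop k) (line_law t (k + n) m \<bind> (\<lambda>ws. map_pmf fst (row False ws)))) zs" for k
  proof -
    let ?a = "1 - int (k + n)" and ?l = "k + n + m"
    let ?F = "\<lambda>w. (window (state t w) ?a ?l, window (noise_row t w) ?a ?l)"
    let ?q = "pair_pmf (line_law t (k + n) m) (replicate_pmf ?l (noise_pmf b1 b2))"
    let ?g = "\<lambda>(as, bs). drop k (fst (scan 0 as bs))"
    have "window (?step w (cut (k + n) (state t w))) (1 - int n) (n + m) = ?g (?F w)" for w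
    proof -
      have "window (cut (k + n) (state t w)) ?a ?l = window (state t w) ?a ?l"
        by (auto simp: window_def cut_def)
      then have "window (?step w (cut (k + n) (state t w))) ?a ?l = fst (scan 0 (window (state t w) ?a ?l) (window (noise_row t w) ?a ?l))"
        using scan_window[of "cut (k + n) (state t w)" "\<lambda>x. fst (noise_row t w x)" "\<lambda>x. snd (noise_row t w x)" ?a ?l]
        unfolding load_cut_start by (simp only: prod.collapse fst_conv)
      moreover have "window (?step w (cut (k + n) (state t w))) (1 - int n) (n + m) =
        drop k (window (?step w (cut (k + n) (state t w))) ?a ?l)"
        using drop_window[of "?step w (cut (k + n) (state t w))" ?a k "n + m"] by (simp add: add.assoc)
      ultimately show ?thesis by simp
    qed
    then have "measure world {w. window (?step w (cut (k + n) (state t w))) (1 - int n) (n + m) = zs} =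
      measure world {w \<in> space world. ?g (?F w) = zs}" by simp
    also have "\<dots> = measure_pmf.prob ?q {x. ?g x = zs}"
    proof (rule W.law_eq_pmf)
      have "(\<lambda>w. window (state t w) ?a ?l) \<in> world \<rightarrow>\<^sub>M count_space UNIV"
        "(\<lambda>w. window (noise_row t w) ?a ?l) \<in> world \<rightarrow>\<^sub>M count_space UNIV"
        by (rule measurable_window; measurable)+
      then have "?F \<in> world \<rightarrow>\<^sub>M count_space UNIV \<Otimes>\<^sub>M count_space UNIV" by (rule measurable_Pair)
      then show "?F \<in> world \<rightarrow>\<^sub>M count_space UNIV" by (simp add: pair_measure_countable)
      fix x :: "bool list \<times> (bool \<times> nat) list"
      obtain as bs where x: "x = (as, bs)" by (cases x)
      show "W.prob {w \<in> space world. ?F w = x} = pmf ?q x"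
        using joint_window_prob[of t ?a ?l as bs] Suc[of "k + n" as] by (simp add: x pmf_pair)
    qed
    also have "\<dots> = pmf (map_pmf ?g ?q) zs" by (simp add: pmf_map vimage_def)
    also have "map_pmf ?g ?q = map_pmf (drop k) (line_law t (k + n) m \<bind> (\<lambda>ws.
        map_pmf (\<lambda>ns. fst (scan 0 ws ns)) (replicate_pmf ?l (noise_pmf b1 b2))))"
      by (simp add: pair_pmf_def map_bind_pmf) (simp add: map_pmf_def bind_assoc_pmf bind_return_pmf)
    also have "\<dots> = map_pmf (drop k) (line_law t (k + n) m \<bind> (\<lambda>ws. map_pmf fst (row False ws)))"
      by (intro arg_cong[where f = "map_pmf (drop k)"] bind_pmf_cong refl)
        (simp only: scan_law_fst[symmetric] line_law_length)
    finally show ?thesis .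
  qed
  \<comment> \<open>For each sample the update with a cut agrees with the true one on the window
    from some \<open>k\<close> on, so the indicators converge and dominated convergence
    applies.\<close>
  have "(\<lambda>k. measure world {w. window (?step w (cut (k + n) (state t w))) (1 - int n) (n + m) = zs})
    \<longlonglongrightarrow> measure world {w. window (state (Suc t) w) (1 - int n) (n + m) = zs}"
  proof -
    let ?C = "\<lambda>k. {w. window (?step w (cut (k + n) (state t w))) (1 - int n) (n + m) = zs}"
    let ?D = "{w. window (state (Suc t) w) (1 - int n) (n + m) = zs}"
    have [measurable]: "Measurable.pred world (\<lambda>w. cut N (state t w) x)" for N x
      unfolding cut_def by measurable
    have [measurable]: "(\<lambda>w. fst (noise_row t w x)) \<in> world \<rightarrow>\<^sub>M count_space UNIV"
      "(\<lambda>w. snd (noise_row t w x)) \<in> world \<rightarrow>\<^sub>M count_space UNIV" for x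
      by (rule measurable_compose[OF measurable_noise_row]; simp)+
    have C: "?C k \<in> sets world" for k
    proof -
      have "Measurable.pred world (\<lambda>w. ?step w (cut (k + n) (state t w)) x)" for x
        by (rule measurable_sv_step) measurable
      then have "(\<lambda>w. window (?step w (cut (k + n) (state t w))) (1 - int n) (n + m)) \<in> world \<rightarrow>\<^sub>M count_space UNIV"
        by (intro measurable_window) simp
      from measurable_sets[OF this, of "{zs}"] show ?thesis by (simp add: vimage_def)
    qed
    have D: "?D \<in> sets world"
    proof -
      have "(\<lambda>w. window (state (Suc t) w) (1 - int n) (n + m)) \<in> world \<rightarrow>\<^sub>M count_space UNIV"
        by (rule measurable_window) measurable
      from measurable_sets[OF this, of "{zs}"] show ?thesis by (simp add: vimage_def)
    qed
    have "(\<lambda>k. \<integral>w. indicat_real (?C k) w \<partial>world) \<longlonglongrightarrow> (\<integral>w. indicat_real ?D w \<partial>world)"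
    proof (rule integral_dominated_convergence[where w = "\<lambda>_. 1"])
      show "AE w in world. (\<lambda>k. indicator (?C k) w) \<longlonglongrightarrow> (indicator ?D w :: real)"
      proof (rule AE_I2)
        fix w
        have "eventually (\<lambda>k. window (?step w (cut (k + n) (state t w))) (1 - int n) (n + m) =
            window (?step w (state t w)) (1 - int n) (n + m)) at_top"
          using eventually_window_cut[of "state t w" "\<lambda>x. fst (noise_row t w x)" "\<lambda>x. snd (noise_row t w x)" "1 - int n" "n + m"]
          by (rule eventually_compose_filterlim[OF _ filterlim_add_const_nat_at_top])
        then show "(\<lambda>k. indicator (?C k) w) \<longlonglongrightarrow> (indicator ?D w :: real)"
          by (intro tendsto_eventually) (auto elim!: eventually_mono simp: state_Suc indicator_def)
      qed
    qed (use C D in auto)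
    then show ?thesis using C D by simp
  qed
  then show ?case using line_law_limit[of t n m zs] unfolding cut_prob by (rule LIMSEQ_unique)
qed

end

section \<open>Local convergence\<close>

lemma topspace_config [simp]: "topspace config_topology = UNIV"
  by (simp add: config_topology_def)

lemma openin_config_iff:
  "openin config_topology S \<longleftrightarrow> (\<forall>eta\<in>S. \<exists>n::nat. \<forall>xi. (\<forall>x. \<bar>x\<bar> \<le> int n \<longrightarrow> xi x = eta x) \<longrightarrow> xi \<in> S)"
proof
  assume "openin config_topology S"
  show "\<forall>eta\<in>S. \<exists>n::nat. \<forall>xi. (\<forall>x. \<bar>x\<bar> \<le> int n \<longrightarrow> xi x = eta x) \<longrightarrow> xi \<in> S"
  proof
    fix eta assume "eta \<in> S"
    with \<open>openin config_topology S\<close> obtain U where U: "finite {i. U i \<noteq> (UNIV :: bool set)}" "eta \<in> PiE UNIV U" "PiE UNIV U \<subseteq> S"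
      unfolding config_topology_def openin_product_topology_alt by (auto simp: PiE_UNIV_domain)
    define n where "n = (\<Sum>i\<in>{i. U i \<noteq> UNIV}. nat \<bar>i\<bar>)"
    have n: "\<bar>i\<bar> \<le> int n" if "U i \<noteq> UNIV" for i
    proof -
      have "nat \<bar>i\<bar> \<le> n" unfolding n_def by (rule member_le_sum) (use U(1) that in auto)
      then show ?thesis by linarith
    qed
    show "\<exists>n::nat. \<forall>xi. (\<forall>x. \<bar>x\<bar> \<le> int n \<longrightarrow> xi x = eta x) \<longrightarrow> xi \<in> S"
    proof (intro exI[of _ n] allI impI)
      fix xi :: config assume xi: "\<forall>x. \<bar>x\<bar> \<le> int n \<longrightarrow> xi x = eta x"
      have "xi i \<in> U i" for i
      proof (cases "U i = UNIV")
        case False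
        then have "xi i = eta i" using xi n by blast
        then show ?thesis using U(2) by (simp add: PiE_iff)
      qed simp
      then show "xi \<in> S" using U(3) by (auto simp: PiE_iff)
    qed
  qed
next
  assume *: "\<forall>eta\<in>S. \<exists>n::nat. \<forall>xi. (\<forall>x. \<bar>x\<bar> \<le> int n \<longrightarrow> xi x = eta x) \<longrightarrow> xi \<in> S"
  show "openin config_topology S"
    unfolding config_topology_def openin_product_topology_alt
  proof (intro conjI ballI)
    fix eta assume "eta \<in> S"
    with * obtain n :: nat where n: "\<And>xi. (\<forall>x. \<bar>x\<bar> \<le> int n \<longrightarrow> xi x = eta x) \<Longrightarrow> xi \<in> S" by blast
    let ?U = "\<lambda>i. if \<bar>i\<bar> \<le> int n then {eta i} else UNIV"
    have "{i. ?U i \<noteq> UNIV} \<subseteq> {- int n..int n}" by auto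
    then have "finite {i. ?U i \<noteq> UNIV}" by (rule finite_subset) simp
    moreover have "PiE UNIV ?U \<subseteq> S"
    proof
      fix xi assume "xi \<in> PiE UNIV ?U"
      then have "\<forall>i. xi i \<in> ?U i" by (simp add: PiE_iff)
      then show "xi \<in> S" by (intro n) (metis singletonD)
    qed
    moreover have "eta \<in> PiE UNIV ?U" by (simp add: PiE_iff)
    ultimately show "\<exists>U. finite {i \<in> UNIV. U i \<noteq> topspace (discrete_topology UNIV)} \<and>
      (\<forall>i\<in>UNIV. openin (discrete_topology UNIV) (U i)) \<and> eta \<in> PiE UNIV U \<and> PiE UNIV U \<subseteq> S"
      by (intro exI[of _ ?U]) auto
  qed
qed

lemma compact_config: "compact_space config_topology"
  unfolding config_topology_def by (simp add: compact_space_product_topology compact_space_discrete_topology)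

text \<open>Uniform continuity by compactness: the cylinders on which \<open>f\<close> varies by
  less than \<open>e / 2\<close> have a finite subcover, and a radius at least as large as all of
  theirs works everywhere.\<close>

lemma continuous_config_local:
  assumes f: "continuous_map config_topology euclideanreal f" and e: "0 < e"
  obtains n :: nat where "\<And>eta xi. (\<And>x. \<bar>x\<bar> \<le> int n \<Longrightarrow> xi x = eta x) \<Longrightarrow> \<bar>f xi - f eta\<bar> < e"
proof -
  have "\<exists>n::nat. \<forall>xi. (\<forall>x. \<bar>x\<bar> \<le> int n \<longrightarrow> xi x = eta x) \<longrightarrow> \<bar>f xi - f eta\<bar> < e / 2" for eta
  proof -
    have "openin config_topology {xi \<in> topspace config_topology. f xi \<in> ball (f eta) (e / 2)}"
      using f by (rule openin_continuous_map_preimage) simp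
    then have "openin config_topology {xi. \<bar>f xi - f eta\<bar> < e / 2}"
      by (simp add: dist_real_def abs_minus_commute)
    moreover have "eta \<in> {xi. \<bar>f xi - f eta\<bar> < e / 2}" using e by simp
    ultimately have "\<exists>n::nat. \<forall>xi. (\<forall>x. \<bar>x\<bar> \<le> int n \<longrightarrow> xi x = eta x) \<longrightarrow> xi \<in> {xi. \<bar>f xi - f eta\<bar> < e / 2}"
      unfolding openin_config_iff by (rule bspec)
    then show ?thesis by (simp only: mem_Collect_eq)
  qed
  then obtain N :: "config \<Rightarrow> nat" where N: "\<And>eta xi. (\<forall>x. \<bar>x\<bar> \<le> int (N eta) \<longrightarrow> xi x = eta x) \<Longrightarrow> \<bar>f xi - f eta\<bar> < e / 2"
    by metis
  define U where "U eta = {xi. \<forall>x. \<bar>x\<bar> \<le> int (N eta) \<longrightarrow> xi x = eta x}" for eta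
  have U: "openin config_topology (U eta)" for eta
    unfolding openin_config_iff U_def by (intro ballI exI[of _ "N eta"]) simp
  have "topspace config_topology \<subseteq> \<Union>(range U)" by (auto simp: U_def)
  then obtain F where F: "finite F" "F \<subseteq> range U" "topspace config_topology \<subseteq> \<Union>F"
    using compact_config U unfolding compact_space_alt by (metis (no_types, lifting) imageE)
  then obtain A where A: "finite A" "F = U ` A" using finite_subset_image[of F U UNIV] by blast
  define n where "n = (\<Sum>eta\<in>A. N eta)"
  have "\<bar>f xi - f eta\<bar> < e" if "\<And>x. \<bar>x\<bar> \<le> int n \<Longrightarrow> xi x = eta x" for eta xi
  proof -
    have "eta \<in> topspace config_topology" by simp
    then obtain z where z: "z \<in> A" "eta \<in> U z" using F(3) A(2) by blast
    have Nn: "N z \<le> n" using member_le_sum[of z A N] z A by (simp add: n_def)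
    have "\<bar>f eta - f z\<bar> < e / 2" using z(2) by (intro N) (simp add: U_def)
    moreover have "\<bar>f xi - f z\<bar> < e / 2"
    proof (rule N, intro allI impI)
      fix x assume x: "\<bar>x\<bar> \<le> int (N z)"
      then have "xi x = eta x" using Nn by (intro that) simp
      also have "\<dots> = z x" using z(2) x by (simp add: U_def)
      finally show "xi x = z x" .
    qed
    ultimately show ?thesis by linarith
  qed
  then show ?thesis by (rule that)
qed

text \<open>A fixed representative of all configurations with a given window; composing with it
  turns a function of configurations into one of finitely many bits.\<close>

definition unwindow :: "nat \<Rightarrow> bool list \<Rightarrow> config" where
  "unwindow n zs x = (\<bar>x\<bar> \<le> int n \<and> zs ! nat (x + int n))"

lemma unwindow_window: "\<bar>x\<bar> \<le> int n \<Longrightarrow> unwindow n (window eta (- int n) (2 * n + 1)) x = eta x"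
proof -
  assume x: "\<bar>x\<bar> \<le> int n"
  then have "nat (x + int n) < 2 * n + 1" by linarith
  then have "window eta (- int n) (2 * n + 1) ! nat (x + int n) = eta (- int n + int (nat (x + int n)))"
    unfolding window_def by (simp del: upt_Suc)
  moreover have "- int n + int (nat (x + int n)) = x" using x by linarith
  ultimately show ?thesis using x by (simp only: unwindow_def simp_thms)
qed

lemma measurable_config_window:
  "sets M = sets config_space \<Longrightarrow> (\<lambda>eta. window eta a n) \<in> M \<rightarrow>\<^sub>M count_space UNIV"
proof -
  assume M: "sets M = sets config_space"
  have "(\<lambda>eta. eta x) \<in> config_space \<rightarrow>\<^sub>M count_space UNIV" for x
    unfolding config_space_def by (rule measurable_component_singleton) simp
  then show ?thesis using M by (intro measurable_window) (simp cong: measurable_cong_sets)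
qed

text \<open>Links the product topology with the product sigma-algebra: \<open>f\<close> is the
  pointwise limit of functions of finite windows.\<close>

lemma continuous_config_measurable:
  assumes f: "continuous_map config_topology euclideanreal f" and M: "sets M = sets config_space"
  shows "f \<in> borel_measurable M"
proof (rule borel_measurable_LIMSEQ_real)
  let ?u = "\<lambda>n eta. f (unwindow n (window eta (- int n) (2 * n + 1)))"
  show "?u n \<in> borel_measurable M" for n
    by (rule measurable_compose[OF measurable_config_window[OF M]]) simp
  show "(\<lambda>n. ?u n eta) \<longlonglongrightarrow> f eta" for eta
  proof (rule LIMSEQ_I)
    fix e :: real assume "0 < e"
    then obtain m where m: "\<And>eta xi. (\<And>x. \<bar>x\<bar> \<le> int m \<Longrightarrow> xi x = eta x) \<Longrightarrow> \<bar>f xi - f eta\<bar> < e"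
      using continuous_config_local[OF f] by metis
    have "\<bar>?u n eta - f eta\<bar> < e" if "m \<le> n" for n
      using that by (intro m unwindow_window) simp
    then show "\<exists>m. \<forall>n\<ge>m. norm (?u n eta - f eta) < e" by auto
  qed
qed

text \<open>Replacing \<open>f\<close> by a function of one window costs at most
  \<open>e / 3\<close> under every measure involved, and the replacement integrates to a finite sum
  of window probabilities.\<close>

lemma weak_conv_configI:
  assumes mu: "\<And>T. prob_space (mu T)" "\<And>T. sets (mu T) = sets config_space"
    and nu: "prob_space nu" "sets nu = sets config_space"
    and lim: "\<And>n zs. length zs = 2 * n + 1 \<Longrightarrow> (\<lambda>T. measure (mu T) {eta. window eta (- int n) (2 * n + 1) = zs})
      \<longlonglongrightarrow> measure nu {eta. window eta (- int n) (2 * n + 1) = zs}"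
  shows "weak_conv_config mu nu"
  unfolding weak_conv_config_def
proof (intro allI impI)
  fix f :: "config \<Rightarrow> real" assume f: "continuous_map config_topology euclideanreal f"
  show "(\<lambda>T. integral\<^sup>L (mu T) f) \<longlonglongrightarrow> integral\<^sup>L nu f"
  proof (rule LIMSEQ_I)
    fix e :: real assume e: "0 < e"
    then obtain n where n: "\<And>eta xi. (\<And>x. \<bar>x\<bar> \<le> int n \<Longrightarrow> xi x = eta x) \<Longrightarrow> \<bar>f xi - f eta\<bar> < e / 3"
      using continuous_config_local[OF f, of "e / 3"] by (metis zero_less_divide_iff zero_less_numeral)
    define Z where "Z = {zs :: bool list. length zs = 2 * n + 1}"
    have Z: "finite Z" using finite_lists_length_eq[of "UNIV :: bool set" "2 * n + 1"] by (simp add: Z_def)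
    define g where "g eta = f (unwindow n (window eta (- int n) (2 * n + 1)))" for eta
    have fg: "\<bar>g eta - f eta\<bar> < e / 3" for eta
      unfolding g_def by (rule n) (rule unwindow_window)
    have g: "g eta = (\<Sum>zs\<in>Z. f (unwindow n zs) * indicator {eta. window eta (- int n) (2 * n + 1) = zs} eta)" for eta
    proof -
      have "window eta (- int n) (2 * n + 1) \<in> Z" by (simp add: Z_def)
      then have "(\<Sum>zs\<in>Z. f (unwindow n zs) * indicator {eta. window eta (- int n) (2 * n + 1) = zs} eta) =
        (\<Sum>zs\<in>{window eta (- int n) (2 * n + 1)}. f (unwindow n zs) * indicator {eta. window eta (- int n) (2 * n + 1) = zs} eta)"
        using Z by (intro sum.mono_neutral_right) auto
      then show ?thesis by (simp add: g_def)
    qed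
    have approx: "\<bar>(\<Sum>zs\<in>Z. f (unwindow n zs) * measure M {eta. window eta (- int n) (2 * n + 1) = zs}) - integral\<^sup>L M f\<bar> \<le> e / 3"
      if M: "prob_space M" "sets M = sets config_space" for M
    proof -
      interpret prob_space M by fact
      have ev: "{eta. window eta (- int n) (2 * n + 1) = zs} \<in> sets M" for zs
      proof -
        have "space M = UNIV" using sets_eq_imp_space_eq[OF M(2)] by (simp add: config_space_def space_PiM)
        then show ?thesis using measurable_sets[OF measurable_config_window[OF M(2)], of "{zs}" "- int n" "2 * n + 1"]
          by (simp add: vimage_def)
      qed
      have g': "g = (\<lambda>eta. \<Sum>zs\<in>Z. f (unwindow n zs) * indicator {eta. window eta (- int n) (2 * n + 1) = zs} eta)"
        by (rule ext) (rule g)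
      have ig: "integrable M g" unfolding g'
        using ev by (intro Bochner_Integration.integrable_sum integrable_mult_right) (simp add: emeasure_eq_measure)
      have igf: "integrable M (\<lambda>eta. g eta - f eta)"
      proof (rule integrable_const_bound[of _ "e / 3"])
        show "(\<lambda>eta. g eta - f eta) \<in> borel_measurable M"
          using continuous_config_measurable[OF f M(2)] ig by measurable
      qed (use fg in \<open>auto simp: less_imp_le\<close>)
      from Bochner_Integration.integrable_diff[OF ig igf] have "integrable M f" by simp
      then have "integral\<^sup>L M g - integral\<^sup>L M f = (\<integral>eta. g eta - f eta \<partial>M)" using ig by simp
      also have "\<bar>\<dots>\<bar> \<le> (\<integral>eta. \<bar>g eta - f eta\<bar> \<partial>M)" by (rule integral_abs_bound)
      also have "\<dots> \<le> (\<integral>eta. e / 3 \<partial>M)" using \<open>integrable M f\<close> ig fg by (intro integral_mono) (auto simp: less_imp_le)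
      also have "\<dots> = e / 3" by (simp add: prob_space)
      finally have "\<bar>integral\<^sup>L M g - integral\<^sup>L M f\<bar> \<le> e / 3" .
      moreover have "integral\<^sup>L M g = (\<Sum>zs\<in>Z. f (unwindow n zs) * measure M {eta. window eta (- int n) (2 * n + 1) = zs})"
        unfolding g' using ev by (subst Bochner_Integration.integral_sum) (auto simp: emeasure_eq_measure)
      ultimately show ?thesis by simp
    qed
    let ?S = "\<lambda>M. \<Sum>zs\<in>Z. f (unwindow n zs) * measure M {eta. window eta (- int n) (2 * n + 1) = zs}"
    have "(\<lambda>T. ?S (mu T)) \<longlonglongrightarrow> ?S nu"
      by (intro tendsto_sum tendsto_mult tendsto_const lim) (simp add: Z_def)
    then obtain T0 where "\<And>T. T \<ge> T0 \<Longrightarrow> \<bar>?S (mu T) - ?S nu\<bar> < e / 3"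
      using LIMSEQ_D[of "\<lambda>T. ?S (mu T)" "?S nu" "e / 3"] e by auto
    moreover have "\<bar>a - b\<bar> < e" if "\<bar>p - q\<bar> < e / 3" "\<bar>p - a\<bar> \<le> e / 3" "\<bar>q - b\<bar> \<le> e / 3" for a b p q
      using that by linarith
    ultimately have "\<bar>integral\<^sup>L (mu T) f - integral\<^sup>L nu f\<bar> < e" if "T \<ge> T0" for T
      using that approx[OF mu, of T] approx[OF nu] by blast
    then show "\<exists>T0. \<forall>T\<ge>T0. norm (integral\<^sup>L (mu T) f - integral\<^sup>L nu f) < e" by auto
  qed
qed

section \<open>Local limit of the shifted process\<close>

lemma window_shift: "window (\<lambda>x. f (x + m)) a n = window f (a + m) n"
  by (simp add: window_def algebra_simps)

lemma strict_mono_int_growth: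
  fixes X :: "nat \<Rightarrow> int"
  assumes "strict_mono X"
  shows "X 0 + int T \<le> X T"
proof (induction T)
  case (Suc T)
  have "X T < X (Suc T)" using assms by (simp add: strict_mono_def)
  with Suc show ?case by simp
qed simp

context shock
begin

lemma measurable_state_config: "state T \<in> world \<rightarrow>\<^sub>M config_space"
  unfolding config_space_def
  by (rule measurable_PiM_single') (auto simp: space_PiM)

lemma sixv_world: "sixv b1 b2 (Upsilon2 \<theta> \<rho>) T = distr world config_space (state T)"
  unfolding sixv_def world_def init_def noise_def state_def by (simp add: case_prod_unfold)

lemma measurable_shift: "(\<lambda>eta x. eta (x + m)) \<in> config_space \<rightarrow>\<^sub>M config_space"
  unfolding config_space_def
  by (rule measurable_PiM_single') (auto simp: space_PiM)

lemma shift_sixv: "shiftM m (sixv b1 b2 (Upsilon2 \<theta> \<rho>) T) = distr world config_space (\<lambda>w x. state T w (x + m))"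
  unfolding shiftM_def sixv_world
  by (subst distr_distr[OF measurable_shift measurable_state_config]) (simp add: o_def)

lemma measurable_shift_state: "(\<lambda>w x. state T w (x + m)) \<in> world \<rightarrow>\<^sub>M config_space"
  by (rule measurable_compose[OF measurable_state_config measurable_shift])

lemma shift_sixv_window:
  "measure (shiftM m (sixv b1 b2 (Upsilon2 \<theta> \<rho>) T)) {eta. window eta a n = zs} =
    measure world {w. window (state T w) (a + m) n = zs}"
proof -
  have "{eta. window eta a n = zs} \<in> sets config_space"
    using measurable_sets[OF measurable_config_window[OF refl], of "{zs}" a n]
    by (simp add: vimage_def config_space_def space_PiM)
  then show ?thesis unfolding shift_sixv
    by (subst measure_distr[OF measurable_shift_state]) (simp_all add: vimage_def window_shift)
qed

lemma state_window_right:
  "measure world {w. window (state T w) (1 + int a) k = zs} = pmf (map_pmf (\<lambda>p. drop a (snd p)) (shock_law T (a + k))) zs"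
proof -
  interpret W: prob_space world by (rule prob_world)
  have "line_law T 0 (a + k) = map_pmf snd (shock_law T (a + k))"
    by (simp add: line_law_def bind_return_pmf bind_return_pmf')
  then have law: "W.prob {w \<in> space world. window (state T w) 1 (a + k) = x} = pmf (map_pmf snd (shock_law T (a + k))) x" for x
    using state_window_prob[of T 0 "a + k" x] by simp
  have "measure world {w. window (state T w) (1 + int a) k = zs} =
    W.prob {w \<in> space world. drop a (window (state T w) 1 (a + k)) = zs}"
    by (simp add: drop_window)
  also have "\<dots> = measure_pmf.prob (map_pmf snd (shock_law T (a + k))) {x. drop a x = zs}"
    by (rule W.law_eq_pmf[OF measurable_window law]) measurable
  also have "\<dots> = pmf (map_pmf (drop a) (map_pmf snd (shock_law T (a + k)))) zs"
    by (simp add: pmf_map vimage_def)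
  finally show ?thesis by (simp add: pmf.map_comp o_def)
qed

theorem local_equilibrium:
  fixes X :: "nat \<Rightarrow> int"
  assumes X: "strict_mono X" and lim: "(\<lambda>T. real_of_int (X T) / real T) \<longlonglongrightarrow> u" and u: "u \<noteq> speed"
  shows "weak_conv_config (\<lambda>T. shiftM (X T) (sixv b1 b2 (Upsilon2 \<theta> \<rho>) T)) (Upsilon (if u < speed then \<theta> else \<rho>))"
proof (rule weak_conv_configI)
  interpret W: prob_space world by (rule prob_world)
  let ?s = "if u < speed then \<theta> else \<rho>"
  show "prob_space (shiftM (X T) (sixv b1 b2 (Upsilon2 \<theta> \<rho>) T))" for T
    unfolding shift_sixv by (rule W.prob_space_distr[OF measurable_shift_state])
  show "sets (shiftM (X T) (sixv b1 b2 (Upsilon2 \<theta> \<rho>) T)) = sets config_space" for T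
    by (simp add: shift_sixv)
  show "prob_space (Upsilon ?s)"
    unfolding Upsilon_def by (rule prob_space_PiM) (rule measure_pmf.prob_space_axioms)
  show "sets (Upsilon ?s) = sets config_space"
    unfolding Upsilon_def config_space_def by (rule sets_PiM_cong) simp_all
  fix n and zs :: "bool list" assume len: "length zs = 2 * n + 1"
  \<comment> \<open>The window around \<open>X T\<close> begins at the site
    \<open>X T - n = 1 + a T\<close>, so it starts after \<open>a T\<close> columns of the
    quadrant.\<close>
  define a where "a T = nat (X T - int n - 1)" for T
  \<comment> \<open>Increasing integers tend to infinity, so eventually the whole window lies to the
    right of the origin, where the quadrant describes the state.\<close>
  have big: "eventually (\<lambda>T. int n + 1 \<le> X T) at_top"
    using eventually_ge_at_top[of "nat (int n + 1 - X 0)"]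
  proof eventually_elim
    case (elim T)
    then show ?case using strict_mono_int_growth[OF X, of T] by linarith
  qed
  have u0: "0 \<le> u"
  proof (rule tendsto_lowerbound[OF lim])
    show "eventually (\<lambda>T. 0 \<le> real_of_int (X T) / real T) at_top"
      using big by eventually_elim simp
  qed simp
  have "((\<lambda>T. real_of_int (X T) / real T - (real n + 1) / real T) \<longlongrightarrow> u - 0) at_top"
    by (intro tendsto_diff lim lim_const_over_n)
  moreover have "eventually (\<lambda>T. real_of_int (X T) / real T - (real n + 1) / real T = real (a T) / real T) at_top"
    using big
  proof eventually_elim
    case (elim T)
    then have "real (a T) = real_of_int (X T) - (real n + 1)" by (simp add: a_def)
    then show ?case by (simp add: diff_divide_distrib)
  qed
  ultimately have "((\<lambda>T. real (a T) / real T) \<longlongrightarrow> u - 0) at_top"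
    by (rule Lim_transform_eventually)
  then have "((\<lambda>T. real (a T) / real T) \<longlongrightarrow> u) at_top" by simp
  from window_limit[OF this u0 u, of "2 * n + 1" zs]
  have wl: "(\<lambda>T. pmf (map_pmf (\<lambda>p. drop (a T) (snd p)) (shock_law T (a T + (2 * n + 1)))) zs)
    \<longlonglongrightarrow> pmf (replicate_pmf (2 * n + 1) (bernoulli_pmf ?s)) zs" .
  have nu: "measure (Upsilon ?s) {eta. window eta (- int n) (2 * n + 1) = zs} = pmf (replicate_pmf (2 * n + 1) (bernoulli_pmf ?s)) zs"
    unfolding Upsilon_def PiM_window_prob[OF len] pmf_replicate using len by simp
  have "eventually (\<lambda>T. pmf (map_pmf (\<lambda>p. drop (a T) (snd p)) (shock_law T (a T + (2 * n + 1)))) zs =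
    measure (shiftM (X T) (sixv b1 b2 (Upsilon2 \<theta> \<rho>) T)) {eta. window eta (- int n) (2 * n + 1) = zs}) at_top"
    using big
  proof eventually_elim
    case (elim T)
    then have "1 + int (a T) = - int n + X T" by (simp add: a_def)
    then show ?case unfolding shift_sixv_window using state_window_right[of T "a T" "2 * n + 1" zs] by simp
  qed
  with wl show "(\<lambda>T. measure (shiftM (X T) (sixv b1 b2 (Upsilon2 \<theta> \<rho>) T)) {eta. window eta (- int n) (2 * n + 1) = zs})
     \<longlonglongrightarrow> measure (Upsilon ?s) {eta. window eta (- int n) (2 * n + 1) = zs}"
    unfolding nu by (rule Lim_transform_eventually)
qed

end

section \<open>The entropy solution\<close>

text \<open>The squared positive part is a cutoff with a continuous first derivative, which is the
  regularity that \<open>test_fn\<close> asks for.\<close>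

definition sqp :: "real \<Rightarrow> real" where "sqp z = (max 0 z)\<^sup>2"

lemma sqp_nonneg [simp]: "0 \<le> sqp z" by (simp add: sqp_def)

lemma sqp_eq_0_iff [simp]: "sqp z = 0 \<longleftrightarrow> z \<le> 0" by (auto simp: sqp_def)

lemma DERIV_sqp [derivative_intros]: "(sqp has_real_derivative 2 * max 0 z) (at z)"
proof -
  consider "z < 0" | "z = 0" | "z > 0" by linarith
  then show ?thesis
  proof cases
    case 1
    have "((\<lambda>_. 0) has_real_derivative 0) (at z)" by simp
    then have "(sqp has_real_derivative 0) (at z)"
      by (rule has_field_derivative_transform_within_open[where S = "{..<0}"]) (use 1 in \<open>auto simp: sqp_def\<close>)
    then show ?thesis using 1 by simp
  next
    case 2
    have "((\<lambda>h. max 0 h) \<longlongrightarrow> max 0 0) (at (0::real))" by (intro tendsto_intros)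
    moreover have "\<forall>\<^sub>F h in at 0. max 0 h = (sqp (0 + h) - sqp 0) / h"
      using eventually_neq_at_within[of 0 0 UNIV]
      by eventually_elim (auto simp: sqp_def power2_eq_square max_def)
    ultimately have "((\<lambda>h. (sqp (0 + h) - sqp 0) / h) \<longlongrightarrow> max 0 0) (at 0)" by (rule Lim_transform_eventually)
    then show ?thesis using 2 by (simp add: DERIV_def)
  next
    case 3
    have "((\<lambda>z. z\<^sup>2) has_real_derivative 2 * z) (at z)" by (auto intro!: derivative_eq_intros)
    then have "(sqp has_real_derivative 2 * z) (at z)"
      by (rule has_field_derivative_transform_within_open[where S = "{0<..}"]) (use 3 in \<open>auto simp: sqp_def\<close>)
    then show ?thesis using 3 by simp
  qed
qed

lemmas DERIV_sqp' [derivative_intros] = DERIV_sqp[THEN DERIV_chain2]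

lemma continuous_sqp [continuous_intros]: "continuous_on S f \<Longrightarrow> continuous_on S (\<lambda>x. sqp (f x))"
  unfolding sqp_def by (intro continuous_intros)

definition tent :: "real \<Rightarrow> real" where "tent z = max 0 (z + 1) - 2 * max 0 z + max 0 (z - 1)"

text \<open>The primitive of \<open>tent\<close>: a continuously differentiable step from 0 to 1.
  Differences of rescaled ramps smooth the indicator of a time interval.\<close>

definition ramp :: "real \<Rightarrow> real" where "ramp z = (sqp (z + 1) - 2 * sqp z + sqp (z - 1)) / 2"

lemma tent_nonneg: "0 \<le> tent z" by (simp add: tent_def max_def)

lemma tent_eq_0: "1 \<le> \<bar>z\<bar> \<Longrightarrow> tent z = 0" by (auto simp: tent_def max_def)

lemma continuous_tent [continuous_intros]: "continuous_on S f \<Longrightarrow> continuous_on S (\<lambda>x. tent (f x))"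
  unfolding tent_def by (intro continuous_intros)

lemma DERIV_ramp: "(ramp has_real_derivative tent z) (at z)"
  unfolding ramp_def[abs_def] tent_def by (auto intro!: derivative_eq_intros)

lemmas DERIV_ramp' [derivative_intros] = DERIV_ramp[THEN DERIV_chain2]

lemma ramp_low: "z \<le> -1 \<Longrightarrow> ramp z = 0" by (simp add: ramp_def sqp_def max_def)

lemma ramp_high: "1 \<le> z \<Longrightarrow> ramp z = 1"
  by (simp add: ramp_def sqp_def max_def power2_eq_square algebra_simps)

lemma ramp_mono: "x \<le> y \<Longrightarrow> ramp x \<le> ramp y"
  by (rule DERIV_nonneg_imp_nondecreasing) (auto intro!: DERIV_ramp tent_nonneg)

lemma integrable_bounded_box:
  fixes f :: "'a::euclidean_space \<Rightarrow> real"
  assumes "f \<in> borel_measurable borel" "\<And>z. \<bar>f z\<bar> \<le> K" "\<And>z. z \<notin> cbox a b \<Longrightarrow> f z = 0"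
  shows "integrable lborel f"
proof (rule Bochner_Integration.integrable_bound)
  show "integrable lborel (\<lambda>z. K * indicator (cbox a b) z)"
    using emeasure_lborel_cbox_finite[of a b] by (intro integrable_mult_right integrable_real_indicator) simp_all
  have "0 \<le> K" using assms(2)[of a] by linarith
  then show "AE z in lborel. norm (f z) \<le> norm (K * indicator (cbox a b) z)"
    using assms(2,3) by (intro AE_I2) (auto simp: indicator_def)
qed (use assms in simp)

text \<open>A smoothed point mass at \<open>y0\<close>: its primitive is the rescaled
  \<open>ramp\<close>, which rises from 0 to 1 across the support.\<close>

lemma integral_tent:
  assumes "0 < e"
  shows "integrable lborel (\<lambda>y. tent ((y - y0) / e) / e)" "(LINT y|lborel. tent ((y - y0) / e) / e) = 1"
proof -
  have cont: "continuous_on UNIV (\<lambda>y. tent ((y - y0) / e) / e)"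
    using assms by (intro continuous_intros) auto
  have zero: "tent ((y - y0) / e) / e = 0" if "y \<notin> {y0 - e..y0 + e}" for y
  proof -
    have "1 \<le> \<bar>(y - y0) / e\<bar>" using that assms by (auto simp: field_simps abs_if)
    then show ?thesis by (simp add: tent_eq_0)
  qed
  have "tent z \<le> 1" for z by (auto simp: tent_def max_def)
  then have bd: "\<bar>tent ((y - y0) / e) / e\<bar> \<le> 1 / e" for y using assms tent_nonneg by (simp add: field_simps)
  show "integrable lborel (\<lambda>y. tent ((y - y0) / e) / e)"
    by (rule integrable_bounded_box[OF borel_measurable_continuous_onI[OF cont] bd, of "y0 - e" "y0 + e"]) (auto simp: zero)
  have "(LINT y|lborel. tent ((y - y0) / e) / e) = (LINT y|lborel. tent ((y - y0) / e) / e * indicator {y0 - e..y0 + e} y)"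
    by (intro Bochner_Integration.integral_cong refl) (use zero in \<open>auto simp: indicator_def\<close>)
  also have "\<dots> = ramp ((y0 + e - y0) / e) - ramp ((y0 - e - y0) / e)"
  proof (rule integral_FTC_Icc_real[where F = "\<lambda>y. ramp ((y - y0) / e)"])
    fix y
    show "((\<lambda>y. ramp ((y - y0) / e)) has_real_derivative tent ((y - y0) / e) / e) (at y)"
      using assms by (auto intro!: derivative_eq_intros)
    show "isCont (\<lambda>y. tent ((y - y0) / e) / e) y" using cont by (simp add: continuous_on_eq_continuous_at)
  qed (use assms in simp)
  also have "\<dots> = 1" using assms by (simp add: ramp_low ramp_high)
  finally show "(LINT y|lborel. tent ((y - y0) / e) / e) = 1" .
qed

text \<open>Outside the box, \<open>psi\<close> vanishes on an open set around the point in each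
  variable separately, so both derivatives vanish there. Compactness of the box bounds them.\<close>

lemma test_fn_derivatives:
  assumes "test_fn psi psix psiy"
  obtains a b c d K where "\<And>x y. x \<notin> {a..b} \<or> y \<notin> {c..d} \<Longrightarrow> psix x y = 0 \<and> psiy x y = 0"
    "\<And>x y. x \<notin> {a..b} \<or> y \<notin> {c..d} \<Longrightarrow> psi x y = 0"
    "\<And>x y. \<bar>psix x y\<bar> \<le> K \<and> \<bar>psiy x y\<bar> \<le> K"
proof -
  from assms obtain a b c d where supp: "\<And>x y. psi x y \<noteq> 0 \<Longrightarrow> a \<le> x \<and> x \<le> b \<and> c \<le> y \<and> y \<le> d"
    unfolding test_fn_def by blast
  have dx: "((\<lambda>x'. psi x' y) has_real_derivative psix x y) (at x)"
    and dy: "((\<lambda>y'. psi x y') has_real_derivative psiy x y) (at y)" for x y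
    using assms unfolding test_fn_def by blast+
  have zero: "psi x y = 0" if "x \<notin> {a..b} \<or> y \<notin> {c..d}" for x y using supp that by fastforce
  have zx: "psix x y = 0" if "x \<notin> {a..b} \<or> y \<notin> {c..d}" for x y
  proof -
    define S where "S = (if y \<in> {c..d} then - {a..b} else UNIV)"
    have "open S" "x \<in> S" using that by (auto simp: S_def)
    have "((\<lambda>_. 0) has_real_derivative 0) (at x)" by simp
    then have "((\<lambda>x'. psi x' y) has_real_derivative 0) (at x)"
    proof (rule has_field_derivative_transform_within_open[OF _ \<open>open S\<close> \<open>x \<in> S\<close>])
      fix x' assume "x' \<in> S"
      then have "x' \<notin> {a..b} \<or> y \<notin> {c..d}" by (auto simp: S_def split: if_splits)
      then show "0 = psi x' y" by (rule zero[symmetric])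
    qed
    then show ?thesis using dx DERIV_unique by blast
  qed
  have zy: "psiy x y = 0" if "x \<notin> {a..b} \<or> y \<notin> {c..d}" for x y
  proof -
    define S where "S = (if x \<in> {a..b} then - {c..d} else UNIV)"
    have "open S" "y \<in> S" using that by (auto simp: S_def)
    have "((\<lambda>_. 0) has_real_derivative 0) (at y)" by simp
    then have "((\<lambda>y'. psi x y') has_real_derivative 0) (at y)"
    proof (rule has_field_derivative_transform_within_open[OF _ \<open>open S\<close> \<open>y \<in> S\<close>])
      fix y' assume "y' \<in> S"
      then have "x \<notin> {a..b} \<or> y' \<notin> {c..d}" by (auto simp: S_def split: if_splits)
      then show "0 = psi x y'" by (rule zero[symmetric])
    qed
    then show ?thesis using dy DERIV_unique by blast
  qed
  have bounded: "\<exists>K. \<forall>z. \<bar>g z\<bar> \<le> K" if g: "continuous_on UNIV (g :: real \<times> real \<Rightarrow> real)"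
    "\<And>x y. x \<notin> {a..b} \<or> y \<notin> {c..d} \<Longrightarrow> g (x, y) = 0" for g
  proof -
    have "compact (g ` cbox (a, c) (b, d))"
      by (rule compact_continuous_image[OF continuous_on_subset[OF g(1)]]) auto
    then obtain K where K: "\<And>z. z \<in> cbox (a, c) (b, d) \<Longrightarrow> \<bar>g z\<bar> \<le> K"
      using compact_imp_bounded bounded_iff by (metis image_eqI real_norm_def)
    have "\<bar>g z\<bar> \<le> max K 0" for z
    proof (cases "z \<in> cbox (a, c) (b, d)")
      case False
      then have "g z = 0" using g(2)[of "fst z" "snd z"] by (cases z) (auto simp: cbox_Pair_eq)
      then show ?thesis by simp
    qed (use K in \<open>fastforce simp: le_max_iff_disj\<close>)
    then show ?thesis by blast
  qed
  have "\<exists>K. \<forall>z. \<bar>psix (fst z) (snd z)\<bar> \<le> K" "\<exists>K. \<forall>z. \<bar>psiy (fst z) (snd z)\<bar> \<le> K"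
    using assms zx zy by (intro bounded; simp add: test_fn_def)+
  then obtain K1 K2 where K: "\<And>x y. \<bar>psix x y\<bar> \<le> K1" "\<And>x y. \<bar>psiy x y\<bar> \<le> K2" by (metis fst_conv snd_conv)
  have "\<bar>psix x y\<bar> \<le> max K1 K2 \<and> \<bar>psiy x y\<bar> \<le> max K1 K2" for x y
    using K[of x y] by (simp add: le_max_iff_disj)
  with zx zy zero show ?thesis by (intro that[of a b c d "max K1 K2"]) auto
qed

lemma test_fn_integrable:
  assumes t: "test_fn psi psix psiy" and P: "P \<in> borel_measurable borel" "\<And>z :: real \<times> real. \<bar>P z\<bar> \<le> M"
  shows "integrable lborel (\<lambda>z. P z * psix (fst z) (snd z))" "integrable lborel (\<lambda>z. P z * psiy (fst z) (snd z))"
proof -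
  obtain a b c d K where zero: "\<And>x y. x \<notin> {a..b} \<or> y \<notin> {c..d} \<Longrightarrow> psix x y = 0 \<and> psiy x y = 0"
    and K: "\<And>x y. \<bar>psix x y\<bar> \<le> K \<and> \<bar>psiy x y\<bar> \<le> K"
    using test_fn_derivatives[OF t] by metis
  have M0: "0 \<le> M" using P(2)[of 0] by linarith
  have g: "integrable lborel (\<lambda>z. P z * g (fst z) (snd z))"
    if "continuous_on UNIV (\<lambda>z. g (fst z) (snd z) :: real)" "\<And>x y. x \<notin> {a..b} \<or> y \<notin> {c..d} \<Longrightarrow> g x y = 0" "\<And>x y. \<bar>g x y\<bar> \<le> K" for g
  proof (rule integrable_bounded_box[where K = "M * K" and a = "(a, c)" and b = "(b, d)"])
    show "(\<lambda>z. P z * g (fst z) (snd z)) \<in> borel_measurable borel"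
      using P(1) borel_measurable_continuous_onI[OF that(1)] by (rule borel_measurable_times)
    show "\<bar>P z * g (fst z) (snd z)\<bar> \<le> M * K" for z
      unfolding abs_mult using P(2) that(3) M0 by (intro mult_mono) auto
    show "P z * g (fst z) (snd z) = 0" if "z \<notin> cbox (a, c) (b, d)" for z
      using that \<open>\<And>x y. x \<notin> {a..b} \<or> y \<notin> {c..d} \<Longrightarrow> g x y = 0\<close>[of "fst z" "snd z"]
      by (cases z) (auto simp: cbox_Pair_eq)
  qed
  show "integrable lborel (\<lambda>z. P z * psix (fst z) (snd z))" "integrable lborel (\<lambda>z. P z * psiy (fst z) (snd z))"
    using t zero K by (intro g; simp add: test_fn_def)+
qed

text \<open>Integrate first in the variable of differentiation, where the compact support makes the
  integral vanish. This permits adding constants to density and flux in the weak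
  inequalities.\<close>

lemma test_fn_integral_0:
  assumes t: "test_fn psi psix psiy"
  shows "(LINT z|lborel. psix (fst z) (snd z)) = 0" "(LINT z|lborel. psiy (fst z) (snd z)) = 0"
proof -
  obtain a b c d K where zero: "\<And>x y. x \<notin> {a..b} \<or> y \<notin> {c..d} \<Longrightarrow> psix x y = 0 \<and> psiy x y = 0"
    and zero': "\<And>x y. x \<notin> {a..b} \<or> y \<notin> {c..d} \<Longrightarrow> psi x y = 0"
    and "\<And>x y. \<bar>psix x y\<bar> \<le> K \<and> \<bar>psiy x y\<bar> \<le> K"
    using test_fn_derivatives[OF t] by metis
  note int = test_fn_integrable[OF t, of "\<lambda>_. 1" 1, simplified]
  have cx: "continuous_on UNIV (\<lambda>z. psix (fst z) (snd z))" and cy: "continuous_on UNIV (\<lambda>z. psiy (fst z) (snd z))"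
    using t by (auto simp: test_fn_def)
  have one: "(LINT s|lborel. g' s) = 0"
    if g: "\<And>s. (g has_real_derivative g' s) (at s)" "continuous_on UNIV g'"
      "\<And>s. s \<notin> {p..q} \<Longrightarrow> g s = 0 \<and> g' s = 0" for g g' :: "real \<Rightarrow> real" and p q
  proof -
    have "g' s = g' s * indicator {p - 1..max p q + 1} s" for s
      using g(3)[of s] by (cases "s \<in> {p..q}") (auto simp: indicator_def)
    then have "(LINT s|lborel. g' s) = (LINT s|lborel. g' s * indicator {p - 1..max p q + 1} s)"
      by (intro Bochner_Integration.integral_cong refl)
    also have "\<dots> = g (max p q + 1) - g (p - 1)"
      using g(1,2) by (intro integral_FTC_Icc_real) (auto simp: continuous_on_eq_continuous_at)
    also have "\<dots> = 0"
    proof -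
      have "max p q + 1 \<notin> {p..q}" "p - 1 \<notin> {p..q}" by (auto simp: max_def)
      from g(3)[OF this(1)] g(3)[OF this(2)] show ?thesis by simp
    qed
    finally show ?thesis .
  qed
  have "(LINT z|lborel. psix (fst z) (snd z)) = (LINT y|lborel. LINT x|lborel. psix x y)"
    using lborel_pair.integral_snd[of psix] int(1) by (simp add: lborel_prod case_prod_unfold)
  also have "\<dots> = (LINT y|(lborel :: real measure). 0)"
  proof (intro Bochner_Integration.integral_cong refl)
    fix y
    show "(LINT x|lborel. psix x y) = 0"
    proof (rule one[of "\<lambda>x. psi x y" _ a b])
      show "continuous_on UNIV (\<lambda>x. psix x y)"
        using continuous_on_compose2[OF cx, of UNIV "\<lambda>x. (x, y)"] by (simp add: continuous_on_Pair)
    qed (use t zero zero' in \<open>auto simp: test_fn_def\<close>)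
  qed
  finally show "(LINT z|lborel. psix (fst z) (snd z)) = 0" by simp
  have "(LINT z|lborel. psiy (fst z) (snd z)) = (LINT x|lborel. LINT y|lborel. psiy x y)"
    using lborel_pair.integral_fst[of psiy] int(2) by (simp add: lborel_prod case_prod_unfold)
  also have "\<dots> = (LINT x|(lborel :: real measure). 0)"
  proof (intro Bochner_Integration.integral_cong refl)
    fix x
    show "(LINT y|lborel. psiy x y) = 0"
    proof (rule one[of "\<lambda>y. psi x y" _ c d])
      show "continuous_on UNIV (\<lambda>y. psiy x y)"
        using continuous_on_compose2[OF cy, of UNIV "\<lambda>y. (x, y)"] by (simp add: continuous_on_Pair)
    qed (use t zero zero' in \<open>auto simp: test_fn_def\<close>)
  qed
  finally show "(LINT z|lborel. psiy (fst z) (snd z)) = 0" by simp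
qed

section \<open>Transport of weighted mass\<close>

lemma sqp_mono: "x \<le> y \<Longrightarrow> sqp x \<le> sqp y"
  by (auto simp: sqp_def intro!: power_mono)

lemma tent_le_1: "tent z \<le> 1" by (auto simp: tent_def max_def)

lemma tent_support: "tent ((y - y0) / e) \<noteq> 0 \<Longrightarrow> 0 < e \<Longrightarrow> \<bar>y - y0\<bar> < e"
  using tent_eq_0[of "(y - y0) / e"] by (force simp: field_simps not_le[symmetric])

text \<open>The weight \<open>sqp (x - c y - a) * sqp (b + d y - x)\<close> is supported in a region whose left boundary
  moves with speed \<open>c\<close> and whose right boundary moves with speed \<open>d\<close>; the condition
  \<open>d P \<le> F \<le> c P\<close> says that nothing enters it.\<close>

locale transport =
  fixes P F :: "real \<Rightarrow> real \<Rightarrow> real" and C a b c d :: real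
  assumes Pm: "(\<lambda>z. P (fst z) (snd z)) \<in> borel_measurable borel" and Pb: "\<And>x y. \<bar>P x y\<bar> \<le> 1"
    and Fm: "(\<lambda>z. F (fst z) (snd z)) \<in> borel_measurable borel" and Fb: "\<And>x y. \<bar>F x y\<bar> \<le> C"
    and weak: "\<And>psi psix psiy. test_fn psi psix psiy \<Longrightarrow>
      0 \<le> (LINT z|lborel. P (fst z) (snd z) * psiy (fst z) (snd z) + F (fst z) (snd z) * psix (fst z) (snd z))"
    and ae: "AE z in lborel. 0 < snd z \<and> snd z < 1 \<longrightarrow>
      d * P (fst z) (snd z) \<le> F (fst z) (snd z) \<and> F (fst z) (snd z) \<le> c * P (fst z) (snd z)"
    and cont: "\<And>R y0. y0 \<in> {0..1} \<Longrightarrow>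
      ((\<lambda>y. LINT x|lborel. indicator {-R..R} x * \<bar>P x y - P x y0\<bar>) \<longlongrightarrow> 0) (at y0 within {0..1})"
    and cd: "0 \<le> c" "0 \<le> d"
begin

definition weight :: "real \<Rightarrow> real \<Rightarrow> real" where "weight x y = sqp (x - c * y - a) * sqp (b + d * y - x)"
definition weight_bound :: real where "weight_bound = sqp (b + d - a) * sqp (b + d - a)"
definition mass :: "real \<Rightarrow> real" where "mass y = (LINT x|lborel. P x y * weight x y)"

lemma weight_nonneg: "0 \<le> weight x y" by (simp add: weight_def)
lemma weight_support: assumes that: "weight x y \<noteq> 0" "y \<in> {0..1}" shows "x \<in> {a..b + d}"
proof -
  have "x - c * y - a > 0" "b + d * y - x > 0" using that(1) by (auto simp: weight_def not_le[symmetric])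
  moreover have "0 \<le> c * y" "d * y \<le> d" using cd that(2) by (auto intro: mult_left_le)
  ultimately show ?thesis by simp
qed
lemma weight_bound_nonneg: "0 \<le> weight_bound" by (simp add: weight_bound_def)
lemma weight_le: assumes that: "y \<in> {0..1}" shows "weight x y \<le> weight_bound"
proof (cases "weight x y = 0")
  case False
  have "0 \<le> c * y" "d * y \<le> d" using cd that by (auto intro: mult_left_le)
  then show ?thesis using weight_support[OF False that] unfolding weight_def weight_bound_def by (intro mult_mono sqp_mono) auto
qed (simp add: weight_bound_nonneg)
lemma continuous_weight: "continuous_on UNIV (\<lambda>z. weight (fst z) (snd z))"
  unfolding weight_def by (intro continuous_intros)
lemma continuous_weight_space: "continuous_on UNIV (\<lambda>x. weight x y)" unfolding weight_def by (intro continuous_intros)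
lemma continuous_weight_time: "continuous_on UNIV (\<lambda>y. weight x y)" unfolding weight_def by (intro continuous_intros)
lemma P_measurable_space [measurable]: "(\<lambda>x. P x y) \<in> borel_measurable borel"
  using measurable_compose[OF _ Pm, of "\<lambda>x. (x, y)" borel] by simp
lemma weight_measurable [measurable]: "(\<lambda>x. weight x y) \<in> borel_measurable borel"
  using continuous_weight_space by (rule borel_measurable_continuous_onI)
lemma integrable_weighted: assumes y: "y \<in> {0..1}" shows "integrable lborel (\<lambda>x. P x y' * weight x y)"
proof (rule integrable_bounded_box[where K = weight_bound and a = a and b = "b + d"])
  show "\<bar>P x y' * weight x y\<bar> \<le> weight_bound" for x
    using mult_mono[OF Pb[of x y'] weight_le[OF y, of x]] weight_nonneg[of x y] by (simp add: abs_mult)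
  show "P x y' * weight x y = 0" if "x \<notin> cbox a (b + d)" for x
    using weight_support[of x y] that y by auto
qed simp

text \<open>The change of \<open>mass\<close> splits into a change of \<open>P\<close>, controlled
  by continuity in time with values in local L1, and a change of the weight, controlled by dominated
  convergence.\<close>

lemma continuous_mass: "continuous_on {0..1} mass"
proof (subst continuous_on_sequentially, intro allI ballI impI)
  fix ys :: "nat \<Rightarrow> real" and y0 assume y0: "y0 \<in> {0..1}" and ys: "(\<forall>n. ys n \<in> {0..1}) \<and> ys \<longlonglongrightarrow> y0"
  define R where "R = max \<bar>a\<bar> \<bar>b + d\<bar>"
  define h where "h y = (LINT x|lborel. indicator {-R..R} x * \<bar>P x y - P x y0\<bar>)" for y
  have "continuous (at y0 within {0..1}) h"
    unfolding continuous_within h_def using cont[OF y0, of R] by simp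
  then have "(h \<circ> ys) \<longlonglongrightarrow> h y0" using ys unfolding continuous_within_sequentially by blast
  then have "(\<lambda>n. weight_bound * h (ys n)) \<longlonglongrightarrow> weight_bound * h y0" by (intro tendsto_mult tendsto_const) (simp add: o_def)
  then have lim0: "(\<lambda>n. weight_bound * h (ys n)) \<longlonglongrightarrow> 0" by (simp add: h_def)
  have A: "(\<lambda>n. mass (ys n) - (LINT x|lborel. P x y0 * weight x (ys n))) \<longlonglongrightarrow> 0"
  proof (rule Lim_null_comparison[OF always_eventually[OF allI] lim0])
    fix n
    have yn: "ys n \<in> {0..1}" using ys by blast
    have i1: "integrable lborel (\<lambda>x. \<bar>P x (ys n) * weight x (ys n) - P x y0 * weight x (ys n)\<bar>)"
      by (intro integrable_abs Bochner_Integration.integrable_diff integrable_weighted yn)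
    have i2: "integrable lborel (\<lambda>x. weight_bound * (indicator {-R..R} x * \<bar>P x (ys n) - P x y0\<bar>))"
    proof (rule integrable_bounded_box[where K = "weight_bound * 2" and a = "-R" and b = R])
      have "\<bar>P x (ys n) - P x y0\<bar> \<le> 2" for x using Pb[of x "ys n"] Pb[of x y0] by linarith
      then show "\<bar>weight_bound * (indicator {-R..R} x * \<bar>P x (ys n) - P x y0\<bar>)\<bar> \<le> weight_bound * 2" for x
        using weight_bound_nonneg by (auto simp: abs_mult indicator_def intro!: mult_left_mono)
    qed (auto simp: indicator_def)
    have "\<bar>mass (ys n) - (LINT x|lborel. P x y0 * weight x (ys n))\<bar> =
      \<bar>LINT x|lborel. P x (ys n) * weight x (ys n) - P x y0 * weight x (ys n)\<bar>"
      unfolding mass_def using integrable_weighted[OF yn] by simp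
    also have "\<dots> \<le> (LINT x|lborel. \<bar>P x (ys n) * weight x (ys n) - P x y0 * weight x (ys n)\<bar>)"
      by (rule integral_abs_bound)
    also have "\<dots> \<le> (LINT x|lborel. weight_bound * (indicator {-R..R} x * \<bar>P x (ys n) - P x y0\<bar>))"
    proof (rule integral_mono[OF i1 i2])
      fix x
      have "\<bar>P x (ys n) * weight x (ys n) - P x y0 * weight x (ys n)\<bar> = weight x (ys n) * \<bar>P x (ys n) - P x y0\<bar>"
        unfolding left_diff_distrib[symmetric] abs_mult using weight_nonneg[of x "ys n"] by simp
      also have "\<dots> \<le> weight_bound * (indicator {-R..R} x * \<bar>P x (ys n) - P x y0\<bar>)"
      proof (cases "weight x (ys n) = 0")
        case False
        then have "x \<in> {-R..R}" using weight_support[OF False yn] by (auto simp: R_def)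
        then show ?thesis using weight_le[OF yn, of x] by (simp add: mult_right_mono)
      qed (use weight_bound_nonneg in simp)
      finally show "\<bar>P x (ys n) * weight x (ys n) - P x y0 * weight x (ys n)\<bar> \<le> weight_bound * (indicator {-R..R} x * \<bar>P x (ys n) - P x y0\<bar>)" .
    qed
    finally show "norm (mass (ys n) - (LINT x|lborel. P x y0 * weight x (ys n))) \<le> weight_bound * h (ys n)"
      by (simp add: h_def)
  qed
  have B: "(\<lambda>n. LINT x|lborel. P x y0 * weight x (ys n)) \<longlonglongrightarrow> (LINT x|lborel. P x y0 * weight x y0)"
  proof (rule integral_dominated_convergence[where w = "\<lambda>x. weight_bound * indicator {a..b + d} x"])
    show "integrable lborel (\<lambda>x. weight_bound * indicator {a..b + d} x)"
      by (rule integrable_bounded_box[where K = weight_bound and a = a and b = "b + d"]) (auto simp: indicator_def weight_bound_nonneg)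
    show "AE x in lborel. (\<lambda>n. P x y0 * weight x (ys n)) \<longlonglongrightarrow> P x y0 * weight x y0"
    proof (rule AE_I2)
      fix x
      have "(\<lambda>n. weight x (ys n)) \<longlonglongrightarrow> weight x y0"
        using continuous_on_tendsto_compose[OF continuous_weight_time conjunct2[OF ys]] by simp
      then show "(\<lambda>n. P x y0 * weight x (ys n)) \<longlonglongrightarrow> P x y0 * weight x y0" by (intro tendsto_mult tendsto_const)
    qed
    show "AE x in lborel. norm (P x y0 * weight x (ys n)) \<le> weight_bound * indicator {a..b + d} x" for n
    proof (rule AE_I2)
      fix x
      have yn: "ys n \<in> {0..1}" using ys by blast
      show "norm (P x y0 * weight x (ys n)) \<le> weight_bound * indicator {a..b + d} x"
      proof (cases "weight x (ys n) = 0")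
        case False
        then have "x \<in> {a..b + d}" using weight_support[OF False yn] by simp
        then show ?thesis using mult_mono[OF Pb[of x y0] weight_le[OF yn, of x]] weight_nonneg[of x "ys n"] by (simp add: abs_mult)
      qed (use weight_bound_nonneg in simp)
    qed
  qed simp_all
  from tendsto_add[OF A B] show "(mass \<circ> ys) \<longlonglongrightarrow> mass y0" by (simp add: o_def mass_def)
qed

text \<open>Test with the weight times a smoothed indicator \<open>chi\<close> of the time interval.
  The derivatives of the weight contribute a nonpositive term, and the time derivative of
  \<open>chi\<close> compares averages of \<open>mass\<close> near \<open>y1\<close> and
  \<open>y2\<close>; an increase would make the whole integral negative.\<close>

lemma mass_decreasing: assumes y12: "0 < y1" "y1 < y2" "y2 < 1" shows "mass y2 \<le> mass y1"
proof (rule ccontr)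
  assume "\<not> mass y2 \<le> mass y1"
  then obtain C1 C2 where C: "mass y1 < C1" "C1 < C2" "C2 < mass y2" by (meson dense not_le)
  have ic: "isCont mass y1" "isCont mass y2"
    using y12 continuous_on_interior[OF continuous_mass] by auto
  obtain e1 where e1: "e1 > 0" "\<And>y. dist y y1 < e1 \<Longrightarrow> mass y < C1"
    using order_tendstoD(2)[OF ic(1)[unfolded isCont_def] C(1)] C(1) unfolding eventually_at by (metis UNIV_I dist_self)
  obtain e2 where e2: "e2 > 0" "\<And>y. dist y y2 < e2 \<Longrightarrow> C2 < mass y"
    using order_tendstoD(1)[OF ic(2)[unfolded isCont_def] C(3)] C(3) unfolding eventually_at by (metis UNIV_I dist_self)
  \<comment> \<open>Small enough that \<open>mass\<close> stays below \<open>C1\<close> or above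
    \<open>C2\<close> on the respective tents, and that \<open>chi\<close> is supported inside the
    open unit interval.\<close>
  define e where "e = min (min e1 e2) (min y1 (1 - y2)) / 2"
  have e: "e > 0" "e < e1" "e < e2" "e < y1" "e < 1 - y2" using e1 e2 y12 by (auto simp: e_def)
  define t1 where "t1 y = tent ((y - y1) / e) / e" for y
  define t2 where "t2 y = tent ((y - y2) / e) / e" for y
  define chi where "chi y = ramp ((y - y1) / e) - ramp ((y - y2) / e)" for y
  have t0: "0 \<le> t1 y" "0 \<le> t2 y" for y using e by (auto simp: t1_def t2_def tent_nonneg)
  have t_supp: "t1 y \<noteq> 0 \<Longrightarrow> \<bar>y - y1\<bar> < e" "t2 y \<noteq> 0 \<Longrightarrow> \<bar>y - y2\<bar> < e" for y
    using tent_support[of y y1 e] tent_support[of y y2 e] e by (auto simp: t1_def t2_def)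
  have t_le: "t1 y \<le> 1 / e" "t2 y \<le> 1 / e" for y
    using e tent_le_1 by (auto simp: t1_def t2_def intro!: divide_right_mono)
  have tcont: "continuous_on UNIV t1" "continuous_on UNIV t2"
    unfolding t1_def[abs_def] t2_def[abs_def] using e by (auto intro!: continuous_intros)
  have chi0: "0 \<le> chi y" for y
    unfolding chi_def using e y12 by (auto intro!: ramp_mono divide_right_mono)
  have chi_supp: "y1 - e \<le> y \<and> y \<le> y2 + e" if "chi y \<noteq> 0" for y
  proof (rule ccontr)
    assume "\<not> ?thesis"
    then consider "y < y1 - e" | "y > y2 + e" by linarith
    then have "chi y = 0"
    proof cases
      case 1
      then have "(y - y1) / e \<le> -1" "(y - y2) / e \<le> -1" using e y12 by (auto simp: field_simps)
      then show ?thesis by (simp add: chi_def ramp_low)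
    next
      case 2
      then have "1 \<le> (y - y1) / e" "1 \<le> (y - y2) / e" using e y12 by (auto simp: field_simps)
      then show ?thesis by (simp add: chi_def ramp_high)
    qed
    with that show False by simp
  qed
  have dchi: "(chi has_real_derivative t1 y - t2 y) (at y)" for y
    unfolding chi_def[abs_def] t1_def t2_def using e by (auto intro!: derivative_eq_intros)
  define psi where "psi x y = weight x y * chi y" for x y
  define wx where "wx x y = 2 * max 0 (x - c * y - a) * sqp (b + d * y - x) - sqp (x - c * y - a) * (2 * max 0 (b + d * y - x))" for x y
  define wy where "wy x y = sqp (x - c * y - a) * (d * (2 * max 0 (b + d * y - x))) - c * (2 * max 0 (x - c * y - a)) * sqp (b + d * y - x)" for x y
  define psix where "psix x y = wx x y * chi y" for x y
  define psiy where "psiy x y = wy x y * chi y + weight x y * (t1 y - t2 y)" for x y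
  have sc: "continuous_on UNIV (snd :: real \<times> real \<Rightarrow> real)" by (intro continuous_intros)
  have chicont: "continuous_on UNIV chi" using dchi by (meson DERIV_isCont continuous_at_imp_continuous_on)
  have test: "test_fn psi psix psiy"
    unfolding test_fn_def
  proof (intro conjI allI)
    fix x y
    have "((\<lambda>x'. weight x' y) has_real_derivative wx x y) (at x)"
      unfolding weight_def wx_def by (auto intro!: derivative_eq_intros)
    then show "((\<lambda>x'. psi x' y) has_real_derivative psix x y) (at x)"
      unfolding psi_def psix_def by (rule DERIV_cmult_right)
    have "((\<lambda>y'. weight x y') has_real_derivative wy x y) (at y)"
      unfolding weight_def wy_def by (auto intro!: derivative_eq_intros)
    from DERIV_mult[OF this dchi] show "((\<lambda>y'. psi x y') has_real_derivative psiy x y) (at y)"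
      unfolding psi_def psiy_def by (simp add: algebra_simps)
    show "0 \<le> psi x y" using weight_nonneg chi0 by (simp add: psi_def)
  next
    have 1: "continuous_on UNIV (\<lambda>z :: real \<times> real. chi (snd z))" "continuous_on UNIV (\<lambda>z :: real \<times> real. t1 (snd z))"
      "continuous_on UNIV (\<lambda>z :: real \<times> real. t2 (snd z))"
      using continuous_on_compose2[OF chicont sc] continuous_on_compose2[OF tcont(1) sc]
        continuous_on_compose2[OF tcont(2) sc] by auto
    show "continuous_on UNIV (\<lambda>z. psix (fst z) (snd z))"
      unfolding psix_def wx_def by (intro continuous_intros 1)
    show "continuous_on UNIV (\<lambda>z. psiy (fst z) (snd z))"
      unfolding psiy_def wy_def by (intro continuous_intros 1 continuous_weight)
    show "\<exists>a b c d. 0 < c \<and> d < 1 \<and> (\<forall>x y. psi x y \<noteq> 0 \<longrightarrow> a \<le> x \<and> x \<le> b \<and> c \<le> y \<and> y \<le> d)"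
    proof (rule exI[of _ a], rule exI[of _ "b + d"], rule exI[of _ "y1 - e"], rule exI[of _ "y2 + e"], intro conjI allI impI)
      fix x y assume "psi x y \<noteq> 0"
      then have "weight x y \<noteq> 0" "chi y \<noteq> 0" by (auto simp: psi_def)
      moreover from this have "y1 - e \<le> y" "y \<le> y2 + e" using chi_supp by auto
      moreover from this have "y \<in> {0..1}" using e by simp
      ultimately show "a \<le> x" "x \<le> b + d" "y1 - e \<le> y" "y \<le> y2 + e" using weight_support[of x y] by auto
    qed (use e in auto)
  qed
  have i1: "integrable lborel (\<lambda>z. P (fst z) (snd z) * psiy (fst z) (snd z) + F (fst z) (snd z) * psix (fst z) (snd z))"
    using test_fn_integrable(2)[OF test Pm Pb] test_fn_integrable(1)[OF test Fm Fb] by (rule Bochner_Integration.integrable_add)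
  define g where "g x y = P x y * weight x y * (t1 y - t2 y)" for x y
  have i2: "integrable lborel (\<lambda>z. g (fst z) (snd z))"
  proof (rule integrable_bounded_box[where K = "weight_bound * (1 / e)" and a = "(a, 0)" and b = "(b + d, 1)"])
    have "continuous_on UNIV (\<lambda>z :: real \<times> real. t1 (snd z) - t2 (snd z))"
      by (intro continuous_on_diff continuous_on_compose2[OF tcont(1) sc] continuous_on_compose2[OF tcont(2) sc]) auto
    then show "(\<lambda>z. g (fst z) (snd z)) \<in> borel_measurable borel"
      unfolding g_def
      by (intro borel_measurable_times[OF borel_measurable_times[OF Pm borel_measurable_continuous_onI[OF continuous_weight]]]
          borel_measurable_continuous_onI)
    have yin: "y \<in> {0..1}" if "t1 y - t2 y \<noteq> 0" for y
    proof -
      have "t1 y \<noteq> 0 \<or> t2 y \<noteq> 0" using that by auto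
      then have "\<bar>y - y1\<bar> < e \<or> \<bar>y - y2\<bar> < e" using t_supp by blast
      then show ?thesis using e y12 by auto
    qed
    show "\<bar>g (fst z) (snd z)\<bar> \<le> weight_bound * (1 / e)" for z
    proof (cases "t1 (snd z) - t2 (snd z) = 0")
      case False
      have "\<bar>P (fst z) (snd z) * weight (fst z) (snd z)\<bar> \<le> weight_bound"
        using mult_mono[OF Pb weight_le[OF yin[OF False]]] weight_nonneg by (simp add: abs_mult)
      moreover have "\<bar>t1 (snd z) - t2 (snd z)\<bar> \<le> 1 / e"
        using t0[of "snd z"] t_le[of "snd z"] by (simp add: abs_le_iff)
      ultimately show ?thesis unfolding g_def abs_mult[of "P _ _ * weight _ _"] using weight_bound_nonneg by (intro mult_mono) auto
    qed (use weight_bound_nonneg e in \<open>simp add: g_def\<close>)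
    show "g (fst z) (snd z) = 0" if "z \<notin> cbox (a, 0) (b + d, 1)" for z
    proof (rule ccontr)
      assume "g (fst z) (snd z) \<noteq> 0"
      then have "weight (fst z) (snd z) \<noteq> 0" "snd z \<in> {0..1}" using yin by (auto simp: g_def)
      then show False using weight_support that by (cases z) (auto simp: cbox_Pair_eq)
    qed
  qed
  have "0 \<le> (LINT z|lborel. P (fst z) (snd z) * psiy (fst z) (snd z) + F (fst z) (snd z) * psix (fst z) (snd z))"
    by (rule weak[OF test])
  also have "\<dots> \<le> (LINT z|lborel. g (fst z) (snd z))"
  proof (rule integral_mono_AE[OF i1 i2])
    show "AE z in lborel. P (fst z) (snd z) * psiy (fst z) (snd z) + F (fst z) (snd z) * psix (fst z) (snd z) \<le> g (fst z) (snd z)"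
      using ae
    proof eventually_elim
      case (elim z)
      obtain x y where z: "z = (x, y)" by (cases z)
      have "P x y * wy x y * chi y + F x y * wx x y * chi y \<le> 0"
      proof (cases "chi y = 0")
        case False
        then have "0 < y" "y < 1" using chi_supp[OF False] e by auto
        then have dc: "d * P x y \<le> F x y" "F x y \<le> c * P x y" using elim by (auto simp: z)
        \<comment> \<open>The derivatives of the weight group by its two edges: the left one comes
          with \<open>F - c P\<close> and the right one with \<open>d P - F\<close>, both
          nonpositive.\<close>
        have "P x y * wy x y + F x y * wx x y =
          2 * max 0 (x - c * y - a) * sqp (b + d * y - x) * (F x y - c * P x y) +
          sqp (x - c * y - a) * (2 * max 0 (b + d * y - x)) * (d * P x y - F x y)"
          unfolding wy_def wx_def by (simp add: algebra_simps)
        also have "\<dots> \<le> 0" using dc by (intro add_nonpos_nonpos mult_nonneg_nonpos) auto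
        finally have "(P x y * wy x y + F x y * wx x y) * chi y \<le> 0" using chi0 by (rule mult_nonpos_nonneg)
        then show ?thesis by (simp add: algebra_simps)
      qed simp
      then show ?case by (simp add: z psix_def psiy_def g_def algebra_simps)
    qed
  qed
  also have "\<dots> = (LINT y|lborel. LINT x|lborel. g x y)"
    using lborel_pair.integral_snd[of g] i2 by (simp add: lborel_prod case_prod_unfold)
  also have "\<dots> = (LINT y|lborel. mass y * (t1 y - t2 y))"
    by (simp add: g_def mass_def)
  also have "\<dots> \<le> (LINT y|lborel. C1 * t1 y - C2 * t2 y)"
  proof (rule integral_mono)
    have "integrable (lborel \<Otimes>\<^sub>M lborel) (\<lambda>(x, y). g x y)" using i2 by (simp add: lborel_prod case_prod_unfold)
    from lborel_pair.integrable_snd[OF this] show "integrable lborel (\<lambda>y. mass y * (t1 y - t2 y))"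
      by (simp add: g_def mass_def)
    show "integrable lborel (\<lambda>y. C1 * t1 y - C2 * t2 y)"
      unfolding t1_def t2_def using integral_tent(1)[OF e(1)] by (intro Bochner_Integration.integrable_diff integrable_mult_right)
    fix y
    have "mass y * t1 y \<le> C1 * t1 y"
    proof (cases "t1 y = 0")
      case False
      then have "dist y y1 < e1" using t_supp(1)[OF False] e by (simp add: dist_real_def)
      then show ?thesis using e1(2) t0 by (intro mult_right_mono) (auto intro: less_imp_le)
    qed simp
    moreover have "C2 * t2 y \<le> mass y * t2 y"
    proof (cases "t2 y = 0")
      case False
      then have "dist y y2 < e2" using t_supp(2)[OF False] e by (simp add: dist_real_def)
      then show ?thesis using e2(2) t0 by (intro mult_right_mono) (auto intro: less_imp_le)
    qed simp
    ultimately show "mass y * (t1 y - t2 y) \<le> C1 * t1 y - C2 * t2 y" by (simp add: algebra_simps)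
  qed
  also have "\<dots> = C1 - C2"
    using integral_tent[OF e(1), of y1] integral_tent[OF e(1), of y2] by (simp add: t1_def[symmetric] t2_def[symmetric])
  finally show False using C by simp
qed

text \<open>\<open>mass_decreasing\<close> covers only interior times; the endpoints follow by
  continuity along the times \<open>y * r n\<close> and \<open>y * (1 - r n)\<close>.\<close>

lemma mass_le_initial: assumes y: "y \<in> {0..1}" shows "mass y \<le> mass 0"
proof (cases "y = 0")
  case False
  then have y0: "0 < y" using y by simp
  define r where "r n = 1 / (real n + 3)" for n
  have r: "0 < r n" "r n < 1 / 2" for n by (auto simp: r_def field_simps)
  have rlim: "r \<longlonglongrightarrow> 0" unfolding r_def by real_asymp
  have in1: "y * r n \<in> {0..1}" "y * (1 - r n) \<in> {0..1}" for n
    using r[of n] y mult_le_one[of y "r n"] mult_le_one[of y "1 - r n"] by auto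
  have "(\<lambda>n. y * r n) \<longlonglongrightarrow> y * 0" "(\<lambda>n. y * (1 - r n)) \<longlonglongrightarrow> y * (1 - 0)"
    by (intro tendsto_mult tendsto_diff tendsto_const rlim)+
  then have "(\<lambda>n. mass (y * r n)) \<longlonglongrightarrow> mass 0" "(\<lambda>n. mass (y * (1 - r n))) \<longlonglongrightarrow> mass y"
    using in1 y by (auto intro!: continuous_on_tendsto_compose[OF continuous_mass] always_eventually)
  moreover have "mass (y * (1 - r n)) \<le> mass (y * r n)" for n
  proof (rule mass_decreasing)
    show "0 < y * r n" using y0 r[of n] by simp
    show "y * r n < y * (1 - r n)" using y0 r[of n] by simp
    have "y * (1 - r n) < y * 1" using y0 r[of n] by (intro mult_strict_left_mono) auto
    then show "y * (1 - r n) < 1" using y by simp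
  qed
  ultimately show ?thesis by (intro LIMSEQ_le[of "\<lambda>n. mass (y * (1 - r n))" _ "\<lambda>n. mass (y * r n)"]) auto
qed simp

end

section \<open>Concavity of the flux\<close>

context six_vertex
begin

definition den :: "real \<Rightarrow> real" where "den z = (b2 - b1) * z + (1 - b2)"

lemma den_pos: "0 \<le> z \<Longrightarrow> 0 < den z" unfolding den_def by (rule flux_den_pos)

lemma den_mono: "x \<le> y \<Longrightarrow> den x \<le> den y"
  unfolding den_def using b by (intro add_right_mono mult_left_mono) auto

text \<open>Exhibits the secant slope as a decreasing function of each endpoint, the form in which
  concavity is used.\<close>

lemma flux_diff:
  assumes "0 \<le> x" "0 \<le> y"
  shows "flux y - flux x = (1 - b1) * (1 - b2) / (den x * den y) * (y - x)"
proof -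
  have "flux y - flux x = ((1 - b1) * y * den x - (1 - b1) * x * den y) / (den x * den y)"
    using den_pos[OF assms(1)] den_pos[OF assms(2)] unfolding flux_alt den_def[symmetric] by (simp add: diff_frac_eq mult.commute)
  also have "(1 - b1) * y * den x - (1 - b1) * x * den y = (1 - b1) * (1 - b2) * (y - x)"
    by (simp add: den_def algebra_simps)
  finally show ?thesis by simp
qed

text \<open>Secant slopes are largest towards 0, where the slope is \<open>kappa b1 b2\<close>; this
  is the maximal speed of propagation.\<close>

lemma flux_lipschitz:
  assumes "0 \<le> x" "x \<le> y"
  shows "0 \<le> flux y - flux x" "flux y - flux x \<le> kappa b1 b2 * (y - x)"
proof -
  have d: "0 < den x" "0 < den y" using den_pos assms by auto
  show "0 \<le> flux y - flux x" using flux_diff[of x y] assms d b by simp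
  have "den 0 \<le> den x" "den 0 \<le> den y" "0 < den 0" using assms den_pos by (auto intro!: den_mono)
  then have "(1 - b1) * (1 - b2) / (den x * den y) \<le> (1 - b1) * (1 - b2) / (den 0 * den 0)"
    using b d by (intro divide_left_mono mult_mono mult_pos_pos) auto
  also have "\<dots> = kappa b1 b2" using b by (simp add: den_def kappa_def)
  finally show "flux y - flux x \<le> kappa b1 b2 * (y - x)"
    unfolding flux_diff[OF assms(1) order_trans[OF assms]] using assms by (intro mult_right_mono) auto
qed

lemma flux_0 [simp]: "flux 0 = 0" and flux_1 [simp]: "flux 1 = 1"
  using b by (simp_all add: flux_alt)

lemma flux_measurable [measurable]: "flux \<in> borel_measurable borel"
  unfolding phi_def[abs_def] by measurable

end

context shock
begin

lemma speed_alt: "speed = (1 - b1) * (1 - b2) / (den \<theta> * den \<rho>)"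
  using flux_diff[of \<theta> \<rho>] dens by (simp add: speed_def)

lemma speed_nonneg: "0 \<le> speed" by (simp add: speed_def)

text \<open>Lowering the right endpoint from \<open>\<rho>\<close> to \<open>g\<close> raises the
  secant slope, and raising the left endpoint from \<open>\<theta>\<close> to \<open>g\<close>
  lowers it.\<close>

lemma flux_chord:
  assumes "\<theta> \<le> g" "g \<le> \<rho>"
  shows "speed * (g - \<theta>) \<le> flux g - flux \<theta>" "flux \<rho> - flux g \<le> speed * (\<rho> - g)"
proof -
  have g0: "0 \<le> g" using assms dens by linarith
  have d: "0 < den \<theta>" "0 < den \<rho>" "0 < den g" "den g \<le> den \<rho>" "den \<theta> \<le> den g"
    using den_pos[of \<theta>] den_pos[of \<rho>] den_pos[of g] den_mono[of g \<rho>] den_mono[of \<theta> g] g0 assms by auto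
  have "speed \<le> (1 - b1) * (1 - b2) / (den \<theta> * den g)"
    unfolding speed_alt using d b by (intro divide_left_mono mult_left_mono mult_pos_pos mult_nonneg_nonneg) auto
  then show "speed * (g - \<theta>) \<le> flux g - flux \<theta>"
    unfolding flux_diff[OF dens(1) g0] using assms by (intro mult_right_mono) auto
  have "(1 - b1) * (1 - b2) / (den g * den \<rho>) \<le> speed"
    unfolding speed_alt using d b by (intro divide_left_mono mult_right_mono mult_pos_pos mult_nonneg_nonneg) auto
  then show "flux \<rho> - flux g \<le> speed * (\<rho> - g)"
    unfolding flux_diff[OF g0 dens_simps(1)] using assms by (intro mult_right_mono) auto
qed

end

text \<open>The two inequalities are added, while \<open>\<alpha>\<close> and \<open>\<beta>\<close>
  integrate to zero against the derivatives of the test function. This yields one-sided entropies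
  and centred densities from the Kruzkov inequalities.\<close>

lemma test_fn_combine:
  fixes U V U' V' P F :: "real \<times> real \<Rightarrow> real"
  assumes t: "test_fn psi psix psiy"
    and m: "U \<in> borel_measurable borel" "V \<in> borel_measurable borel" "U' \<in> borel_measurable borel" "V' \<in> borel_measurable borel"
    and b: "\<And>z. \<bar>U z\<bar> \<le> M" "\<And>z. \<bar>V z\<bar> \<le> M" "\<And>z. \<bar>U' z\<bar> \<le> M" "\<And>z. \<bar>V' z\<bar> \<le> M"
    and nonneg: "0 \<le> (LINT z|lborel. U z * psiy (fst z) (snd z) + V z * psix (fst z) (snd z))"
      "0 \<le> (LINT z|lborel. U' z * psiy (fst z) (snd z) + V' z * psix (fst z) (snd z))"
    and r: "0 < r" "\<And>z. r * P z = U z + U' z + \<alpha>" "\<And>z. r * F z = V z + V' z + \<beta>"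
  shows "0 \<le> (LINT z|lborel. P z * psiy (fst z) (snd z) + F z * psix (fst z) (snd z))"
proof -
  have int: "integrable lborel (\<lambda>z. Y z * psix (fst z) (snd z))" "integrable lborel (\<lambda>z. Y z * psiy (fst z) (snd z))"
    if "Y \<in> borel_measurable borel" "\<And>z. \<bar>Y z\<bar> \<le> N" for Y :: "real \<times> real \<Rightarrow> real" and N
    using test_fn_integrable[OF t that] by auto
  note i = int[OF m(1) b(1)] int[OF m(2) b(2)] int[OF m(3) b(3)] int[OF m(4) b(4)]
  have c: "integrable lborel (\<lambda>z. \<gamma> * psix (fst z) (snd z))" "integrable lborel (\<lambda>z. \<gamma> * psiy (fst z) (snd z))" for \<gamma>
    using int[of "\<lambda>_. \<gamma>" "\<bar>\<gamma>\<bar>"] by auto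
  have PF: "P z = (U z + U' z + \<alpha>) / r" "F z = (V z + V' z + \<beta>) / r" for z
    using r by (simp_all add: field_simps flip: r(2,3))
  have "(LINT z|lborel. P z * psiy (fst z) (snd z) + F z * psix (fst z) (snd z)) =
    (LINT z|lborel. ((U z * psiy (fst z) (snd z) + V z * psix (fst z) (snd z)) +
      (U' z * psiy (fst z) (snd z) + V' z * psix (fst z) (snd z)) +
      (\<alpha> * psiy (fst z) (snd z) + \<beta> * psix (fst z) (snd z))) / r)"
    unfolding PF by (intro Bochner_Integration.integral_cong refl) (use r(1) in \<open>simp add: field_simps\<close>)
  also have "\<dots> = ((LINT z|lborel. U z * psiy (fst z) (snd z) + V z * psix (fst z) (snd z)) +
      (LINT z|lborel. U' z * psiy (fst z) (snd z) + V' z * psix (fst z) (snd z)) +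
      (LINT z|lborel. \<alpha> * psiy (fst z) (snd z) + \<beta> * psix (fst z) (snd z))) / r"
    using i c by (simp del: integral_divide add: Bochner_Integration.integral_divide_zero)
  also have "(LINT z|lborel. \<alpha> * psiy (fst z) (snd z) + \<beta> * psix (fst z) (snd z)) = 0"
    using c[of \<alpha>] c[of \<beta>] test_fn_integral_0[OF t] by simp
  finally show ?thesis using nonneg r(1) by simp
qed

lemma AE_interval_exists:
  assumes "AE x in lborel. Q x" "p < (q::real)"
  shows "\<exists>x. p < x \<and> x < q \<and> Q x"
proof (rule ccontr)
  assume "\<not> ?thesis"
  then have "AE x in lborel. x \<notin> {p<..<q}" using assms(1) by (auto elim!: eventually_mono)
  then have "emeasure lborel {p<..<q} = 0" by (subst (asm) AE_iff_measurable[of "{p<..<q}"]) auto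
  then show False using assms(2) by simp
qed

text \<open>Points with value \<open>v\<close> accumulate at \<open>u\<close> even if
  \<open>u\<close> is an endpoint of the interval, and continuity passes to the limit.\<close>

lemma AE_eq_imp_eq_isCont:
  fixes g :: "real \<Rightarrow> real"
  assumes ae: "AE x in lborel. l < x \<and> x < r \<longrightarrow> g x = v" and u: "l \<le> u" "u \<le> r" "l < r" and g: "isCont g u"
  shows "g u = v"
proof -
  have "\<exists>x. max l (u - 1 / (real n + 1)) < x \<and> x < min r (u + 1 / (real n + 1)) \<and> (l < x \<and> x < r \<longrightarrow> g x = v)" for n :: nat
  proof (rule AE_interval_exists[OF ae])
    have *: "max l (u - e) < min r (u + e)" if "0 < e" for e using that u by (auto simp: max_def min_def)
    show "max l (u - 1 / (real n + 1)) < min r (u + 1 / (real n + 1))" by (rule *) simp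
  qed
  then obtain x where x: "\<And>n. max l (u - 1 / (real n + 1)) < x n \<and> x n < min r (u + 1 / (real n + 1)) \<and> (l < x n \<and> x n < r \<longrightarrow> g (x n) = v)"
    by metis
  have "(\<lambda>n. u - 1 / (real n + 1)) \<longlonglongrightarrow> u" "(\<lambda>n. u + 1 / (real n + 1)) \<longlonglongrightarrow> u" by real_asymp+
  then have "x \<longlonglongrightarrow> u"
    by (rule tendsto_sandwich[rotated 2]) (use x in \<open>auto intro!: always_eventually less_imp_le\<close>)
  then have "(\<lambda>n. g (x n)) \<longlonglongrightarrow> g u" by (rule isCont_tendsto_compose[OF g])
  moreover have "g (x n) = v" for n using x[of n] by auto
  ultimately have "(\<lambda>n::nat. v) \<longlonglongrightarrow> g u" by simp
  then show ?thesis using LIMSEQ_unique[OF tendsto_const] by metis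
qed

lemma AE_nat_interval:
  assumes "\<And>N::nat. AE x in lborel. - real N + l < x \<and> x < real N \<longrightarrow> Q x"
  shows "AE x in lborel. Q x"
proof -
  have "AE x in lborel. \<forall>N::nat. - real N + l < x \<and> x < real N \<longrightarrow> Q x"
    using assms by (intro AE_all_countable[THEN iffD2] allI)
  then show ?thesis
  proof eventually_elim
    case (elim x)
    obtain N :: nat where "max (l - x) x < real N" using reals_Archimedean2 by blast
    then show ?case using elim[rule_format, of N] by simp
  qed
qed

section \<open>The Riemann problem with shock data\<close>

locale riemann = shock +
  fixes G :: "real \<Rightarrow> real \<Rightarrow> real"
  assumes ent: "entropy_solution flux (\<lambda>x. if x \<le> 0 then \<theta> else \<rho>) G"
begin

lemma G_measurable: "(\<lambda>z. G (fst z) (snd z)) \<in> borel_measurable borel"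
  and G_range: "0 \<le> G x y" "G x y \<le> 1"
  and G_initial: "G x 0 = (if x \<le> 0 then \<theta> else \<rho>)"
  and G_continuous: "y0 \<in> {0..1} \<Longrightarrow>
        ((\<lambda>y. LINT x|lborel. indicator {-R..R} x * \<bar>G x y - G x y0\<bar>) \<longlongrightarrow> 0) (at y0 within {0..1})"
  and G_entropy: "test_fn psi psix psiy \<Longrightarrow>
        0 \<le> (LINT z|lborel. \<bar>G (fst z) (snd z) - k\<bar> * psiy (fst z) (snd z)
             + sgn (G (fst z) (snd z) - k) * (flux (G (fst z) (snd z)) - flux k) * psix (fst z) (snd z))"
  using ent unfolding entropy_solution_def by auto

lemma compose_G: "p \<in> borel_measurable borel \<Longrightarrow> (\<lambda>z. p (G (fst z) (snd z)) :: real) \<in> borel_measurable borel"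
  by (rule measurable_compose[OF G_measurable])

lemma compose_G1: "p \<in> borel_measurable borel \<Longrightarrow> (\<lambda>x. p (G x y) :: real) \<in> borel_measurable borel"
  using measurable_compose[OF _ compose_G, of "\<lambda>x. (x, y)" borel p] by simp

lemma flux_G: "0 \<le> flux (G x y)" "flux (G x y) \<le> 1"
  using flux_bounds G_range by auto

text \<open>The weighted mass of \<open>p (G x y)\<close> vanishes at time 0 and cannot grow. Being
  nonnegative at time \<open>y\<close>, it is zero there, and the weight is positive exactly between
  the two moving edges.\<close>

lemma transport_zero:
  assumes p: "p \<in> borel_measurable borel" "\<And>g. 0 \<le> g \<Longrightarrow> g \<le> 1 \<Longrightarrow> \<bar>p g\<bar> \<le> 1"
      "\<And>g h. 0 \<le> g \<Longrightarrow> g \<le> 1 \<Longrightarrow> 0 \<le> h \<Longrightarrow> h \<le> 1 \<Longrightarrow> \<bar>p g - p h\<bar> \<le> \<bar>g - h\<bar>"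
    and f: "f \<in> borel_measurable borel" "\<And>g. 0 \<le> g \<Longrightarrow> g \<le> 1 \<Longrightarrow> \<bar>f g\<bar> \<le> 1"
    and weak: "\<And>psi psix psiy. test_fn psi psix psiy \<Longrightarrow>
      0 \<le> (LINT z|lborel. p (G (fst z) (snd z)) * psiy (fst z) (snd z) + f (G (fst z) (snd z)) * psix (fst z) (snd z))"
    and ae: "AE z in lborel. 0 < snd z \<and> snd z < 1 \<longrightarrow>
      d * p (G (fst z) (snd z)) \<le> f (G (fst z) (snd z)) \<and> f (G (fst z) (snd z)) \<le> c * p (G (fst z) (snd z))"
    and cd: "0 \<le> c" "0 \<le> d" and y: "y \<in> {0..1}"
    and init: "\<And>x. a < x \<Longrightarrow> x < b \<Longrightarrow> p (G x 0) = 0"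
    and nonneg: "AE x in lborel. 0 \<le> p (G x y)"
  shows "AE x in lborel. a + c * y < x \<and> x < b + d * y \<longrightarrow> p (G x y) = 0"
proof -
  interpret T: transport "\<lambda>x y. p (G x y)" "\<lambda>x y. f (G x y)" 1 a b c d
  proof
    fix R y0 :: real assume y0: "y0 \<in> {0..1}"
    have int: "integrable lborel (\<lambda>x. indicator {-R..R} x * \<bar>q (G x y) - q (G x y0)\<bar>)"
      if "q \<in> borel_measurable borel" "\<And>g. 0 \<le> g \<Longrightarrow> g \<le> 1 \<Longrightarrow> \<bar>q g\<bar> \<le> 1" for q :: "real \<Rightarrow> real" and y
    proof (rule integrable_bounded_box[where K = 2 and a = "-R" and b = R])
      show "(\<lambda>x. indicator {-R..R} x * \<bar>q (G x y) - q (G x y0)\<bar>) \<in> borel_measurable borel"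
        using compose_G1[OF that(1), of y] compose_G1[OF that(1), of y0] by measurable
      have "\<bar>q (G x y) - q (G x y0)\<bar> \<le> 2" for x using that(2)[of "G x y"] that(2)[of "G x y0"] G_range by (simp add: abs_le_iff)
      then show "\<bar>indicator {-R..R} x * \<bar>q (G x y) - q (G x y0)\<bar>\<bar> \<le> 2" for x by (auto simp: indicator_def)
    qed (auto simp: indicator_def)
    show "((\<lambda>y. LINT x|lborel. indicator {-R..R} x * \<bar>p (G x y) - p (G x y0)\<bar>) \<longlongrightarrow> 0) (at y0 within {0..1})"
    proof (rule tendsto_sandwich[OF always_eventually always_eventually tendsto_const G_continuous[OF y0, of R]]; intro allI)
      fix y
      show "0 \<le> (LINT x|lborel. indicator {-R..R} x * \<bar>p (G x y) - p (G x y0)\<bar>)"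
        by (intro integral_nonneg_AE AE_I2) simp
      have iG: "integrable lborel (\<lambda>x. indicator {-R..R} x * \<bar>G x y - G x y0\<bar>)"
        using int[of "\<lambda>g. g" y] by simp
      show "(LINT x|lborel. indicator {-R..R} x * \<bar>p (G x y) - p (G x y0)\<bar>) \<le> (LINT x|lborel. indicator {-R..R} x * \<bar>G x y - G x y0\<bar>)"
        using p(3) G_range by (intro integral_mono int[OF p(1,2)] iG mult_left_mono) auto
    qed
  qed (use p f weak ae cd compose_G G_range in auto)
  have "T.mass 0 = 0"
  proof -
    have "p (G x 0) * T.weight x 0 = 0" for x
      using init[of x] by (cases "a < x \<and> x < b") (auto simp: T.weight_def)
    then show ?thesis unfolding T.mass_def by (simp only: Bochner_Integration.integral_zero)
  qed
  then have le: "(LINT x|lborel. p (G x y) * T.weight x y) \<le> 0" using T.mass_le_initial[OF y] by (simp add: T.mass_def)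
  have ae0: "AE x in lborel. 0 \<le> p (G x y) * T.weight x y" using nonneg by eventually_elim (simp add: T.weight_nonneg)
  then have "(LINT x|lborel. p (G x y) * T.weight x y) = 0" using le integral_nonneg_AE[OF ae0] by simp
  then have "AE x in lborel. p (G x y) * T.weight x y = 0"
    using integral_nonneg_eq_0_iff_AE[OF T.integrable_weighted[OF y] ae0] by simp
  then show ?thesis by eventually_elim (auto simp: T.weight_def)
qed

text \<open>The constant 0 lies below all values of \<open>G\<close>, which makes the Kruzkov
  inequality linear; the constant 1 in \<open>weak_1\<close> gives the same with the opposite
  sign.\<close>

lemma weak_0:
  assumes "test_fn psi psix psiy"
  shows "0 \<le> (LINT z|lborel. G (fst z) (snd z) * psiy (fst z) (snd z) + flux (G (fst z) (snd z)) * psix (fst z) (snd z))"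
proof -
  have "\<bar>G x y - 0\<bar> = G x y" "sgn (G x y - 0) * (flux (G x y) - flux 0) = flux (G x y)" for x y
    using G_range[of x y] by (auto simp: sgn_if)
  then show ?thesis using G_entropy[OF assms, of 0] by (simp only:)
qed

lemma weak_1:
  assumes "test_fn psi psix psiy"
  shows "0 \<le> (LINT z|lborel. (1 - G (fst z) (snd z)) * psiy (fst z) (snd z) + (1 - flux (G (fst z) (snd z))) * psix (fst z) (snd z))"
proof -
  have "\<bar>G x y - 1\<bar> = 1 - G x y" "sgn (G x y - 1) * (flux (G x y) - flux 1) = 1 - flux (G x y)" for x y
    using G_range[of x y] by (auto simp: sgn_if)
  then show ?thesis using G_entropy[OF assms, of 1] by (simp only:)
qed

lemma meas_sgn: "(\<lambda>g. sgn (g - k) * (flux g - flux k)) \<in> borel_measurable borel"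
  unfolding sgn_if by measurable

lemma bound_sgn: "0 \<le> k \<Longrightarrow> k \<le> 1 \<Longrightarrow> \<bar>sgn (G x y - k) * (flux (G x y) - flux k)\<bar> \<le> 1"
  using flux_G[of x y] flux_bounds[of k] by (auto simp: abs_mult sgn_if abs_le_iff)

lemma flux_gap:
  assumes "0 \<le> g" "g \<le> 1"
  shows "\<bar>flux g - flux \<theta>\<bar> \<le> 1" "\<bar>flux \<theta> - flux g\<bar> \<le> 1" "\<bar>flux g - flux \<rho>\<bar> \<le> 1" "\<bar>flux \<rho> - flux g\<bar> \<le> 1"
  using flux_bounds[OF assms] flux_simps by linarith+

lemma G_init: "G x 0 = \<theta> \<or> G x 0 = \<rho>" by (simp add: G_initial)

text \<open>The negative part of \<open>G - \<theta>\<close> is half of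
  \<open>\<bar>G - \<theta>\<bar> + (1 - G) + (\<theta> - 1)\<close>, so its inequality combines the
  entropy at \<open>\<theta>\<close> with \<open>weak_1\<close>. It vanishes initially and hence at
  all times.\<close>

lemma G_ge: assumes y: "y \<in> {0..1}" shows "AE x in lborel. \<theta> \<le> G x y"
proof -
  let ?p = "\<lambda>g. max 0 (\<theta> - g)" and ?f = "\<lambda>g. if g < \<theta> then flux \<theta> - flux g else 0"
  have k: "0 \<le> kappa b1 b2" using b by (simp add: kappa_def)
  have mf: "?f \<in> borel_measurable borel" by measurable
  have mp: "?p \<in> borel_measurable borel" by measurable
  have lip: "?f g \<le> kappa b1 b2 * ?p g" "0 * ?p g \<le> ?f g" if "0 \<le> g" for g
    using flux_lipschitz[of g \<theta>] that k by (auto simp: max_def)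
  \<comment> \<open>The left edge moves with the maximal speed and the right edge rests, because all
    speeds lie between 0 and \<open>kappa b1 b2\<close>; letting \<open>N\<close> grow exhausts the
    line.\<close>
  have "AE x in lborel. - real N + kappa b1 b2 * y < x \<and> x < real N + 0 * y \<longrightarrow> ?p (G x y) = 0" for N
  proof (rule transport_zero[OF mp _ _ mf])
    show "\<bar>?p g\<bar> \<le> 1" if "0 \<le> g" "g \<le> 1" for g using that dens by linarith
    show "\<bar>?p g - ?p h\<bar> \<le> \<bar>g - h\<bar>" for g h by linarith
    show "\<bar>?f g\<bar> \<le> 1" if "0 \<le> g" "g \<le> 1" for g
      using flux_gap[OF that] by simp
    show "?p (G x 0) = 0" for x using G_init[of x] dens by auto
    show "AE z in lborel. 0 < snd z \<and> snd z < 1 \<longrightarrow>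
      0 * ?p (G (fst z) (snd z)) \<le> ?f (G (fst z) (snd z)) \<and> ?f (G (fst z) (snd z)) \<le> kappa b1 b2 * ?p (G (fst z) (snd z))"
      by (intro AE_I2 impI conjI lip G_range)
    show "0 \<le> (LINT z|lborel. ?p (G (fst z) (snd z)) * psiy (fst z) (snd z) + ?f (G (fst z) (snd z)) * psix (fst z) (snd z))"
      if t: "test_fn psi psix psiy" for psi psix psiy
    proof (rule test_fn_combine[OF t _ _ _ _ _ _ _ _ G_entropy[OF t, of \<theta>] weak_1[OF t], of 1 2 _ "\<theta> - 1" _ "flux \<theta> - 1"])
      show "\<bar>\<bar>G (fst z) (snd z) - \<theta>\<bar>\<bar> \<le> 1" "\<bar>1 - G (fst z) (snd z)\<bar> \<le> 1" "\<bar>1 - flux (G (fst z) (snd z))\<bar> \<le> 1" for z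
        using G_range[of "fst z" "snd z"] flux_G[of "fst z" "snd z"] dens by linarith+
      show "\<bar>sgn (G (fst z) (snd z) - \<theta>) * (flux (G (fst z) (snd z)) - flux \<theta>)\<bar> \<le> 1" for z by (rule bound_sgn) auto
      show "2 * ?p (G (fst z) (snd z)) = \<bar>G (fst z) (snd z) - \<theta>\<bar> + (1 - G (fst z) (snd z)) + (\<theta> - 1)" for z
        by (auto simp: max_def)
      show "2 * ?f (G (fst z) (snd z)) = sgn (G (fst z) (snd z) - \<theta>) * (flux (G (fst z) (snd z)) - flux \<theta>) +
        (1 - flux (G (fst z) (snd z))) + (flux \<theta> - 1)" for z
        by (auto simp: sgn_if)
      show "(\<lambda>z. \<bar>G (fst z) (snd z) - \<theta>\<bar>) \<in> borel_measurable borel" "(\<lambda>z. 1 - G (fst z) (snd z)) \<in> borel_measurable borel"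
        "(\<lambda>z. 1 - flux (G (fst z) (snd z))) \<in> borel_measurable borel"
        "(\<lambda>z. sgn (G (fst z) (snd z) - \<theta>) * (flux (G (fst z) (snd z)) - flux \<theta>)) \<in> borel_measurable borel"
        using compose_G[OF meas_sgn] by (auto intro!: compose_G[of "\<lambda>g. \<bar>g - \<theta>\<bar>"] compose_G[of "\<lambda>g. 1 - g"] compose_G[of "\<lambda>g. 1 - flux g"])
    qed simp
    show "0 \<le> kappa b1 b2" by (rule k)
    show "y \<in> {0..1}" by (rule y)
  qed simp_all
  then have "AE x in lborel. - real N + kappa b1 b2 * y < x \<and> x < real N \<longrightarrow> ?p (G x y) = 0" for N
    by (simp only: mult_zero_left add_0_right)
  then have "AE x in lborel. ?p (G x y) = 0" by (rule AE_nat_interval)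
  then show ?thesis by eventually_elim (simp add: max_def split: if_splits)
qed

lemma G_le: assumes y: "y \<in> {0..1}" shows "AE x in lborel. G x y \<le> \<rho>"
proof -
  let ?p = "\<lambda>g. max 0 (g - \<rho>)" and ?f = "\<lambda>g. if \<rho> < g then flux g - flux \<rho> else 0"
  have k: "0 \<le> kappa b1 b2" using b by (simp add: kappa_def)
  have mf: "?f \<in> borel_measurable borel" by measurable
  have mp: "?p \<in> borel_measurable borel" by measurable
  have lip: "?f g \<le> kappa b1 b2 * ?p g" "0 * ?p g \<le> ?f g" if "0 \<le> g" for g
    using flux_lipschitz[of \<rho> g] that k by (auto simp: max_def)
  have "AE x in lborel. - real N + kappa b1 b2 * y < x \<and> x < real N + 0 * y \<longrightarrow> ?p (G x y) = 0" for N
  proof (rule transport_zero[OF mp _ _ mf])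
    show "\<bar>?p g\<bar> \<le> 1" if "0 \<le> g" "g \<le> 1" for g using that dens by linarith
    show "\<bar>?p g - ?p h\<bar> \<le> \<bar>g - h\<bar>" for g h by linarith
    show "\<bar>?f g\<bar> \<le> 1" if "0 \<le> g" "g \<le> 1" for g
      using flux_gap[OF that] by simp
    show "?p (G x 0) = 0" for x using G_init[of x] dens by auto
    show "AE z in lborel. 0 < snd z \<and> snd z < 1 \<longrightarrow>
      0 * ?p (G (fst z) (snd z)) \<le> ?f (G (fst z) (snd z)) \<and> ?f (G (fst z) (snd z)) \<le> kappa b1 b2 * ?p (G (fst z) (snd z))"
      by (intro AE_I2 impI conjI lip G_range)
    show "0 \<le> (LINT z|lborel. ?p (G (fst z) (snd z)) * psiy (fst z) (snd z) + ?f (G (fst z) (snd z)) * psix (fst z) (snd z))"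
      if t: "test_fn psi psix psiy" for psi psix psiy
    proof (rule test_fn_combine[OF t _ _ _ _ _ _ _ _ G_entropy[OF t, of \<rho>] weak_0[OF t], of 1 2 _ "- \<rho>" _ "- flux \<rho>"])
      show "\<bar>\<bar>G (fst z) (snd z) - \<rho>\<bar>\<bar> \<le> 1" "\<bar>G (fst z) (snd z)\<bar> \<le> 1" "\<bar>flux (G (fst z) (snd z))\<bar> \<le> 1" for z
        using G_range[of "fst z" "snd z"] flux_G[of "fst z" "snd z"] dens by linarith+
      show "\<bar>sgn (G (fst z) (snd z) - \<rho>) * (flux (G (fst z) (snd z)) - flux \<rho>)\<bar> \<le> 1" for z by (rule bound_sgn) auto
      show "2 * ?p (G (fst z) (snd z)) = \<bar>G (fst z) (snd z) - \<rho>\<bar> + G (fst z) (snd z) + - \<rho>" for z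
        by (auto simp: max_def)
      show "2 * ?f (G (fst z) (snd z)) = sgn (G (fst z) (snd z) - \<rho>) * (flux (G (fst z) (snd z)) - flux \<rho>) +
        flux (G (fst z) (snd z)) + - flux \<rho>" for z
        by (auto simp: sgn_if)
      show "(\<lambda>z. \<bar>G (fst z) (snd z) - \<rho>\<bar>) \<in> borel_measurable borel" "(\<lambda>z. G (fst z) (snd z)) \<in> borel_measurable borel"
        "(\<lambda>z. flux (G (fst z) (snd z))) \<in> borel_measurable borel"
        "(\<lambda>z. sgn (G (fst z) (snd z) - \<rho>) * (flux (G (fst z) (snd z)) - flux \<rho>)) \<in> borel_measurable borel"
        using compose_G[OF meas_sgn] G_measurable by (auto intro!: compose_G[of "\<lambda>g. \<bar>g - \<rho>\<bar>"] compose_G[of flux])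
    qed simp
    show "0 \<le> kappa b1 b2" by (rule k)
    show "y \<in> {0..1}" by (rule y)
  qed simp_all
  then have "AE x in lborel. - real N + kappa b1 b2 * y < x \<and> x < real N \<longrightarrow> ?p (G x y) = 0" for N
    by (simp only: mult_zero_left add_0_right)
  then have "AE x in lborel. ?p (G x y) = 0" by (rule AE_nat_interval)
  then show ?thesis by eventually_elim (simp add: max_def split: if_splits)
qed

text \<open>The bounds hold for almost every \<open>x\<close> at each time; Fubini turns them into
  bounds almost everywhere in the strip, as the transport argument requires.\<close>

lemma G_between: "AE z in lborel. 0 < snd z \<and> snd z < 1 \<longrightarrow> \<theta> \<le> G (fst z) (snd z) \<and> G (fst z) (snd z) \<le> \<rho>"
proof -
  let ?Q = "\<lambda>x y. 0 < y \<and> y < 1 \<longrightarrow> \<theta> \<le> G x y \<and> G x y \<le> \<rho>"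
  have [measurable]: "(\<lambda>z. G (fst z) (snd z)) \<in> borel_measurable (borel \<Otimes>\<^sub>M borel)" using G_measurable by (simp add: borel_prod)
  have meas: "{z \<in> space (lborel \<Otimes>\<^sub>M lborel). ?Q (fst z) (snd z)} \<in> sets (lborel \<Otimes>\<^sub>M (lborel :: real measure))"
    by (measurable; simp)
  have "AE y in lborel. AE x in lborel. ?Q x y"
  proof (rule AE_I2)
    fix y
    show "AE x in lborel. ?Q x y"
    proof (cases "0 < y \<and> y < 1")
      case True
      then have "AE x in lborel. \<theta> \<le> G x y" "AE x in lborel. G x y \<le> \<rho>" by (auto intro!: G_ge G_le)
      then show ?thesis by eventually_elim simp
    next
      case False
      then show ?thesis by (intro AE_I2) auto
    qed
  qed
  then have "AE x in lborel. AE y in lborel. ?Q x y"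
    by (rule iffD2[OF lborel_pair.AE_commute[of ?Q, OF meas]])
  then have "AE z in lborel \<Otimes>\<^sub>M lborel. ?Q (fst z) (snd z)"
    by (intro lborel_pair.AE_pair_measure[OF meas]) simp
  then show ?thesis by (simp only: lborel_prod)
qed

text \<open>By \<open>flux_chord\<close> the nonnegative density \<open>G - \<theta>\<close> moves
  at least as fast as the shock. It starts on the right of the origin, so none of it is left behind
  the shock.\<close>

lemma G_left: "AE x in lborel. x < speed \<longrightarrow> G x 1 = \<theta>"
proof -
  let ?p = "\<lambda>g. g - \<theta>" and ?f = "\<lambda>g. flux g - flux \<theta>"
  have k: "0 \<le> kappa b1 b2" using b by (simp add: kappa_def)
  have "AE x in lborel. - real N + kappa b1 b2 * 1 < x \<and> x < 0 + speed * 1 \<longrightarrow> ?p (G x 1) = 0" for N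
  proof (rule transport_zero)
    show "\<bar>?p g\<bar> \<le> 1" if "0 \<le> g" "g \<le> 1" for g using that dens by linarith
    show "\<bar>?f g\<bar> \<le> 1" if "0 \<le> g" "g \<le> 1" for g
      using flux_gap[OF that] by simp
    show "?p (G x 0) = 0" if "x < 0" for x using that by (simp add: G_initial)
    show "AE z in lborel. 0 < snd z \<and> snd z < 1 \<longrightarrow>
      speed * ?p (G (fst z) (snd z)) \<le> ?f (G (fst z) (snd z)) \<and> ?f (G (fst z) (snd z)) \<le> kappa b1 b2 * ?p (G (fst z) (snd z))"
      using G_between by eventually_elim (auto simp: flux_chord intro!: flux_lipschitz)
    show "AE x in lborel. 0 \<le> ?p (G x 1)" using G_ge[of 1] by simp
    show "0 \<le> (LINT z|lborel. ?p (G (fst z) (snd z)) * psiy (fst z) (snd z) + ?f (G (fst z) (snd z)) * psix (fst z) (snd z))"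
      if t: "test_fn psi psix psiy" for psi psix psiy
      by (rule test_fn_combine[OF t G_measurable compose_G[OF flux_measurable] _ _ _ _ _ _ weak_0[OF t],
            of "\<lambda>_. 0" "\<lambda>_. 0" 1 1 _ "- \<theta>" _ "- flux \<theta>"]) (use G_range flux_G in auto)
  qed (use k speed_nonneg in \<open>auto intro: borel_measurable_diff flux_measurable\<close>)
  then have "AE x in lborel. \<forall>N::nat. - real N + kappa b1 b2 < x \<and> x < speed \<longrightarrow> G x 1 = \<theta>"
    by (intro AE_all_countable[THEN iffD2] allI) simp
  then show ?thesis
  proof eventually_elim
    case (elim x)
    obtain N :: nat where "kappa b1 b2 - x < real N" using reals_Archimedean2 by blast
    then show ?case using elim[rule_format, of N] by simp
  qed
qed

text \<open>Dually, \<open>\<rho> - G\<close> starts on the left of the origin and moves at most as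
  fast as the shock, so it never gets ahead of it.\<close>

lemma G_right: "AE x in lborel. speed < x \<longrightarrow> G x 1 = \<rho>"
proof -
  let ?p = "\<lambda>g. \<rho> - g" and ?f = "\<lambda>g. flux \<rho> - flux g"
  have "AE x in lborel. 0 + speed * 1 < x \<and> x < real N + 0 * 1 \<longrightarrow> ?p (G x 1) = 0" for N
  proof (rule transport_zero)
    show "\<bar>?p g\<bar> \<le> 1" if "0 \<le> g" "g \<le> 1" for g using that dens by linarith
    show "\<bar>?f g\<bar> \<le> 1" if "0 \<le> g" "g \<le> 1" for g
      using flux_gap[OF that] by simp
    show "?p (G x 0) = 0" if "0 < x" for x using that by (simp add: G_initial)
    show "AE z in lborel. 0 < snd z \<and> snd z < 1 \<longrightarrow>
      0 * ?p (G (fst z) (snd z)) \<le> ?f (G (fst z) (snd z)) \<and> ?f (G (fst z) (snd z)) \<le> speed * ?p (G (fst z) (snd z))"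
      using G_between
    proof eventually_elim
      case (elim z)
      then show ?case using flux_lipschitz(1)[of "G (fst z) (snd z)" \<rho>] G_range by (auto simp: flux_chord)
    qed
    show "AE x in lborel. 0 \<le> ?p (G x 1)" using G_le[of 1] by simp
    show "0 \<le> (LINT z|lborel. ?p (G (fst z) (snd z)) * psiy (fst z) (snd z) + ?f (G (fst z) (snd z)) * psix (fst z) (snd z))"
      if t: "test_fn psi psix psiy" for psi psix psiy
      by (rule test_fn_combine[OF t compose_G[of "\<lambda>g. 1 - g"] compose_G[of "\<lambda>g. 1 - flux g"] _ _ _ _ _ _ weak_1[OF t],
            of "\<lambda>_. 0" "\<lambda>_. 0" 1 1 _ "\<rho> - 1" _ "flux \<rho> - 1"]) (use G_range flux_G in auto)
  qed (use speed_nonneg in \<open>auto intro: borel_measurable_diff flux_measurable\<close>)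
  then have "AE x in lborel. \<forall>N::nat. speed < x \<and> x < real N \<longrightarrow> \<rho> = G x 1"
    by (intro AE_all_countable[THEN iffD2] allI) simp
  then show ?thesis
  proof eventually_elim
    case (elim x)
    obtain N :: nat where "x < real N" using reals_Archimedean2 by blast
    then show ?case using elim[rule_format, of N] by simp
  qed
qed

text \<open>At the shock position continuity would force both values \<open>\<theta>\<close> and
  \<open>\<rho>\<close>, which differ; elsewhere the value on the respective side is
  attained.\<close>

lemma G_value:
  assumes u: "isCont (\<lambda>x. G x 1) u"
  shows "u \<noteq> speed" "G u 1 = (if u < speed then \<theta> else \<rho>)"
proof -
  have l: "G u 1 = \<theta>" if "u \<le> speed"
    by (rule AE_eq_imp_eq_isCont[where l = "u - 1" and r = speed, OF _ _ _ _ u]) (use G_left that in auto)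
  have r: "G u 1 = \<rho>" if "speed \<le> u"
    by (rule AE_eq_imp_eq_isCont[where l = speed and r = "u + 1", OF _ _ _ _ u]) (use G_right that in auto)
  show "u \<noteq> speed" using l r dens by auto
  then show "G u 1 = (if u < speed then \<theta> else \<rho>)" using l r by auto
qed

end

theorem theorem4p9:
  fixes b1 b2 theta rho u :: real
    and G :: "real \<Rightarrow> real \<Rightarrow> real"
    and X :: "nat \<Rightarrow> int"
  assumes "0 < b1" and "b1 < b2" and "b2 < 1"
    and "0 \<le> theta" and "theta < rho" and "rho \<le> 1"
    and "entropy_solution (phi b1 b2) (\<lambda>x. if x \<le> 0 then theta else rho) G"
    and "isCont (\<lambda>x. G x 1) u"
    and "strict_mono X"
    and "(\<lambda>T. real_of_int (X T) / real T) \<longlonglongrightarrow> u"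
  shows "weak_conv_config (\<lambda>T. shiftM (X T) (sixv b1 b2 (Upsilon2 theta rho) T))
           (Upsilon (G u 1))"
proof -
  interpret riemann b1 b2 theta rho G
    using assms by unfold_locales auto
  show ?thesis
    using local_equilibrium[OF assms(9,10) G_value(1)[OF assms(8)]] G_value(2)[OF assms(8)] by simp
qed

end
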